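(* Let $n\ge 1$ be an integer, let $\alpha>-1$, let $w_\alpha(x)=(1+|x|^2)^{(\alpha+n+1)/2}$ for $x\in\mathbb{R}^n$, and let $f\in\mathcal{S}'(\mathbb{R}^n)$. Then the following assertions are equivalent: (i) $f\in w_\alpha\mathcal{D}'_{L^1}$. (ii) $f$ is $\mathcal{S}'$-convolvable with $\mathcal{K}_{\alpha,y}$ for each $y>0$. Furthermore, if $f\in w_\alpha\mathcal{D}'_{L^1}$ then, for each $y>0$, the $\mathcal{S}'$-convolution $\mathcal{K}_{\alpha,y}\ast f$ is the function on $\mathbb{R}^n$ given by $$\eta\mapsto\langle w_\alpha^{-1}f,\; w_\alpha\,\tau_\eta\mathcal{K}_{\alpha,y}\rangle_{\mathcal{D}'_{L^1},\mathcal{B}_c}.$$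
   Context: All function and distribution spaces are on $\mathbb{R}^n$. The kernel is $\mathcal{K}_\alpha(x,y)=\frac{\Gamma((\alpha+n+1)/2)}{\Gamma((\alpha+1)/2)\pi^{n/2}}\cdot\frac{y^{\alpha+1}}{(|x|^2+y^2)^{(\alpha+n+1)/2}}$ for $x\in\mathbb{R}^n$, $y>0$, and $\mathcal{K}_{\alpha,y}(x)=\mathcal{K}_\alpha(x,y)$. Translation is $\tau_\eta\varphi(x)=\varphi(x-\eta)$. $\mathcal{B}$ is the space of smooth $\varphi:\mathbb{R}^n\to\mathbb{C}$ such that $\varphi$ and all its derivatives are bounded; $\dot{\mathcal{B}}$ is the closed subspace of those $\varphi\in\mathcal{B}$ with $\partial^\beta\varphi(x)\to0$ as $|x|\to\infty$ for all multi-indices $\beta$ (topology: uniform convergence of all derivatives). $\mathcal{D}'_{L^1}$ is the dual of $\dot{\mathcal{B}}$; it is a space of tempered distributions, consisting exactly of the finite sums $u=\sum_\beta\partial^\beta u_\beta$ with $u_\beta\in L^1$. $\mathcal{B}_c$ is $\mathcal{B}$ endowed with the finest locally convex topology that on bounded subsets of $\mathcal{B}$ induces the topology inherited from $C^\infty$; every $u\in\mathcal{D}'_{L^1}$ extends uniquely to a continuous linear form on $\mathcal{B}_c$, and the pairing is $\langle u,\varphi\rangle_{\mathcal{D}'_{L^1},\mathcal{B}_c}=\sum_\beta(-1)^{|\beta|}\int u_\beta\,\partial^\beta\varphi\,dx$ for $\varphi\in\mathcal{B}$. The weighted space is $w_\alpha\mathcal{D}'_{L^1}=\{u\in\mathcal{S}':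 w_\alpha^{-1}u\in\mathcal{D}'_{L^1}\}$. $\mathcal{S}'$-convolution: two tempered distributions $u,v$ are $\mathcal{S}'$-convolvable if $u(\check v\ast\varphi)\in\mathcal{D}'_{L^1}$ for every $\varphi\in\mathcal{S}$, where $\check\varphi(x)=\varphi(-x)$ (extended to $\mathcal{S}'$ by duality) and $\check v\ast\varphi$ is the function $\eta\mapsto\langle v,\tau_{-\eta}\varphi\rangle_{\mathcal{S}',\mathcal{S}}$. Then $u\ast v\in\mathcal{S}'$ is defined by $\langle u\ast v,\varphi\rangle=\langle u(\check v\ast\varphi),1\rangle_{\mathcal{D}'_{L^1},\mathcal{B}_c}$. The $\mathcal{S}'$-convolution is commutative when defined. *)

theory Defs
  imports "HOL-Analysis.Analysis"
begin

section \<open>Locally convex topologies on complex spaces of functions\<close>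

definition function_space :: "('a \<Rightarrow> complex) set \<Rightarrow> bool" where
  "function_space V \<longleftrightarrow>
     (\<lambda>_. 0) \<in> V \<and>
     (\<forall>\<phi>\<in>V. \<forall>\<psi>\<in>V. (\<lambda>x. \<phi> x + \<psi> x) \<in> V) \<and>
     (\<forall>c. \<forall>\<phi>\<in>V. (\<lambda>x. c * \<phi> x) \<in> V)"

definition seminorm_on :: "('a \<Rightarrow> complex) set \<Rightarrow> (('a \<Rightarrow> complex) \<Rightarrow> real) \<Rightarrow> bool" where
  "seminorm_on V p \<longleftrightarrow>
     (\<forall>\<phi>\<in>V. 0 \<le> p \<phi>) \<and>
     (\<forall>\<phi>\<in>V. \<forall>\<psi>\<in>V. p (\<lambda>x. \<phi> x + \<psi> x) \<le> p \<phi> + p \<psi>) \<and>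
     (\<forall>c. \<forall>\<phi>\<in>V. p (\<lambda>x. c * \<phi> x) = cmod c * p \<phi>)"

text \<open>
  The set \<open>V\<close> itself is added to the subbasis only so that the topological space is \<open>V\<close>
  also for an empty family of seminorms.
\<close>

definition seminorm_topology ::
    "('a \<Rightarrow> complex) set \<Rightarrow> (('a \<Rightarrow> complex) \<Rightarrow> real) set \<Rightarrow> ('a \<Rightarrow> complex) topology" where
  "seminorm_topology V P =
     topology_generated_by
       (insert V {{\<psi>\<in>V. p (\<lambda>x. \<psi> x - \<phi> x) < e} | p \<phi> e. p \<in> P \<and> \<phi> \<in> V \<and> 0 < e})"

definition locally_convex_topology ::
    "('a \<Rightarrow> complex) set \<Rightarrow> ('a \<Rightarrow> complex) topology \<Rightarrow> bool" where
  "locally_convex_topology V T \<longleftrightarrow>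
     function_space V \<and> (\<exists>P. (\<forall>p\<in>P. seminorm_on V p) \<and> T = seminorm_topology V P)"

definition finer_topology :: "'a topology \<Rightarrow> 'a topology \<Rightarrow> bool" where
  "finer_topology T T' \<longleftrightarrow> (\<forall>U. openin T' U \<longrightarrow> openin T U)"

text \<open>
  Linear forms on a space \<open>V\<close> of functions are represented by functions that are defined on all
  functions; their values outside \<open>V\<close> are irrelevant.
\<close>

definition linear_form_on :: "('a \<Rightarrow> complex) set \<Rightarrow> (('a \<Rightarrow> complex) \<Rightarrow> complex) \<Rightarrow> bool" where
  "linear_form_on V u \<longleftrightarrow>
     (\<forall>\<phi>\<in>V. \<forall>\<psi>\<in>V. u (\<lambda>x. \<phi> x + \<psi> x) = u \<phi> + u \<psi>) \<and>
     (\<forall>c. \<forall>\<phi>\<in>V. u (\<lambda>x. c * \<phi> x) = c * u \<phi>)"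

definition dual_space :: "('a \<Rightarrow> complex) topology \<Rightarrow> (('a \<Rightarrow> complex) \<Rightarrow> complex) set" where
  "dual_space T = {u. linear_form_on (topspace T) u \<and> continuous_map T euclidean u}"


section \<open>Smooth functions on Euclidean space\<close>

definition partial_deriv :: "'n \<Rightarrow> (real^'n \<Rightarrow> complex) \<Rightarrow> real^'n \<Rightarrow> complex" where
  "partial_deriv i \<phi> x = frechet_derivative \<phi> (at x) (axis i 1)"

text \<open>
  Higher partial derivatives are indexed by words of coordinate directions: \<open>pderivs [i, j, k] \<phi>\<close>
  is the derivative of \<open>\<phi>\<close> with respect to \<open>x\<^sub>k\<close>, then \<open>x\<^sub>j\<close>, then \<open>x\<^sub>i\<close>.  On smooth functions
  the order does not matter, so these are exactly the derivatives with respect to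
  multi-indices, the order of the multi-index being the length of the word.
\<close>

definition pderivs :: "'n list \<Rightarrow> (real^'n \<Rightarrow> complex) \<Rightarrow> real^'n \<Rightarrow> complex" where
  "pderivs \<beta> \<phi> = foldr partial_deriv \<beta> \<phi>"

definition smooth_space :: "(real^'n \<Rightarrow> complex) set" where
  "smooth_space = {\<phi>. \<forall>\<beta> x. pderivs \<beta> \<phi> differentiable (at x)}"

definition smooth_topology :: "(real^'n \<Rightarrow> complex) topology" where
  "smooth_topology =
     seminorm_topology smooth_space
       {(\<lambda>\<phi>. SUP x\<in>K. cmod (pderivs \<beta> \<phi> x)) | K \<beta>. compact K \<and> K \<noteq> {}}"


section \<open>Tempered distributions\<close>

definition schwartz_space :: "(real^'n \<Rightarrow> complex) set" where
  "schwartz_space =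
     {\<phi>\<in>smooth_space. \<forall>k \<beta>. bounded (range (\<lambda>x. (1 + norm x) ^ k * cmod (pderivs \<beta> \<phi> x)))}"

definition schwartz_topology :: "(real^'n \<Rightarrow> complex) topology" where
  "schwartz_topology =
     seminorm_topology schwartz_space
       {(\<lambda>\<phi>. SUP x. (1 + norm x) ^ k * cmod (pderivs \<beta> \<phi> x)) | (k::nat) \<beta>. True}"

type_synonym 'n form = "(real^'n \<Rightarrow> complex) \<Rightarrow> complex"

definition tempered :: "'n::finite form set" where
  "tempered = dual_space schwartz_topology"

definition mult_dist :: "(real^'n \<Rightarrow> complex) \<Rightarrow> 'n form \<Rightarrow> 'n form" where
  "mult_dist h u = (\<lambda>\<phi>. u (\<lambda>x. h x * \<phi> x))"

definition dist_of_fun :: "(real^'n \<Rightarrow> complex) \<Rightarrow> 'n form" where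
  "dist_of_fun g = (\<lambda>\<phi>. \<integral>x. g x * \<phi> x \<partial>lborel)"

definition is_function :: "'n::finite form \<Rightarrow> (real^'n \<Rightarrow> complex) \<Rightarrow> bool" where
  "is_function u g \<longleftrightarrow>
     u \<in> tempered \<and>
     (\<forall>\<phi>\<in>schwartz_space. integrable lborel (\<lambda>x. g x * \<phi> x) \<and> u \<phi> = dist_of_fun g \<phi>)"

definition translate :: "real^'n \<Rightarrow> (real^'n \<Rightarrow> complex) \<Rightarrow> real^'n \<Rightarrow> complex" where
  "translate \<eta> \<phi> = (\<lambda>x. \<phi> (x - \<eta>))"


section \<open>Integrable distributions\<close>

definition B_space :: "(real^'n \<Rightarrow> complex) set" where
  "B_space = {\<phi>\<in>smooth_space. \<forall>\<beta>. bounded (range (pderivs \<beta> \<phi>))}"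

definition B_seminorms :: "((real^'n \<Rightarrow> complex) \<Rightarrow> real) set" where
  "B_seminorms = {(\<lambda>\<phi>. SUP x. cmod (pderivs \<beta> \<phi> x)) | \<beta>. True}"

definition B_topology :: "(real^'n \<Rightarrow> complex) topology" where
  "B_topology = seminorm_topology B_space B_seminorms"

definition B_bounded :: "(real^'n \<Rightarrow> complex) set \<Rightarrow> bool" where
  "B_bounded A \<longleftrightarrow> A \<subseteq> B_space \<and> (\<forall>p\<in>B_seminorms. bounded (p ` A))"

definition Bdot_space :: "(real^'n \<Rightarrow> complex) set" where
  "Bdot_space = {\<phi>\<in>B_space. \<forall>\<beta>. (pderivs \<beta> \<phi> \<longlongrightarrow> 0) at_infinity}"

definition Bdot_topology :: "(real^'n \<Rightarrow> complex) topology" where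
  "Bdot_topology = subtopology B_topology Bdot_space"

definition Bc_admissible :: "(real^'n \<Rightarrow> complex) topology \<Rightarrow> bool" where
  "Bc_admissible T \<longleftrightarrow>
     locally_convex_topology B_space T \<and>
     (\<forall>A. B_bounded A \<longrightarrow> subtopology T A = subtopology smooth_topology A)"

definition Bc_topology :: "(real^'n \<Rightarrow> complex) topology" where
  "Bc_topology = (THE T. Bc_admissible T \<and> (\<forall>T'. Bc_admissible T' \<longrightarrow> finer_topology T T'))"

text \<open>
  The Schwartz functions are dense in \<open>Bdot_space\<close>, so the dual of \<open>Bdot_space\<close> is a space of
  tempered distributions via restriction to Schwartz functions.
\<close>

definition DL1 :: "'n::finite form set" where
  "DL1 = {u\<in>tempered. \<exists>U\<in>dual_space Bdot_topology. \<forall>\<phi>\<in>schwartz_space. U \<phi> = u \<phi>}"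

text \<open>
  The pairing of \<open>u \<in> DL1\<close> with \<open>\<phi> \<in> B_space\<close> is the value at \<open>\<phi>\<close> of the unique extension of
  \<open>u\<close> to a continuous linear form for \<open>Bc_topology\<close>.
\<close>

definition DL1_pairing :: "'n::finite form \<Rightarrow> (real^'n \<Rightarrow> complex) \<Rightarrow> complex" where
  "DL1_pairing u \<phi> =
     (THE c. \<exists>U\<in>dual_space Bc_topology. (\<forall>\<psi>\<in>schwartz_space. U \<psi> = u \<psi>) \<and> U \<phi> = c)"


section \<open>Convolution of tempered distributions\<close>

text \<open>
  \<open>check_conv v \<phi>\<close> is the convolution with \<open>\<phi>\<close> of the reflection of \<open>v\<close>.
\<close>

definition check_conv :: "'n form \<Rightarrow> (real^'n \<Rightarrow> complex) \<Rightarrow> real^'n \<Rightarrow> complex" where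
  "check_conv v \<phi> = (\<lambda>\<eta>. v (translate (- \<eta>) \<phi>))"

definition S_convolvable :: "'n::finite form \<Rightarrow> 'n form \<Rightarrow> bool" where
  "S_convolvable u v \<longleftrightarrow>
     u \<in> tempered \<and> v \<in> tempered \<and>
     (\<forall>\<phi>\<in>schwartz_space. mult_dist (check_conv v \<phi>) u \<in> DL1)"

definition S_convolution :: "'n::finite form \<Rightarrow> 'n form \<Rightarrow> 'n form" where
  "S_convolution u v = (\<lambda>\<phi>. DL1_pairing (mult_dist (check_conv v \<phi>) u) (\<lambda>_. 1))"


section \<open>The kernel and the weighted space\<close>

definition alpha_kernel :: "real \<Rightarrow> real \<Rightarrow> real^'n \<Rightarrow> complex" where
  "alpha_kernel \<alpha> y x = complex_of_real
     (Gamma ((\<alpha> + real CARD('n) + 1) / 2) / (Gamma ((\<alpha> + 1) / 2) * pi powr (real CARD('n) / 2))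
      * (y powr (\<alpha> + 1) / ((norm x)\<^sup>2 + y\<^sup>2) powr ((\<alpha> + real CARD('n) + 1) / 2)))"

definition weight :: "real \<Rightarrow> real^'n \<Rightarrow> complex" where
  "weight \<alpha> x = complex_of_real ((1 + (norm x)\<^sup>2) powr ((\<alpha> + real CARD('n) + 1) / 2))"

definition weighted_DL1 :: "real \<Rightarrow> 'n::finite form set" where
  "weighted_DL1 \<alpha> = {u\<in>tempered. mult_dist (\<lambda>x. inverse (weight \<alpha> x)) u \<in> DL1}"

end

theory Submission
  imports Defs
begin

text \<open>
  All function spaces are described by one family of seminorms: \<open>jet m \<phi> x\<close> bounds the derivatives
  of \<open>\<phi>\<close> at \<open>x\<close> up to order \<open>m\<close>, and the symbols of order \<open>\<rho>\<close> are the smooth functions whose jets are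
  \<open>O((1 + \<bar>x\<bar>\<^sup>2) powr \<rho>)\<close>.  With \<open>s = (\<alpha> + n + 1) / 2\<close>, the weight \<open>w\<close> is a symbol of order \<open>s\<close>, the kernels
  \<open>K\<close> are symbols of order \<open>- s\<close>, and so is \<open>K * \<phi>\<close> for every Schwartz function \<open>\<phi>\<close>, by Peetre's
  inequality (\<open>convolution_alpha_kernel_symbol\<close>).

  A form \<open>u\<close> on the Schwartz functions belongs to \<open>DL1\<close> if and only if \<open>\<bar>u \<psi>\<bar> \<le> C sup (jet m \<psi>)\<close> for some
  \<open>m\<close> and \<open>C\<close> (\<open>DL1_jet_bounded_form\<close> and \<open>jet_bounded_form_DL1\<close>).  Consequently symbols of order zero
  multiply \<open>DL1\<close> into itself (\<open>DL1_mult\<close>), and the characterization of the weighted space follows by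
  multiplication and division.  If \<open>f / w\<close> is in \<open>DL1\<close>, then so is \<open>(K * \<phi>) f = (w (K * \<phi>)) (f / w)\<close>,
  since \<open>w (K * \<phi>)\<close> has order zero.  Conversely, if \<open>\<phi>\<close> is a Gaussian, then \<open>w (K * \<phi>)\<close> is moreover
  bounded away from zero (\<open>convolution_alpha_kernel_cutoff_ge\<close>), and its reciprocal has order zero;
  multiplying \<open>(K * \<phi>) f\<close> by the reciprocal recovers \<open>f / w\<close>.

  The pairing of \<open>DL1\<close> with bounded smooth functions is made explicit as a limit along Gaussian
  cutoffs.  The limit exists because a form in \<open>DL1\<close> is small on functions that live far out
  (\<open>jet_bounded_form_tail\<close>), and it is continuous for the finest topology in the definition of the
  pairing, which is generated by the seminorms that are continuous on bounded sets
  (\<open>Bc_topology_eq\<close>, \<open>extension_in_Bc_dual\<close>, \<open>DL1_pairing_eq\<close>).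

  For the representation of \<open>K * f\<close>, let \<open>L \<psi> = \<langle>f / w, w \<psi>\<rangle>\<close> for symbols \<open>\<psi>\<close> of order \<open>- s\<close>.  Continuous
  forms commute with convolutions (\<open>linear_form_convolution\<close>), since a convolution is a limit of
  linear combinations of translates.  Used twice, this gives the theorem: it turns the pairing of
  \<open>K (f\<^sup>\<or> * \<phi>)\<close> with a cutoff into \<open>L\<close> applied to a convolution with a cut off kernel, so that
  \<open>\<langle>K * f, \<phi>\<rangle> = L (K * \<phi>)\<close> in the limit (\<open>S_convolution_kernel\<close>), and it turns \<open>L (K * \<phi>)\<close> into the
  integral of \<open>\<phi> \<eta> * L (translate \<eta> K)\<close> over \<open>\<eta>\<close>.
\<close>

section \<open>Topologies generated by seminorms\<close>

lemma function_spaceD: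
  assumes "function_space V"
  shows function_space_zero: "(\<lambda>_. 0) \<in> V"
    and function_space_add: "\<phi> \<in> V \<Longrightarrow> \<psi> \<in> V \<Longrightarrow> (\<lambda>x. \<phi> x + \<psi> x) \<in> V"
    and function_space_cmult: "\<phi> \<in> V \<Longrightarrow> (\<lambda>x. c * \<phi> x) \<in> V"
  using assms unfolding function_space_def by auto

lemma function_space_diff:
  assumes "function_space V" "\<phi> \<in> V" "\<psi> \<in> V"
  shows "(\<lambda>x. \<phi> x - \<psi> x) \<in> V"
  using function_space_add[OF assms(1,2) function_space_cmult[OF assms(1,3), of "-1"]] by simp

lemma seminorm_onD:
  assumes "seminorm_on V p"
  shows seminorm_on_nonneg: "\<phi> \<in> V \<Longrightarrow> 0 \<le> p \<phi>"
    and seminorm_on_add: "\<phi> \<in> V \<Longrightarrow> \<psi> \<in> V \<Longrightarrow> p (\<lambda>x. \<phi> x + \<psi> x) \<le> p \<phi> + p \<psi>"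
    and seminorm_on_cmult: "\<phi> \<in> V \<Longrightarrow> p (\<lambda>x. c * \<phi> x) = cmod c * p \<phi>"
  using assms unfolding seminorm_on_def by auto

lemma seminorm_on_zero:
  assumes "seminorm_on V p" "function_space V"
  shows "p (\<lambda>_. 0) = 0"
  using seminorm_on_cmult[OF assms(1) function_space_zero[OF assms(2)], of 0] by simp

lemma linear_form_onD:
  assumes "linear_form_on V u"
  shows linear_form_on_add: "\<phi> \<in> V \<Longrightarrow> \<psi> \<in> V \<Longrightarrow> u (\<lambda>x. \<phi> x + \<psi> x) = u \<phi> + u \<psi>"
    and linear_form_on_cmult: "\<phi> \<in> V \<Longrightarrow> u (\<lambda>x. c * \<phi> x) = c * u \<phi>"
  using assms unfolding linear_form_on_def by auto

lemma linear_form_on_diff: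
  assumes "linear_form_on V u" "function_space V" "\<phi> \<in> V" "\<psi> \<in> V"
  shows "u (\<lambda>x. \<phi> x - \<psi> x) = u \<phi> - u \<psi>"
proof -
  have "u (\<lambda>x. \<phi> x + (-1) * \<psi> x) = u \<phi> + (-1) * u \<psi>"
    using linear_form_on_add[OF assms(1,3) function_space_cmult[OF assms(2,4), of "-1"]]
      linear_form_on_cmult[OF assms(1,4), of "-1"] by simp
  then show ?thesis by simp
qed

lemma seminorm_on_linear_form:
  assumes "linear_form_on V u"
  shows "seminorm_on V (\<lambda>\<phi>. cmod (u \<phi>))"
  unfolding seminorm_on_def
  by (auto simp: linear_form_on_add[OF assms] linear_form_on_cmult[OF assms] norm_mult
      intro: norm_triangle_ineq)

lemma topspace_seminorm_topology [simp]: "topspace (seminorm_topology V P) = V"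
  unfolding seminorm_topology_def by auto

lemma openin_seminorm_ball:
  assumes "finite F" "F \<subseteq> P" "\<phi> \<in> V" "0 < e"
  shows "openin (seminorm_topology V P) {\<psi>\<in>V. \<forall>p\<in>F. p (\<lambda>x. \<psi> x - \<phi> x) < e}"
proof -
  have "openin (seminorm_topology V P) {\<psi>\<in>V. p (\<lambda>x. \<psi> x - \<phi> x) < e}" if "p \<in> F" for p
    unfolding seminorm_topology_def
    by (rule topology_generated_by_Basis, rule insertI2, rule CollectI, rule exI[of _ p],
        rule exI[of _ \<phi>], rule exI[of _ e]) (use assms that in auto)
  moreover have "openin (seminorm_topology V P) V"
    using openin_topspace[of "seminorm_topology V P"] by simp
  ultimately have "openin (seminorm_topology V P) (\<Inter>(insert V ((\<lambda>p. {\<psi>\<in>V. p (\<lambda>x. \<psi> x - \<phi> x) < e}) ` F)))"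
    using assms by (intro openin_Inter) auto
  moreover have "\<Inter>(insert V ((\<lambda>p. {\<psi>\<in>V. p (\<lambda>x. \<psi> x - \<phi> x) < e}) ` F)) =
      {\<psi>\<in>V. \<forall>p\<in>F. p (\<lambda>x. \<psi> x - \<phi> x) < e}"
    by auto
  ultimately show ?thesis by simp
qed

text \<open>
  The finite intersections of seminorm balls centred at a point form a neighbourhood base of it;
  the triangle inequality allows to re-centre the balls of the defining subbasis.
\<close>

lemma openin_seminorm_topologyD:
  assumes V: "function_space V" and P: "\<forall>p\<in>P. seminorm_on V p"
    and U: "openin (seminorm_topology V P) U" and \<phi>U: "\<phi> \<in> U"
  shows "\<exists>F e. finite F \<and> F \<subseteq> P \<and> 0 < e \<and>
      (\<forall>\<psi>\<in>V. (\<forall>p\<in>F. p (\<lambda>x. \<psi> x - \<phi> x) < e) \<longrightarrow> \<psi> \<in> U)"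
proof -
  let ?B = "insert V {{\<psi>\<in>V. p (\<lambda>x. \<psi> x - \<phi> x) < e} | p \<phi> e. p \<in> P \<and> \<phi> \<in> V \<and> 0 < e}"
  have "generate_topology_on ?B U"
    using U unfolding seminorm_topology_def openin_topology_generated_by_iff by auto
  then show ?thesis
    using \<phi>U
  proof induction
    case Empty
    then show ?case by simp
  next
    case (Int a b)
    from Int.IH(1) Int.prems obtain F e where Fa:
      "finite F" "F \<subseteq> P" "0 < e" "\<forall>\<psi>\<in>V. (\<forall>p\<in>F. p (\<lambda>x. \<psi> x - \<phi> x) < e) \<longrightarrow> \<psi> \<in> a"
      by (elim exE conjE IntE) blast
    from Int.IH(2) Int.prems obtain F' e' where Fb:
      "finite F'" "F' \<subseteq> P" "0 < e'" "\<forall>\<psi>\<in>V. (\<forall>p\<in>F'. p (\<lambda>x. \<psi> x - \<phi> x) < e') \<longrightarrow> \<psi> \<in> b"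
      by (elim exE conjE IntE) blast
    from Fa Fb show ?case
      by (intro exI[of _ "F \<union> F'"] exI[of _ "min e e'"]) auto
  next
    case (UN K)
    then obtain k where k: "k \<in> K" "\<phi> \<in> k" by auto
    from UN.IH[OF k] obtain F e where "finite F" "F \<subseteq> P" "0 < e"
      "\<forall>\<psi>\<in>V. (\<forall>p\<in>F. p (\<lambda>x. \<psi> x - \<phi> x) < e) \<longrightarrow> \<psi> \<in> k" by (elim exE conjE)
    then show ?case
      using k(1) by (intro exI[of _ F] exI[of _ e]) auto
  next
    case (Basis s)
    then consider "s = V" | p \<phi>0 e where "p \<in> P" "\<phi>0 \<in> V" "0 < e"
      "s = {\<psi>\<in>V. p (\<lambda>x. \<psi> x - \<phi>0 x) < e}"
      by auto
    then show ?case
    proof cases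
      case 1
      then show ?thesis by (intro exI[of _ "{}"] exI[of _ 1]) auto
    next
      case 2
      then have \<phi>: "\<phi> \<in> V" "p (\<lambda>x. \<phi> x - \<phi>0 x) < e" using Basis.prems by auto
      have "\<psi> \<in> s" if "\<psi> \<in> V" "p (\<lambda>x. \<psi> x - \<phi> x) < e - p (\<lambda>x. \<phi> x - \<phi>0 x)" for \<psi>
      proof -
        have "p (\<lambda>x. (\<psi> x - \<phi> x) + (\<phi> x - \<phi>0 x)) \<le> p (\<lambda>x. \<psi> x - \<phi> x) + p (\<lambda>x. \<phi> x - \<phi>0 x)"
          by (intro seminorm_on_add[OF bspec[OF P 2(1)]] function_space_diff[OF V] that \<phi> 2)
        then show ?thesis using that 2 by simp
      qed
      then show ?thesis
        using 2 \<phi> by (intro exI[of _ "{p}"] exI[of _ "e - p (\<lambda>x. \<phi> x - \<phi>0 x)"]) auto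
    qed
  qed
qed

lemma openin_subtopology_seminorm:
  assumes V: "function_space V" and P: "\<forall>p\<in>P. seminorm_on V p" and A: "A \<subseteq> V"
  shows "openin (subtopology (seminorm_topology V P) A) U \<longleftrightarrow>
    U \<subseteq> A \<and> (\<forall>\<phi>\<in>U. \<exists>F e. finite F \<and> F \<subseteq> P \<and> 0 < e \<and>
      (\<forall>\<psi>\<in>A. (\<forall>p\<in>F. p (\<lambda>x. \<psi> x - \<phi> x) < e) \<longrightarrow> \<psi> \<in> U))"
proof (intro iffI conjI ballI)
  assume "openin (subtopology (seminorm_topology V P) A) U"
  then obtain W where W: "openin (seminorm_topology V P) W" "U = W \<inter> A" by (auto simp: openin_subtopology)
  show "U \<subseteq> A" using W by auto
  fix \<phi> assume "\<phi> \<in> U"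
  then have "\<phi> \<in> W" using W by auto
  from openin_seminorm_topologyD[OF V P W(1) this] obtain F e where "finite F" "F \<subseteq> P" "0 < e"
    "\<forall>\<psi>\<in>V. (\<forall>p\<in>F. p (\<lambda>x. \<psi> x - \<phi> x) < e) \<longrightarrow> \<psi> \<in> W" by (elim exE conjE)
  then show "\<exists>F e. finite F \<and> F \<subseteq> P \<and> 0 < e \<and>
      (\<forall>\<psi>\<in>A. (\<forall>p\<in>F. p (\<lambda>x. \<psi> x - \<phi> x) < e) \<longrightarrow> \<psi> \<in> U)"
    using A W(2) by (intro exI[of _ F] exI[of _ e]) auto
next
  assume U: "U \<subseteq> A \<and> (\<forall>\<phi>\<in>U. \<exists>F e. finite F \<and> F \<subseteq> P \<and> 0 < e \<and>
      (\<forall>\<psi>\<in>A. (\<forall>p\<in>F. p (\<lambda>x. \<psi> x - \<phi> x) < e) \<longrightarrow> \<psi> \<in> U))"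
  show "openin (subtopology (seminorm_topology V P) A) U"
  proof (rule openin_subopen[THEN iffD2], rule ballI)
    fix \<phi> assume \<phi>: "\<phi> \<in> U"
    from bspec[OF conjunct2[OF U] \<phi>] obtain F e where F: "finite F" "F \<subseteq> P" "0 < e"
      "\<forall>\<psi>\<in>A. (\<forall>p\<in>F. p (\<lambda>x. \<psi> x - \<phi> x) < e) \<longrightarrow> \<psi> \<in> U" by (elim exE conjE)
    have \<phi>V: "\<phi> \<in> V" "\<phi> \<in> A" using \<phi> U A by auto
    let ?N = "{\<psi>\<in>V. \<forall>p\<in>F. p (\<lambda>x. \<psi> x - \<phi> x) < e}"
    have "openin (subtopology (seminorm_topology V P) A) (?N \<inter> A)"
      using openin_seminorm_ball[OF F(1,2) \<phi>V(1) F(3)] by (auto simp: openin_subtopology)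
    moreover have "\<phi> \<in> ?N \<inter> A"
      using F(2,3) \<phi>V P by (auto simp: subset_iff seminorm_on_zero[OF _ V])
    moreover have "?N \<inter> A \<subseteq> U" using F(4) by auto
    ultimately show "\<exists>T. openin (subtopology (seminorm_topology V P) A) T \<and> \<phi> \<in> T \<and> T \<subseteq> U"
      by (intro exI[of _ "?N \<inter> A"] conjI)
  qed
qed

lemma openin_seminorm_topology:
  assumes "function_space V" "\<forall>p\<in>P. seminorm_on V p"
  shows "openin (seminorm_topology V P) U \<longleftrightarrow>
    U \<subseteq> V \<and> (\<forall>\<phi>\<in>U. \<exists>F e. finite F \<and> F \<subseteq> P \<and> 0 < e \<and>
      (\<forall>\<psi>\<in>V. (\<forall>p\<in>F. p (\<lambda>x. \<psi> x - \<phi> x) < e) \<longrightarrow> \<psi> \<in> U))"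
  using openin_subtopology_seminorm[OF assms order_refl, of U]
    subtopology_topspace[of "seminorm_topology V P"] by simp

lemma continuous_map_subtopology_seminorm:
  fixes u :: "('a \<Rightarrow> complex) \<Rightarrow> complex"
  assumes V: "function_space V" and P: "\<forall>p\<in>P. seminorm_on V p" and A: "A \<subseteq> V"
  shows "continuous_map (subtopology (seminorm_topology V P) A) euclidean u \<longleftrightarrow>
    (\<forall>\<phi>\<in>A. \<forall>\<epsilon>>0. \<exists>F e. finite F \<and> F \<subseteq> P \<and> 0 < e \<and>
      (\<forall>\<psi>\<in>A. (\<forall>p\<in>F. p (\<lambda>x. \<psi> x - \<phi> x) < e) \<longrightarrow> cmod (u \<psi> - u \<phi>) < \<epsilon>))"
proof (intro iffI ballI allI impI)
  have top: "topspace (subtopology (seminorm_topology V P) A) = A" using A by auto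
  {
    fix \<phi> and \<epsilon> :: real
    assume u: "continuous_map (subtopology (seminorm_topology V P) A) euclidean u" and \<phi>: "\<phi> \<in> A" "0 < \<epsilon>"
    have "openin (subtopology (seminorm_topology V P) A) {\<psi>\<in>A. u \<psi> \<in> ball (u \<phi>) \<epsilon>}"
      using openin_continuous_map_preimage[OF u, of "ball (u \<phi>) \<epsilon>", unfolded top] by simp
    note nb = conjunct2[OF iffD1[OF openin_subtopology_seminorm[OF V P A] this]]
    have "\<phi> \<in> {\<psi>\<in>A. u \<psi> \<in> ball (u \<phi>) \<epsilon>}" using \<phi> by simp
    from bspec[OF nb this] obtain F e where F: "finite F" "F \<subseteq> P" "0 < e"
      "\<forall>\<psi>\<in>A. (\<forall>p\<in>F. p (\<lambda>x. \<psi> x - \<phi> x) < e) \<longrightarrow> \<psi> \<in> {\<psi>\<in>A. u \<psi> \<in> ball (u \<phi>) \<epsilon>}"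
      by (elim exE conjE)
    have "cmod (u \<psi> - u \<phi>) < \<epsilon>" if "\<psi> \<in> {\<psi>\<in>A. u \<psi> \<in> ball (u \<phi>) \<epsilon>}" for \<psi>
      using that by (simp add: dist_norm norm_minus_commute)
    then show "\<exists>F e. finite F \<and> F \<subseteq> P \<and> 0 < e \<and>
        (\<forall>\<psi>\<in>A. (\<forall>p\<in>F. p (\<lambda>x. \<psi> x - \<phi> x) < e) \<longrightarrow> cmod (u \<psi> - u \<phi>) < \<epsilon>)"
      using F by (intro exI[of _ F] exI[of _ e]) blast
  }
  assume cont: "\<forall>\<phi>\<in>A. \<forall>\<epsilon>>0. \<exists>F e. finite F \<and> F \<subseteq> P \<and> 0 < e \<and>
      (\<forall>\<psi>\<in>A. (\<forall>p\<in>F. p (\<lambda>x. \<psi> x - \<phi> x) < e) \<longrightarrow> cmod (u \<psi> - u \<phi>) < \<epsilon>)"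
  have "openin (subtopology (seminorm_topology V P) A) {\<phi>\<in>A. u \<phi> \<in> W}" if W: "open W" for W
    unfolding openin_subtopology_seminorm[OF V P A]
  proof (intro conjI ballI)
    fix \<phi> assume \<phi>: "\<phi> \<in> {\<phi>\<in>A. u \<phi> \<in> W}"
    then obtain \<epsilon> where \<epsilon>: "0 < \<epsilon>" "ball (u \<phi>) \<epsilon> \<subseteq> W"
      using open_contains_ball_eq[OF W, of "u \<phi>"] by auto
    have \<phi>A: "\<phi> \<in> A" using \<phi> by auto
    from cont[rule_format, OF \<phi>A \<epsilon>(1)] obtain F e where F: "finite F" "F \<subseteq> P" "0 < e"
      "\<forall>\<psi>\<in>A. (\<forall>p\<in>F. p (\<lambda>x. \<psi> x - \<phi> x) < e) \<longrightarrow> cmod (u \<psi> - u \<phi>) < \<epsilon>"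
      by (elim exE conjE)
    have "u \<psi> \<in> W" if "cmod (u \<psi> - u \<phi>) < \<epsilon>" for \<psi>
      using that \<epsilon>(2) by (auto simp: dist_norm norm_minus_commute)
    then show "\<exists>F e. finite F \<and> F \<subseteq> P \<and> 0 < e \<and>
        (\<forall>\<psi>\<in>A. (\<forall>p\<in>F. p (\<lambda>x. \<psi> x - \<phi> x) < e) \<longrightarrow> \<psi> \<in> {\<phi>\<in>A. u \<phi> \<in> W})"
      using F by (intro exI[of _ F] exI[of _ e]) auto
  qed auto
  then show "continuous_map (subtopology (seminorm_topology V P) A) euclidean u"
    unfolding continuous_map_def top by auto
qed

lemma continuous_map_seminorm:
  fixes u :: "('a \<Rightarrow> complex) \<Rightarrow> complex"
  assumes "function_space V" "\<forall>p\<in>P. seminorm_on V p"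
  shows "continuous_map (seminorm_topology V P) euclidean u \<longleftrightarrow>
    (\<forall>\<phi>\<in>V. \<forall>\<epsilon>>0. \<exists>F e. finite F \<and> F \<subseteq> P \<and> 0 < e \<and>
      (\<forall>\<psi>\<in>V. (\<forall>p\<in>F. p (\<lambda>x. \<psi> x - \<phi> x) < e) \<longrightarrow> cmod (u \<psi> - u \<phi>) < \<epsilon>))"
  using continuous_map_subtopology_seminorm[OF assms order_refl, of u]
    subtopology_topspace[of "seminorm_topology V P"] by simp

text \<open>All seminorms of interest are weighted suprema of a linear operator applied to the function.\<close>

lemma seminorm_on_SUP:
  assumes V: "function_space V" and K: "K \<noteq> {}" and q: "\<And>x. 0 \<le> q x"
    and bdd: "\<And>\<phi>. \<phi> \<in> V \<Longrightarrow> bdd_above ((\<lambda>x. q x * cmod (D \<phi> x)) ` K)"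
    and add: "\<And>\<phi> \<psi> x. \<phi> \<in> V \<Longrightarrow> \<psi> \<in> V \<Longrightarrow> D (\<lambda>x. \<phi> x + \<psi> x) x = D \<phi> x + D \<psi> x"
    and cmult: "\<And>\<phi> c x. \<phi> \<in> V \<Longrightarrow> D (\<lambda>x. c * \<phi> x) x = c * D \<phi> x"
  shows "seminorm_on V (\<lambda>\<phi>. SUP x\<in>K. q x * cmod (D \<phi> x))"
  unfolding seminorm_on_def
proof (intro conjI ballI allI)
  obtain z where z: "z \<in> K" using K by auto
  fix \<phi> assume \<phi>: "\<phi> \<in> V"
  have "0 \<le> q z * cmod (D \<phi> z)" using q by simp
  also have "\<dots> \<le> (SUP x\<in>K. q x * cmod (D \<phi> x))" by (rule cSUP_upper[OF z bdd[OF \<phi>]])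
  finally show nonneg: "0 \<le> (SUP x\<in>K. q x * cmod (D \<phi> x))" .
  show "(SUP x\<in>K. q x * cmod (D (\<lambda>x. \<phi> x + \<psi> x) x)) \<le>
      (SUP x\<in>K. q x * cmod (D \<phi> x)) + (SUP x\<in>K. q x * cmod (D \<psi> x))" if \<psi>: "\<psi> \<in> V" for \<psi>
  proof (rule cSUP_least[OF K])
    fix x assume x: "x \<in> K"
    have "q x * cmod (D (\<lambda>x. \<phi> x + \<psi> x) x) \<le> q x * (cmod (D \<phi> x) + cmod (D \<psi> x))"
      unfolding add[OF \<phi> \<psi>] by (intro mult_left_mono norm_triangle_ineq q)
    also have "\<dots> \<le> (SUP x\<in>K. q x * cmod (D \<phi> x)) + (SUP x\<in>K. q x * cmod (D \<psi> x))"
      using cSUP_upper[OF x bdd[OF \<phi>]] cSUP_upper[OF x bdd[OF \<psi>]] by (simp add: algebra_simps)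
    finally show "q x * cmod (D (\<lambda>x. \<phi> x + \<psi> x) x) \<le>
      (SUP x\<in>K. q x * cmod (D \<phi> x)) + (SUP x\<in>K. q x * cmod (D \<psi> x))" .
  qed
  show "(SUP x\<in>K. q x * cmod (D (\<lambda>x. c * \<phi> x) x)) = cmod c * (SUP x\<in>K. q x * cmod (D \<phi> x))" for c
  proof -
    have le: "(SUP x\<in>K. q x * cmod (D (\<lambda>x. c * \<phi> x) x)) \<le> cmod c * (SUP x\<in>K. q x * cmod (D \<phi> x))"
      if \<phi>: "\<phi> \<in> V" for \<phi> c
    proof (rule cSUP_least[OF K])
      fix x assume x: "x \<in> K"
      show "q x * cmod (D (\<lambda>x. c * \<phi> x) x) \<le> cmod c * (SUP x\<in>K. q x * cmod (D \<phi> x))"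
        using mult_left_mono[OF cSUP_upper[OF x bdd[OF \<phi>]], of "cmod c"]
        unfolding cmult[OF \<phi>] by (simp add: norm_mult algebra_simps)
    qed
    show ?thesis
    proof (cases "c = 0")
      case True
      have "D (\<lambda>x. c * \<phi> x) x = 0" for x using cmult[OF \<phi>, of c x] True by simp
      then show ?thesis using True K by simp
    next
      case False
      have "(SUP x\<in>K. q x * cmod (D (\<lambda>x. inverse c * (c * \<phi> x)) x)) \<le>
          cmod (inverse c) * (SUP x\<in>K. q x * cmod (D (\<lambda>x. c * \<phi> x) x))"
        by (rule le) (rule function_space_cmult[OF V \<phi>])
      moreover have "(\<lambda>x. inverse c * (c * \<phi> x)) = \<phi>" using False by (auto simp: mult.assoc[symmetric])
      ultimately have "cmod c * (SUP x\<in>K. q x * cmod (D \<phi> x)) \<le>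
          (SUP x\<in>K. q x * cmod (D (\<lambda>x. c * \<phi> x) x))"
        using mult_left_mono[of _ _ "cmod c"] False by (fastforce simp: norm_inverse mult.assoc[symmetric])
      then show ?thesis using le[OF \<phi>, of c] by simp
    qed
  qed
qed

section \<open>Jets of smooth functions\<close>

lemma partial_deriv_eq:
  assumes "(\<phi> has_derivative D) (at x)"
  shows "partial_deriv i \<phi> x = D (axis i 1)"
  unfolding partial_deriv_def using frechet_derivative_at[OF assms] by simp

lemma has_derivative_partial_derivs:
  fixes \<phi> :: "real^'n \<Rightarrow> complex"
  assumes "\<phi> differentiable at x"
  shows "(\<phi> has_derivative (\<lambda>h. \<Sum>i\<in>UNIV. h $ i *\<^sub>R partial_deriv i \<phi> x)) (at x)"
proof -
  let ?D = "frechet_derivative \<phi> (at x)"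
  have D: "(\<phi> has_derivative ?D) (at x)" using assms frechet_derivative_works by blast
  then interpret bounded_linear ?D by (rule has_derivative_bounded_linear)
  have "?D h = (\<Sum>i\<in>UNIV. h $ i *\<^sub>R partial_deriv i \<phi> x)" for h
  proof -
    have "?D h = ?D (\<Sum>i\<in>UNIV. h $ i *\<^sub>R axis i 1)"
      using basis_expansion[of h] by (simp add: scalar_mult_eq_scaleR)
    then show ?thesis by (simp add: sum scaleR partial_deriv_def)
  qed
  then have "?D = (\<lambda>h. \<Sum>i\<in>UNIV. h $ i *\<^sub>R partial_deriv i \<phi> x)" by auto
  with D show ?thesis by simp
qed

lemma pderivs_Nil [simp]: "pderivs [] \<phi> = \<phi>"
  and pderivs_Cons [simp]: "pderivs (i # \<beta>) \<phi> = partial_deriv i (pderivs \<beta> \<phi>)"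
  and pderivs_snoc [simp]: "pderivs (\<beta> @ [i]) \<phi> = pderivs \<beta> (partial_deriv i \<phi>)"
  unfolding pderivs_def by auto

lemma smooth_spaceD:
  assumes "\<phi> \<in> smooth_space"
  shows smooth_differentiable: "\<phi> differentiable at x"
    and smooth_partial_deriv: "partial_deriv i \<phi> \<in> smooth_space"
    and smooth_pderivs: "pderivs \<beta> \<phi> \<in> smooth_space"
proof -
  show "\<phi> differentiable at x" using assms unfolding smooth_space_def by (auto dest: spec[of _ "[]"])
  have *: "partial_deriv i \<psi> \<in> smooth_space" if "\<psi> \<in> smooth_space" for \<psi> i
    using that unfolding smooth_space_def by (auto simp flip: pderivs_snoc)
  then show "partial_deriv i \<phi> \<in> smooth_space" using assms .
  show "pderivs \<beta> \<phi> \<in> smooth_space" by (induction \<beta>) (auto simp: assms *)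
qed

text \<open>
  The smooth functions are the largest class of differentiable functions that is closed under
  partial derivatives, which replaces inductions over all derivatives.
\<close>

lemma smooth_coinduct:
  assumes "\<phi> \<in> X"
    and "\<And>\<phi> x. \<phi> \<in> X \<Longrightarrow> \<phi> differentiable at x"
    and "\<And>\<phi> i. \<phi> \<in> X \<Longrightarrow> partial_deriv i \<phi> \<in> X"
  shows "\<phi> \<in> smooth_space"
proof -
  have "pderivs \<beta> \<phi> \<in> X" for \<beta> by (induction \<beta>) (auto simp: assms)
  then show ?thesis unfolding smooth_space_def using assms(2) by auto
qed

lemma smooth_has_derivative:
  "\<phi> \<in> smooth_space \<Longrightarrow>
    (\<phi> has_derivative (\<lambda>h. \<Sum>i\<in>UNIV. h $ i *\<^sub>R partial_deriv i \<phi> x)) (at x)"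
  by (intro has_derivative_partial_derivs smooth_differentiable)

lemma partial_deriv_add:
  assumes "\<phi> differentiable at x" "\<psi> differentiable at x"
  shows "partial_deriv i (\<lambda>x. \<phi> x + \<psi> x) x = partial_deriv i \<phi> x + partial_deriv i \<psi> x"
proof -
  from assms obtain D E where D: "(\<phi> has_derivative D) (at x)" and E: "(\<psi> has_derivative E) (at x)"
    unfolding differentiable_def by auto
  show ?thesis
    using partial_deriv_eq[OF has_derivative_add[OF D E]] partial_deriv_eq[OF D] partial_deriv_eq[OF E]
    by simp
qed

lemma partial_deriv_mult:
  assumes "\<phi> differentiable at x" "\<psi> differentiable at x"
  shows "partial_deriv i (\<lambda>x. \<phi> x * \<psi> x) x = partial_deriv i \<phi> x * \<psi> x + \<phi> x * partial_deriv i \<psi> x"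
proof -
  from assms obtain D E where D: "(\<phi> has_derivative D) (at x)" and E: "(\<psi> has_derivative E) (at x)"
    unfolding differentiable_def by auto
  show ?thesis
    using partial_deriv_eq[OF has_derivative_mult[OF D E]] partial_deriv_eq[OF D] partial_deriv_eq[OF E]
    by simp
qed

lemma partial_deriv_const: "partial_deriv i (\<lambda>x. c) = (\<lambda>x. 0)"
  by (rule ext, rule partial_deriv_eq[OF has_derivative_const])

lemma partial_deriv_cmult:
  fixes \<phi> :: "real^'n \<Rightarrow> complex"
  assumes "\<phi> differentiable at x"
  shows "partial_deriv i (\<lambda>x. c * \<phi> x) x = c * partial_deriv i \<phi> x"
  using partial_deriv_mult[of "\<lambda>_. c", OF differentiable_const assms]
  by (simp add: partial_deriv_const)

lemma smooth_add:
  assumes "\<phi> \<in> smooth_space" "\<psi> \<in> smooth_space"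
  shows "(\<lambda>x. \<phi> x + \<psi> x) \<in> smooth_space"
proof (rule smooth_coinduct[where X="{\<lambda>x. \<phi> x + \<psi> x | \<phi> \<psi>. \<phi> \<in> smooth_space \<and> \<psi> \<in> smooth_space}"])
  fix \<zeta> :: "real^'n \<Rightarrow> complex" and x i
  assume "\<zeta> \<in> {\<lambda>x. \<phi> x + \<psi> x | \<phi> \<psi>. \<phi> \<in> smooth_space \<and> \<psi> \<in> smooth_space}"
  then obtain \<phi> \<psi> where *: "\<phi> \<in> smooth_space" "\<psi> \<in> smooth_space" "\<zeta> = (\<lambda>x. \<phi> x + \<psi> x)" by auto
  show "\<zeta> differentiable at x" unfolding * by (intro differentiable_add smooth_differentiable *)
  have "partial_deriv i \<zeta> = (\<lambda>x. partial_deriv i \<phi> x + partial_deriv i \<psi> x)"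
    unfolding * by (intro ext partial_deriv_add smooth_differentiable *)
  then show "partial_deriv i \<zeta> \<in> {\<lambda>x. \<phi> x + \<psi> x | \<phi> \<psi>. \<phi> \<in> smooth_space \<and> \<psi> \<in> smooth_space}"
    using *(1,2) by (auto intro: smooth_partial_deriv)
qed (use assms in auto)

text \<open>By the product rule, the derivatives of a product are sums of products.\<close>

inductive_set product_sums :: "(real^'n \<Rightarrow> complex) set" where
  product: "\<phi> \<in> smooth_space \<Longrightarrow> \<psi> \<in> smooth_space \<Longrightarrow> (\<lambda>x. \<phi> x * \<psi> x) \<in> product_sums"
| sum: "\<zeta> \<in> product_sums \<Longrightarrow> \<xi> \<in> product_sums \<Longrightarrow> (\<lambda>x. \<zeta> x + \<xi> x) \<in> product_sums"

lemma product_sums_differentiable: "\<zeta> \<in> product_sums \<Longrightarrow> \<zeta> differentiable at x"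
  by (induction rule: product_sums.induct)
    (auto intro!: differentiable_add differentiable_mult intro: smooth_differentiable)

lemma product_sums_partial_deriv:
  "\<zeta> \<in> product_sums \<Longrightarrow> partial_deriv i \<zeta> \<in> product_sums"
proof (induction rule: product_sums.induct)
  case (product \<phi> \<psi>)
  have "partial_deriv i (\<lambda>x. \<phi> x * \<psi> x) = (\<lambda>x. partial_deriv i \<phi> x * \<psi> x + \<phi> x * partial_deriv i \<psi> x)"
    by (intro ext partial_deriv_mult smooth_differentiable product)
  then show ?case
    using product by (auto intro!: product_sums.intros smooth_partial_deriv)
next
  case (sum \<zeta> \<xi>)
  have "partial_deriv i (\<lambda>x. \<zeta> x + \<xi> x) = (\<lambda>x. partial_deriv i \<zeta> x + partial_deriv i \<xi> x)"
    by (intro ext partial_deriv_add product_sums_differentiable sum)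
  then show ?case using sum by (auto intro: product_sums.intros)
qed

lemma smooth_mult:
  assumes "\<phi> \<in> smooth_space" "\<psi> \<in> smooth_space"
  shows "(\<lambda>x. \<phi> x * \<psi> x) \<in> smooth_space"
  by (rule smooth_coinduct[OF product_sums.product[OF assms]])
    (auto intro: product_sums_differentiable product_sums_partial_deriv)

lemma smooth_const: "(\<lambda>x. c) \<in> smooth_space"
  by (rule smooth_coinduct[where X="range (\<lambda>c x. c)"]) (auto simp: partial_deriv_const)

lemma smooth_cmult: "\<phi> \<in> smooth_space \<Longrightarrow> (\<lambda>x. c * \<phi> x) \<in> smooth_space"
  by (intro smooth_mult smooth_const)

lemma function_space_smooth: "function_space smooth_space"
  unfolding function_space_def by (auto intro: smooth_const smooth_add smooth_cmult)

lemma smooth_diff: "\<phi> \<in> smooth_space \<Longrightarrow> \<psi> \<in> smooth_space \<Longrightarrow> (\<lambda>x. \<phi> x - \<psi> x) \<in> smooth_space"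
  by (rule function_space_diff[OF function_space_smooth])

lemma pderivs_add:
  assumes "\<phi> \<in> smooth_space" "\<psi> \<in> smooth_space"
  shows "pderivs \<beta> (\<lambda>x. \<phi> x + \<psi> x) = (\<lambda>x. pderivs \<beta> \<phi> x + pderivs \<beta> \<psi> x)"
  by (induction \<beta>) (auto intro!: ext partial_deriv_add smooth_differentiable smooth_pderivs assms)

lemma pderivs_cmult:
  assumes "\<phi> \<in> smooth_space"
  shows "pderivs \<beta> (\<lambda>x. c * \<phi> x) = (\<lambda>x. c * pderivs \<beta> \<phi> x)"
  by (induction \<beta>) (auto intro!: ext partial_deriv_cmult smooth_differentiable smooth_pderivs assms)

text \<open>
  The sum of the absolute values of all derivatives of order at most \<open>m\<close>, mixed derivatives being
  counted once for every order of differentiation.  The recursion peels off the innermost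
  derivative, so that estimates follow by induction on \<open>m\<close> for all functions simultaneously and
  no multi-indices are needed in the product rule.
\<close>

primrec jet :: "nat \<Rightarrow> (real^'n \<Rightarrow> complex) \<Rightarrow> real^'n \<Rightarrow> real" where
  "jet 0 \<phi> x = cmod (\<phi> x)"
| "jet (Suc m) \<phi> x = cmod (\<phi> x) + (\<Sum>i\<in>UNIV. jet m (partial_deriv i \<phi>) x)"

lemma jet_nonneg [simp]: "0 \<le> jet m \<phi> x"
  by (induction m arbitrary: \<phi>) (auto intro!: add_nonneg_nonneg sum_nonneg)

lemma cmod_le_jet: "cmod (\<phi> x) \<le> jet m \<phi> x"
  by (cases m) (auto intro!: sum_nonneg)

lemma jet_le_Suc: "jet m \<phi> x \<le> jet (Suc m) \<phi> x"
proof (induction m arbitrary: \<phi>)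
  case 0
  then show ?case by (auto intro!: sum_nonneg)
next
  case (Suc m)
  have "(\<Sum>i\<in>UNIV. jet m (partial_deriv i \<phi>) x) \<le> (\<Sum>i\<in>UNIV. jet (Suc m) (partial_deriv i \<phi>) x)"
    by (intro sum_mono Suc)
  then show ?case by simp
qed

lemma jet_mono: "m \<le> n \<Longrightarrow> jet m \<phi> x \<le> jet n \<phi> x"
  by (rule lift_Suc_mono_le[of "\<lambda>m. jet m \<phi> x"]) (rule jet_le_Suc)

lemma jet_partial_deriv_le: "jet m (partial_deriv i \<phi>) x \<le> jet (Suc m) \<phi> x"
proof -
  have "jet m (partial_deriv i \<phi>) x \<le> (\<Sum>i\<in>UNIV. jet m (partial_deriv i \<phi>) x)"
    by (rule member_le_sum) auto
  then show ?thesis using norm_ge_zero[of "\<phi> x"] by (simp del: norm_ge_zero)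
qed

lemma pderivs_le_jet: "length \<beta> \<le> m \<Longrightarrow> cmod (pderivs \<beta> \<phi> x) \<le> jet m \<phi> x"
proof (induction \<beta> arbitrary: \<phi> m rule: rev_induct)
  case Nil
  then show ?case by (simp add: cmod_le_jet)
next
  case (snoc i \<beta>)
  then obtain k where k: "m = Suc k" "length \<beta> \<le> k" by (cases m) auto
  show ?case
    using snoc.IH[OF k(2), of "partial_deriv i \<phi>"] jet_partial_deriv_le[of k i \<phi> x] k by simp
qed

lemma jet_le_pderivs:
  fixes \<phi> :: "real^'n \<Rightarrow> complex"
  assumes "\<And>\<beta>. length \<beta> \<le> m \<Longrightarrow> cmod (pderivs \<beta> \<phi> x) \<le> e"
  shows "jet m \<phi> x \<le> real (CARD('n) + 1) ^ m * e"
  using assms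
proof (induction m arbitrary: \<phi>)
  case 0
  from 0[of "[]"] show ?case by simp
next
  case (Suc m)
  have e: "0 \<le> e" "cmod (\<phi> x) \<le> e" using Suc.prems[of "[]"] norm_ge_zero[of "\<phi> x"] by (simp_all del: norm_ge_zero)
  have "jet m (partial_deriv i \<phi>) x \<le> real (CARD('n) + 1) ^ m * e" for i
    by (rule Suc.IH) (use Suc.prems[of "_ @ [i]"] in simp)
  then have "(\<Sum>i\<in>UNIV. jet m (partial_deriv i \<phi>) x) \<le> (\<Sum>i\<in>(UNIV::'n set). real (CARD('n) + 1) ^ m * e)"
    by (intro sum_mono)
  moreover have "e \<le> real (CARD('n) + 1) ^ m * e"
    using e mult_right_mono[of 1 "real (CARD('n) + 1) ^ m" e] by simp
  ultimately show ?case using e(2) by (simp add: algebra_simps)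
qed

lemma jet_add:
  assumes "\<phi> \<in> smooth_space" "\<psi> \<in> smooth_space"
  shows "jet m (\<lambda>x. \<phi> x + \<psi> x) x \<le> jet m \<phi> x + jet m \<psi> x"
  using assms
proof (induction m arbitrary: \<phi> \<psi>)
  case 0
  then show ?case by (auto intro: norm_triangle_ineq)
next
  case (Suc m)
  have pd: "partial_deriv i (\<lambda>x. \<phi> x + \<psi> x) = (\<lambda>x. partial_deriv i \<phi> x + partial_deriv i \<psi> x)" for i
    by (intro ext partial_deriv_add smooth_differentiable Suc.prems)
  have "(\<Sum>i\<in>UNIV. jet m (partial_deriv i (\<lambda>x. \<phi> x + \<psi> x)) x) \<le>
      (\<Sum>i\<in>UNIV. jet m (partial_deriv i \<phi>) x + jet m (partial_deriv i \<psi>) x)"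
    unfolding pd by (intro sum_mono Suc.IH smooth_partial_deriv Suc.prems)
  then show ?case using norm_triangle_ineq[of "\<phi> x" "\<psi> x"] by (simp add: sum.distrib)
qed

lemma jet_cmult:
  assumes "\<phi> \<in> smooth_space"
  shows "jet m (\<lambda>x. c * \<phi> x) x = cmod c * jet m \<phi> x"
  using assms
proof (induction m arbitrary: \<phi>)
  case 0
  then show ?case by (simp add: norm_mult)
next
  case (Suc m)
  have pd: "partial_deriv i (\<lambda>x. c * \<phi> x) = (\<lambda>x. c * partial_deriv i \<phi> x)" for i
    by (intro ext partial_deriv_cmult smooth_differentiable Suc.prems)
  show ?case
    by (simp add: pd Suc.IH smooth_partial_deriv Suc.prems norm_mult sum_distrib_left algebra_simps)
qed

lemma jet_diff:
  assumes "\<phi> \<in> smooth_space" "\<psi> \<in> smooth_space"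
  shows "jet m (\<lambda>x. \<phi> x - \<psi> x) x \<le> jet m \<phi> x + jet m \<psi> x"
  using jet_add[OF assms(1) smooth_cmult[OF assms(2), of "-1"], of m x] jet_cmult[OF assms(2), of m "-1" x] by simp

lemma jet_mult:
  assumes "\<phi> \<in> smooth_space" "\<psi> \<in> smooth_space"
  shows "jet m (\<lambda>x. \<phi> x * \<psi> x) x \<le> 2 ^ m * jet m \<phi> x * jet m \<psi> x"
  using assms
proof (induction m arbitrary: \<phi> \<psi>)
  case 0
  then show ?case by (simp add: norm_mult)
next
  case (Suc m)
  let ?S = "\<Sum>i\<in>UNIV. jet m (partial_deriv i \<phi>) x" and ?T = "\<Sum>i\<in>UNIV. jet m (partial_deriv i \<psi>) x"
  let ?a = "cmod (\<phi> x)" and ?b = "cmod (\<psi> x)"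
  have pd: "partial_deriv i (\<lambda>x. \<phi> x * \<psi> x) = (\<lambda>x. partial_deriv i \<phi> x * \<psi> x + \<phi> x * partial_deriv i \<psi> x)" for i
    by (intro ext partial_deriv_mult smooth_differentiable Suc.prems)
  have "jet m (partial_deriv i (\<lambda>x. \<phi> x * \<psi> x)) x \<le>
      2 ^ m * jet m (partial_deriv i \<phi>) x * jet m \<psi> x + 2 ^ m * jet m \<phi> x * jet m (partial_deriv i \<psi>) x" for i
    unfolding pd
    by (rule order_trans[OF jet_add])
      (intro smooth_mult smooth_partial_deriv Suc.prems add_mono Suc.IH)+
  then have "(\<Sum>i\<in>UNIV. jet m (partial_deriv i (\<lambda>x. \<phi> x * \<psi> x)) x) \<le>
      (\<Sum>i\<in>UNIV. 2 ^ m * jet m (partial_deriv i \<phi>) x * jet m \<psi> x + 2 ^ m * jet m \<phi> x * jet m (partial_deriv i \<psi>) x)"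
    by (intro sum_mono)
  also have "\<dots> = 2 ^ m * (?S * jet m \<psi> x + jet m \<phi> x * ?T)"
    by (simp add: sum.distrib sum_distrib_left sum_distrib_right algebra_simps)
  also have "\<dots> \<le> 2 ^ m * (?S * (?b + ?T) + (?a + ?S) * ?T)"
    using jet_le_Suc[of m \<psi> x] jet_le_Suc[of m \<phi> x]
    by (intro mult_left_mono add_mono mult_right_mono) (auto intro!: sum_nonneg)
  finally have le: "jet (Suc m) (\<lambda>x. \<phi> x * \<psi> x) x \<le> ?a * ?b + 2 ^ m * (?S * (?b + ?T) + (?a + ?S) * ?T)"
    by (simp add: norm_mult)
  have S: "0 \<le> ?S" and T: "0 \<le> ?T" by (auto intro!: sum_nonneg)
  have "?a * ?b \<le> 2 ^ m * (?a * ?b)" using mult_right_mono[of 1 "2 ^ m" "?a * ?b"] by simp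
  with le have "jet (Suc m) (\<lambda>x. \<phi> x * \<psi> x) x \<le> 2 ^ m * (?a * ?b + (?S * (?b + ?T) + (?a + ?S) * ?T))"
    by (simp add: algebra_simps)
  also have "\<dots> \<le> 2 ^ m * (2 * ((?a + ?S) * (?b + ?T)))"
    using S T by (intro mult_left_mono) (auto simp: algebra_simps intro!: add_nonneg_nonneg mult_nonneg_nonneg)
  finally show ?case by (simp add: algebra_simps)
qed

text \<open>
  A sharper product rule for cutoff functions: where the proper derivatives of \<open>h\<close> are small,
  multiplication by \<open>h\<close> multiplies the jet by little more than \<open>\<bar>h\<bar>\<close>, with no constant in front.
\<close>

lemma jet_mult_sharp:
  assumes "h \<in> smooth_space" "\<psi> \<in> smooth_space"
  shows "jet m (\<lambda>x. h x * \<psi> x) x \<le> (cmod (h x) + 2 ^ m * (jet m h x - cmod (h x))) * jet m \<psi> x"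
  using assms(2)
proof (induction m arbitrary: \<psi>)
  case 0
  then show ?case by (simp add: norm_mult)
next
  case (Suc m)
  let ?S = "\<Sum>i\<in>UNIV. jet m (partial_deriv i h) x" and ?T = "\<Sum>i\<in>UNIV. jet m (partial_deriv i \<psi>) x"
  let ?a = "cmod (h x)" and ?b = "cmod (\<psi> x)"
  have pd: "partial_deriv i (\<lambda>x. h x * \<psi> x) = (\<lambda>x. partial_deriv i h x * \<psi> x + h x * partial_deriv i \<psi> x)" for i
    by (intro ext partial_deriv_mult smooth_differentiable Suc.prems assms)
  have S: "0 \<le> ?S" and T: "0 \<le> ?T" by (auto intro!: sum_nonneg)
  have "jet m (partial_deriv i (\<lambda>x. h x * \<psi> x)) x \<le>
      2 ^ m * jet m (partial_deriv i h) x * jet m \<psi> x +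
      (?a + 2 ^ m * (jet m h x - ?a)) * jet m (partial_deriv i \<psi>) x" for i
    unfolding pd
    by (rule order_trans[OF jet_add])
      (intro smooth_mult smooth_partial_deriv Suc.prems assms add_mono Suc.IH jet_mult)+
  then have "(\<Sum>i\<in>UNIV. jet m (partial_deriv i (\<lambda>x. h x * \<psi> x)) x) \<le>
      (\<Sum>i\<in>UNIV. 2 ^ m * jet m (partial_deriv i h) x * jet m \<psi> x +
      (?a + 2 ^ m * (jet m h x - ?a)) * jet m (partial_deriv i \<psi>) x)"
    by (intro sum_mono)
  also have "\<dots> = 2 ^ m * ?S * jet m \<psi> x + (?a + 2 ^ m * (jet m h x - ?a)) * ?T"
    by (simp only: sum.distrib sum_distrib_left sum_distrib_right)
  also have "\<dots> \<le> 2 ^ m * ?S * (?b + ?T) + (?a + 2 ^ m * ?S) * ?T"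
    using jet_le_Suc[of m \<psi> x] jet_le_Suc[of m h x] S T
    by (intro add_mono mult_left_mono mult_right_mono) auto
  finally have "jet (Suc m) (\<lambda>x. h x * \<psi> x) x \<le> ?a * ?b + (2 ^ m * ?S * (?b + ?T) + (?a + 2 ^ m * ?S) * ?T)"
    by (simp add: norm_mult)
  also have "\<dots> \<le> (?a + 2 ^ Suc m * ?S) * (?b + ?T)"
    using S T by (auto simp: algebra_simps intro!: mult_nonneg_nonneg)
  finally show ?case by simp
qed

section \<open>Symbols\<close>

definition bracket :: "real^'n \<Rightarrow> real" where
  "bracket x = 1 + (norm x)\<^sup>2"

lemma bracket_ge_1 [simp]: "1 \<le> bracket x"
  and bracket_pos [simp]: "0 < bracket x"
  and bracket_nonneg [simp]: "0 \<le> bracket x"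
  and bracket_nonzero [simp]: "bracket x \<noteq> 0"
  and bracket_minus [simp]: "bracket (- x) = bracket x"
  unfolding bracket_def by (auto intro: add_pos_nonneg simp: add_nonneg_eq_0_iff)

lemma bracket_mono: "norm x \<le> norm y \<Longrightarrow> bracket x \<le> bracket y"
  unfolding bracket_def by simp

lemma bracket_powr_mono: "\<rho> \<le> \<sigma> \<Longrightarrow> bracket x powr \<rho> \<le> bracket x powr \<sigma>"
  by (rule powr_mono) auto

lemma bracket_add_le: "bracket (x + y) \<le> 2 * bracket x * bracket y"
proof -
  have "(norm (x + y))\<^sup>2 \<le> (norm x + norm y)\<^sup>2" by (intro power_mono norm_triangle_ineq) auto
  also have "\<dots> \<le> 2 * (norm x)\<^sup>2 + 2 * (norm y)\<^sup>2"
    using zero_le_power2[of "norm x - norm y"] by (simp add: power2_sum power2_diff)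
  finally have "bracket (x + y) \<le> 1 + 2 * (norm x)\<^sup>2 + 2 * (norm y)\<^sup>2" unfolding bracket_def by simp
  also have "\<dots> \<le> 2 * bracket x * bracket y" unfolding bracket_def by (simp add: algebra_simps)
  finally show ?thesis .
qed

text \<open>Peetre's inequality.\<close>

lemma bracket_powr_add_le:
  "bracket (x + y) powr \<rho> \<le> 2 powr \<bar>\<rho>\<bar> * bracket x powr \<rho> * bracket y powr \<bar>\<rho>\<bar>"
proof (cases "0 \<le> \<rho>")
  case True
  have "bracket (x + y) powr \<rho> \<le> (2 * bracket x * bracket y) powr \<rho>"
    using True by (intro powr_mono2 bracket_add_le) auto
  then show ?thesis using True by (simp add: powr_mult)
next
  case False
  have "bracket x \<le> 2 * bracket (x + y) * bracket y" using bracket_add_le[of "x + y" "- y"] by simp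
  then have "bracket x / (2 * bracket y) \<le> bracket (x + y)" by (simp add: field_simps)
  then have "bracket (x + y) powr \<rho> \<le> (bracket x / (2 * bracket y)) powr \<rho>"
    using False by (intro powr_mono2') auto
  also have "\<dots> = 2 powr \<bar>\<rho>\<bar> * bracket x powr \<rho> * bracket y powr \<bar>\<rho>\<bar>"
    using False by (simp add: powr_divide powr_mult powr_minus field_simps)
  finally show ?thesis .
qed

lemma one_plus_norm_power_le: "(1 + norm x) ^ k \<le> 2 ^ k * bracket x powr real k"
proof -
  have "0 \<le> (norm x - 1)\<^sup>2 + (norm x)\<^sup>2 + (norm x)\<^sup>2" by (intro add_nonneg_nonneg zero_le_power2)
  also have "(norm x - 1)\<^sup>2 + (norm x)\<^sup>2 + (norm x)\<^sup>2 \<le> 2 * (2 * bracket x - (1 + norm x))"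
    unfolding bracket_def power2_diff by simp
  finally have "1 + norm x \<le> 2 * bracket x" by simp
  then have "(1 + norm x) ^ k \<le> (2 * bracket x) ^ k" by (intro power_mono) auto
  then show ?thesis by (simp add: power_mult_distrib powr_realpow)
qed

lemma bracket_power_le: "bracket x powr real k \<le> (1 + norm x) ^ (2 * k)"
proof -
  have "bracket x \<le> (1 + norm x)\<^sup>2" unfolding bracket_def by (simp add: power2_sum)
  then have "bracket x ^ k \<le> ((1 + norm x)\<^sup>2) ^ k" by (intro power_mono) auto
  then show ?thesis by (simp add: powr_realpow power_mult)
qed

text \<open>
  Functions all of whose derivatives are \<open>O((1 + \<bar>x\<bar>\<^sup>2) powr \<rho>)\<close>.  Order \<open>0\<close> gives the bounded
  smooth functions, the intersection of all orders is the Schwartz space, the weight has order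
  \<open>(\<alpha> + n + 1) / 2\<close> and the kernels have the opposite order, so every function space of this
  theory is covered by one calculus.
\<close>

definition symbol_space :: "real \<Rightarrow> (real^'n \<Rightarrow> complex) set" where
  "symbol_space \<rho> = {\<phi> \<in> smooth_space. \<forall>m. \<exists>C. \<forall>x. jet m \<phi> x \<le> C * bracket x powr \<rho>}"

lemma symbol_smooth: "\<phi> \<in> symbol_space \<rho> \<Longrightarrow> \<phi> \<in> smooth_space"
  unfolding symbol_space_def by auto

lemma symbol_jet_le:
  fixes \<phi> :: "real^'n \<Rightarrow> complex"
  assumes "\<phi> \<in> symbol_space \<rho>"
  obtains C where "0 \<le> C" "\<And>x. jet m \<phi> x \<le> C * bracket x powr \<rho>"
proof -
  obtain C where C: "\<And>x. jet m \<phi> x \<le> C * bracket x powr \<rho>"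
    using assms unfolding symbol_space_def by auto
  have "0 \<le> C * bracket x powr \<rho>" for x :: "real^'n" by (rule order_trans[OF jet_nonneg C])
  then have "0 \<le> C" by (auto simp: zero_le_mult_iff)
  then show ?thesis using C by (rule that)
qed

text \<open>
  It suffices to bound the functions of a class that is closed under partial derivatives: the
  derivatives of its members are among its members.
\<close>

lemma symbol_coinduct:
  fixes X :: "(real^'n \<Rightarrow> complex) set"
  assumes "\<phi> \<in> X"
    and diff: "\<And>\<phi> x. \<phi> \<in> X \<Longrightarrow> \<phi> differentiable at x"
    and partial: "\<And>\<phi> i. \<phi> \<in> X \<Longrightarrow> partial_deriv i \<phi> \<in> X"
    and bound: "\<And>\<phi>. \<phi> \<in> X \<Longrightarrow> \<exists>C. \<forall>x. cmod (\<phi> x) \<le> C * bracket x powr \<rho>"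
  shows "\<phi> \<in> symbol_space \<rho>"
proof -
  have "\<exists>C. \<forall>x. jet m \<phi> x \<le> C * bracket x powr \<rho>" if "\<phi> \<in> X" for m \<phi>
    using that
  proof (induction m arbitrary: \<phi>)
    case 0
    then show ?case using bound by simp
  next
    case (Suc m)
    obtain C where C: "\<And>x. cmod (\<phi> x) \<le> C * bracket x powr \<rho>" using bound[OF Suc.prems] by auto
    have "\<forall>i. \<exists>C. \<forall>x. jet m (partial_deriv i \<phi>) x \<le> C * bracket x powr \<rho>"
      using Suc.IH partial Suc.prems by blast
    then obtain D where D: "\<And>i x. jet m (partial_deriv i \<phi>) x \<le> D i * bracket x powr \<rho>" by metis
    have "jet (Suc m) \<phi> x \<le> (C + (\<Sum>i\<in>UNIV. D i)) * bracket x powr \<rho>" for x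
      using C D by (auto simp: distrib_right sum_distrib_right intro!: add_mono sum_mono)
    then show ?case by blast
  qed
  moreover have "\<phi> \<in> smooth_space" by (rule smooth_coinduct[OF assms(1-3)])
  ultimately show ?thesis using assms(1) unfolding symbol_space_def by auto
qed

lemma symbol_partial_deriv:
  assumes "\<phi> \<in> symbol_space \<rho>"
  shows "partial_deriv i \<phi> \<in> symbol_space \<rho>"
proof -
  have "\<exists>C. \<forall>x. jet m (partial_deriv i \<phi>) x \<le> C * bracket x powr \<rho>" for m
  proof -
    obtain C where C: "\<And>x. jet (Suc m) \<phi> x \<le> C * bracket x powr \<rho>"
      using symbol_jet_le[OF assms, of "Suc m"] by metis
    show ?thesis using order_trans[OF jet_partial_deriv_le C] by blast
  qed
  then show ?thesis
    using smooth_partial_deriv[OF symbol_smooth[OF assms]] unfolding symbol_space_def by auto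
qed

lemma symbol_add:
  assumes "\<phi> \<in> symbol_space \<rho>" "\<psi> \<in> symbol_space \<rho>"
  shows "(\<lambda>x. \<phi> x + \<psi> x) \<in> symbol_space \<rho>"
proof -
  have "\<exists>C. \<forall>x. jet m (\<lambda>x. \<phi> x + \<psi> x) x \<le> C * bracket x powr \<rho>" for m
  proof -
    obtain C D where C: "\<And>x. jet m \<phi> x \<le> C * bracket x powr \<rho>"
      and D: "\<And>x. jet m \<psi> x \<le> D * bracket x powr \<rho>"
      using symbol_jet_le[OF assms(1)] symbol_jet_le[OF assms(2)] by metis
    have "jet m (\<lambda>x. \<phi> x + \<psi> x) x \<le> (C + D) * bracket x powr \<rho>" for x
      using jet_add[OF symbol_smooth[OF assms(1)] symbol_smooth[OF assms(2)], of m x] C[of x] D[of x]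
      by (simp add: distrib_right)
    then show ?thesis by blast
  qed
  then show ?thesis
    using smooth_add[OF symbol_smooth[OF assms(1)] symbol_smooth[OF assms(2)]]
    unfolding symbol_space_def by auto
qed

lemma symbol_mult:
  assumes "\<phi> \<in> symbol_space \<rho>" "\<psi> \<in> symbol_space \<sigma>"
  shows "(\<lambda>x. \<phi> x * \<psi> x) \<in> symbol_space (\<rho> + \<sigma>)"
proof -
  have "\<exists>C. \<forall>x. jet m (\<lambda>x. \<phi> x * \<psi> x) x \<le> C * bracket x powr (\<rho> + \<sigma>)" for m
  proof -
    obtain C D where C: "0 \<le> C" "\<And>x. jet m \<phi> x \<le> C * bracket x powr \<rho>"
      and D: "\<And>x. jet m \<psi> x \<le> D * bracket x powr \<sigma>"
      using symbol_jet_le[OF assms(1)] symbol_jet_le[OF assms(2)] by metis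
    have "jet m (\<lambda>x. \<phi> x * \<psi> x) x \<le> (2 ^ m * C * D) * bracket x powr (\<rho> + \<sigma>)" for x
    proof -
      have "jet m (\<lambda>x. \<phi> x * \<psi> x) x \<le> 2 ^ m * (jet m \<phi> x * jet m \<psi> x)"
        using jet_mult[OF symbol_smooth[OF assms(1)] symbol_smooth[OF assms(2)], of m x]
        by (simp only: mult.assoc)
      also have "\<dots> \<le> 2 ^ m * ((C * bracket x powr \<rho>) * (D * bracket x powr \<sigma>))"
        by (intro mult_left_mono mult_mono C D) (use C in auto)
      finally show ?thesis by (simp only: powr_add mult_ac)
    qed
    then show ?thesis by blast
  qed
  then show ?thesis
    using smooth_mult[OF symbol_smooth[OF assms(1)] symbol_smooth[OF assms(2)]]
    unfolding symbol_space_def by auto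
qed

lemma symbol_const: "(\<lambda>x. c) \<in> symbol_space 0"
  by (rule symbol_coinduct[where X="range (\<lambda>c x. c)"]) (auto simp: partial_deriv_const intro!: exI)

lemma symbol_cmult: "\<phi> \<in> symbol_space \<rho> \<Longrightarrow> (\<lambda>x. c * \<phi> x) \<in> symbol_space \<rho>"
  using symbol_mult[OF symbol_const, of \<phi> \<rho> c] by simp

lemma symbol_zero: "(\<lambda>x :: real^'n. 0) \<in> symbol_space \<rho>"
proof -
  have "jet m (\<lambda>x. 0) x = 0" for m and x :: "real^'n"
    by (induction m) (simp_all add: partial_deriv_const)
  then show ?thesis
    unfolding symbol_space_def using smooth_const[of 0] by (auto intro!: exI[of _ 0])
qed

lemma function_space_symbol: "function_space (symbol_space \<rho>)"
  unfolding function_space_def by (auto intro: symbol_zero symbol_add symbol_cmult)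

lemmas symbol_diff = function_space_diff[OF function_space_symbol]

lemma symbol_mult_B: "\<phi> \<in> symbol_space \<rho> \<Longrightarrow> \<psi> \<in> symbol_space 0 \<Longrightarrow> (\<lambda>x. \<phi> x * \<psi> x) \<in> symbol_space \<rho>"
  using symbol_mult[of \<phi> \<rho> \<psi> 0] by simp

lemma B_space_eq: "B_space = symbol_space 0"
proof
  show "B_space \<subseteq> symbol_space (0::real)"
  proof
    fix \<phi> :: "real^'n \<Rightarrow> complex" assume \<phi>: "\<phi> \<in> B_space"
    have "\<phi> \<in> symbol_space 0"
    proof (rule symbol_coinduct[where X="range (\<lambda>\<beta>. pderivs \<beta> \<phi>)"])
      show "\<phi> \<in> range (\<lambda>\<beta>. pderivs \<beta> \<phi>)" by (rule range_eqI[of _ _ "[]"]) simp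
      fix \<psi> x i assume "\<psi> \<in> range (\<lambda>\<beta>. pderivs \<beta> \<phi>)"
      then obtain \<beta> where \<beta>: "\<psi> = pderivs \<beta> \<phi>" by auto
      show "\<psi> differentiable at x"
        unfolding \<beta> using \<phi> by (intro smooth_differentiable smooth_pderivs) (simp add: B_space_def)
      show "partial_deriv i \<psi> \<in> range (\<lambda>\<beta>. pderivs \<beta> \<phi>)"
        unfolding \<beta> by (rule range_eqI[of _ _ "i # \<beta>"]) simp
      show "\<exists>C. \<forall>x. cmod (\<psi> x) \<le> C * bracket x powr 0"
        using \<phi> unfolding \<beta> B_space_def bounded_iff by auto
    qed
    then show "\<phi> \<in> symbol_space 0" .
  qed
  show "symbol_space (0::real) \<subseteq> B_space"
  proof
    fix \<phi> :: "real^'n \<Rightarrow> complex" assume \<phi>: "\<phi> \<in> symbol_space 0"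
    have "bounded (range (pderivs \<beta> \<phi>))" for \<beta>
    proof -
      obtain C where C: "\<And>x. jet (length \<beta>) \<phi> x \<le> C * bracket x powr 0" using symbol_jet_le[OF \<phi>] by metis
      show ?thesis
        unfolding bounded_iff
        using order_trans[OF pderivs_le_jet[OF order_refl] C] by (intro exI[of _ C]) auto
    qed
    then show "\<phi> \<in> B_space" using symbol_smooth[OF \<phi>] unfolding B_space_def by auto
  qed
qed

lemma symbol_jet_bounded:
  assumes "\<phi> \<in> symbol_space 0"
  obtains C where "0 \<le> C" "\<And>x. jet m \<phi> x \<le> C"
  using symbol_jet_le[OF assms, of m] by (auto intro: that)

lemma schwartz_symbol: "\<phi> \<in> schwartz_space \<Longrightarrow> \<phi> \<in> symbol_space \<rho>"
proof -
  assume \<phi>: "\<phi> \<in> schwartz_space"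
  show ?thesis
  proof (rule symbol_coinduct[where X="range (\<lambda>\<beta>. pderivs \<beta> \<phi>)"])
    show "\<phi> \<in> range (\<lambda>\<beta>. pderivs \<beta> \<phi>)" by (rule range_eqI[of _ _ "[]"]) simp
    fix \<psi> x i assume "\<psi> \<in> range (\<lambda>\<beta>. pderivs \<beta> \<phi>)"
    then obtain \<beta> where \<beta>: "\<psi> = pderivs \<beta> \<phi>" by auto
    show "\<psi> differentiable at x"
      unfolding \<beta> using \<phi> by (intro smooth_differentiable smooth_pderivs) (simp add: schwartz_space_def)
    show "partial_deriv i \<psi> \<in> range (\<lambda>\<beta>. pderivs \<beta> \<phi>)"
      unfolding \<beta> by (rule range_eqI[of _ _ "i # \<beta>"]) simp
    obtain k :: nat where k: "- \<rho> \<le> real k" using real_arch_simple by blast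
    have "bounded (range (\<lambda>x. (1 + norm x) ^ (2 * k) * cmod (pderivs \<beta> \<phi> x)))"
      using \<phi> unfolding schwartz_space_def by blast
    then obtain C where C0: "\<And>x. norm ((1 + norm x) ^ (2 * k) * cmod (pderivs \<beta> \<phi> x)) \<le> C"
      unfolding bounded_iff by auto
    have C: "(1 + norm x) ^ (2 * k) * cmod (pderivs \<beta> \<phi> x) \<le> C" for x
      using order_trans[OF abs_ge_self C0[of x, unfolded real_norm_def]] .
    have "cmod (\<psi> x) \<le> C * bracket x powr \<rho>" for x
    proof -
      have "bracket x powr (-\<rho>) * cmod (\<psi> x) \<le> (1 + norm x) ^ (2 * k) * cmod (\<psi> x)"
        by (rule mult_right_mono[OF order_trans[OF bracket_powr_mono[OF k] bracket_power_le]]) simp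
      also have "\<dots> \<le> C" using C \<beta> by simp
      finally show ?thesis by (simp add: powr_minus field_simps)
    qed
    then show "\<exists>C. \<forall>x. cmod (\<psi> x) \<le> C * bracket x powr \<rho>" by blast
  qed
qed

lemma schwartz_spaceI:
  assumes "\<And>\<rho>. \<phi> \<in> symbol_space \<rho>"
  shows "\<phi> \<in> schwartz_space"
proof -
  have "bounded (range (\<lambda>x. (1 + norm x) ^ k * cmod (pderivs \<beta> \<phi> x)))" for k \<beta>
  proof -
    obtain C where C: "0 \<le> C" "\<And>x. jet (length \<beta>) \<phi> x \<le> C * bracket x powr (- real k)"
      using symbol_jet_le[OF assms] by metis
    have "(1 + norm x) ^ k * cmod (pderivs \<beta> \<phi> x) \<le> 2 ^ k * C" for x
    proof -
      have "(1 + norm x) ^ k * cmod (pderivs \<beta> \<phi> x) \<le>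
          (2 ^ k * bracket x powr real k) * (C * bracket x powr (- real k))"
        by (intro mult_mono one_plus_norm_power_le order_trans[OF pderivs_le_jet[OF order_refl] C(2)]) auto
      also have "\<dots> = 2 ^ k * C" by (simp add: powr_minus)
      finally show ?thesis .
    qed
    then show ?thesis unfolding bounded_iff by (intro exI[of _ "2 ^ k * C"]) auto
  qed
  then show ?thesis using symbol_smooth[OF assms] unfolding schwartz_space_def by auto
qed

lemma schwartz_mult_symbol:
  assumes "h \<in> symbol_space \<rho>" "\<phi> \<in> schwartz_space"
  shows "(\<lambda>x. h x * \<phi> x) \<in> schwartz_space"
proof (rule schwartz_spaceI)
  show "(\<lambda>x. h x * \<phi> x) \<in> symbol_space \<sigma>" for \<sigma>
    using symbol_mult[OF assms(1) schwartz_symbol[OF assms(2)], of "\<sigma> - \<rho>"] by simp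
qed

lemma function_space_schwartz: "function_space schwartz_space"
  unfolding function_space_def
  by (auto intro: schwartz_spaceI[OF symbol_zero] schwartz_spaceI[OF symbol_add[OF schwartz_symbol schwartz_symbol]]
      schwartz_spaceI[OF symbol_cmult[OF schwartz_symbol]])

lemma schwartz_smooth: "\<phi> \<in> schwartz_space \<Longrightarrow> \<phi> \<in> smooth_space"
  unfolding schwartz_space_def by simp

lemma schwartz_subset_B: "schwartz_space \<subseteq> B_space"
  unfolding B_space_eq using schwartz_symbol by auto

text \<open>
  Powers of \<open>1 + \<bar>x\<bar>\<^sup>2\<close> and Gaussians: a class of functions with explicit bounds that contains
  both and is closed under differentiation.  A coordinate has order \<open>1/2\<close>.
\<close>

inductive elementary_symbol :: "real \<Rightarrow> (real^'n \<Rightarrow> complex) \<Rightarrow> bool" where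
  base: "0 < y \<Longrightarrow> 0 \<le> t \<Longrightarrow> r \<le> \<rho> \<or> 0 < t \<Longrightarrow>
    elementary_symbol \<rho> (\<lambda>x. of_real ((y\<^sup>2 + (norm x)\<^sup>2) powr r * exp (- t * (norm x)\<^sup>2)))"
| coord: "elementary_symbol (\<rho> - 1/2) \<phi> \<Longrightarrow> elementary_symbol \<rho> (\<lambda>x. of_real (x $ i) * \<phi> x)"
| cmult: "elementary_symbol \<rho> \<phi> \<Longrightarrow> elementary_symbol \<rho> (\<lambda>x. c * \<phi> x)"
| add: "elementary_symbol \<rho> \<phi> \<Longrightarrow> elementary_symbol \<rho> \<psi> \<Longrightarrow> elementary_symbol \<rho> (\<lambda>x. \<phi> x + \<psi> x)"

lemma elementary_symbol_mono: "elementary_symbol \<rho> \<phi> \<Longrightarrow> \<rho> \<le> \<sigma> \<Longrightarrow> elementary_symbol \<sigma> \<phi>"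
proof (induction arbitrary: \<sigma> rule: elementary_symbol.induct)
  case (base y t r \<rho>)
  then show ?case by (intro elementary_symbol.base) auto
next
  case (coord \<rho> \<phi> i)
  show ?case by (rule elementary_symbol.coord, rule coord.IH) (use coord.prems in simp)
next
  case (cmult \<rho> \<phi> c)
  show ?case by (rule elementary_symbol.cmult, rule cmult.IH) (rule cmult.prems)
next
  case (add \<rho> \<phi> \<psi>)
  show ?case by (rule elementary_symbol.add) (rule add.IH, rule add.prems)+
qed

lemma radial_has_derivative:
  assumes "0 < y"
  shows "((\<lambda>x :: real^'n. complex_of_real ((y\<^sup>2 + (norm x)\<^sup>2) powr r * exp (- t * (norm x)\<^sup>2))) has_derivative
    (\<lambda>h. of_real ((2 * r * ((y\<^sup>2 + (norm x)\<^sup>2) powr (r - 1) * exp (- t * (norm x)\<^sup>2))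
      - 2 * t * ((y\<^sup>2 + (norm x)\<^sup>2) powr r * exp (- t * (norm x)\<^sup>2))) * (x \<bullet> h)))) (at x)"
proof -
  have pos: "0 < y\<^sup>2 + x \<bullet> x" using assms by (intro add_pos_nonneg) auto
  have q: "((\<lambda>s. (y\<^sup>2 + s) powr r * exp (- t * s)) has_field_derivative
      (r * (y\<^sup>2 + x \<bullet> x) powr (r - 1) * exp (- t * (x \<bullet> x)) - t * ((y\<^sup>2 + x \<bullet> x) powr r * exp (- t * (x \<bullet> x)))))
      (at (x \<bullet> x))"
  proof -
    have "((\<lambda>s. y\<^sup>2 + s) has_field_derivative 1) (at (x \<bullet> x))"
      using DERIV_add[OF DERIV_const DERIV_ident] by simp
    from DERIV_chain2[OF has_real_derivative_powr[OF pos, of r] this]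
    have 1: "((\<lambda>s. (y\<^sup>2 + s) powr r) has_field_derivative r * (y\<^sup>2 + x \<bullet> x) powr (r - 1)) (at (x \<bullet> x))"
      by simp
    have 2: "((\<lambda>s. exp (- t * s)) has_field_derivative - t * exp (- t * (x \<bullet> x))) (at (x \<bullet> x))"
      using DERIV_chain2[OF DERIV_exp DERIV_cmult_Id[of "- t" "x \<bullet> x"]] by (simp add: mult.commute)
    show ?thesis by (rule DERIV_cong[OF DERIV_mult[OF 1 2]]) (simp add: algebra_simps)
  qed
  have n: "((\<lambda>x. x \<bullet> x) has_derivative (\<lambda>h. 2 * (x \<bullet> h))) (at x)"
    using has_derivative_inner[OF has_derivative_ident has_derivative_ident, of x UNIV]
    by (simp add: inner_commute)
  have "((\<lambda>x. (y\<^sup>2 + x \<bullet> x) powr r * exp (- t * (x \<bullet> x))) has_derivative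
      (\<lambda>h. 2 * (x \<bullet> h) * (r * (y\<^sup>2 + x \<bullet> x) powr (r - 1) * exp (- t * (x \<bullet> x)) -
        t * ((y\<^sup>2 + x \<bullet> x) powr r * exp (- t * (x \<bullet> x)))))) (at x)"
    by (rule has_derivative_eq_rhs[OF DERIV_compose_FDERIV[OF q n]]) (simp add: algebra_simps)
  then have "((\<lambda>x. complex_of_real ((y\<^sup>2 + x \<bullet> x) powr r * exp (- t * (x \<bullet> x)))) has_derivative
      (\<lambda>h. of_real (2 * (x \<bullet> h) * (r * (y\<^sup>2 + x \<bullet> x) powr (r - 1) * exp (- t * (x \<bullet> x)) -
        t * ((y\<^sup>2 + x \<bullet> x) powr r * exp (- t * (x \<bullet> x))))))) (at x)"
    by (rule has_derivative_of_real)
  then show ?thesis by (simp only: power2_norm_eq_inner) (simp add: algebra_simps)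
qed

lemma elementary_symbol_differentiable:
  fixes \<phi> :: "real^'n \<Rightarrow> complex"
  shows "elementary_symbol \<rho> \<phi> \<Longrightarrow> \<phi> differentiable at x"
proof (induction rule: elementary_symbol.induct)
  case (base y t r \<rho>)
  then show ?case using radial_has_derivative unfolding differentiable_def by blast
next
  case (coord \<rho> \<phi> i)
  have "(\<lambda>x :: real^'n. complex_of_real (x $ i)) differentiable at x"
    using has_derivative_of_real[OF bounded_linear_imp_has_derivative[OF bounded_linear_vec_nth]]
    unfolding differentiable_def by blast
  then show ?case using coord.IH by (intro differentiable_mult)
qed (simp_all add: differentiable_mult differentiable_add)

lemma elementary_symbol_partial_deriv:
  fixes \<phi> :: "real^'n \<Rightarrow> complex"
  shows "elementary_symbol \<rho> \<phi> \<Longrightarrow> elementary_symbol \<rho> (partial_deriv j \<phi>)"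
proof (induction rule: elementary_symbol.induct)
  case (base y t r \<rho>)
  let ?g = "\<lambda>r (x :: real^'n). complex_of_real ((y\<^sup>2 + (norm x)\<^sup>2) powr r * exp (- t * (norm x)\<^sup>2))"
  have eq: "partial_deriv j (?g r) = (\<lambda>x. of_real (x $ j) * (of_real (2 * r) * ?g (r - 1) x + of_real (- 2 * t) * ?g r x))"
    by (rule ext, subst partial_deriv_eq[OF radial_has_derivative[OF base(1)]])
      (simp add: inner_axis algebra_simps)
  have 1: "elementary_symbol (\<rho> - 1/2) (?g (r - 1))"
    using base by (intro elementary_symbol.base) auto
  have 2: "elementary_symbol (\<rho> - 1/2) (\<lambda>x. of_real (- 2 * t) * ?g r x)"
  proof (cases "t = 0")
    case True
    then show ?thesis using elementary_symbol.cmult[OF 1, of 0] by simp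
  next
    case False
    then show ?thesis using base by (intro elementary_symbol.cmult[OF elementary_symbol.base]) auto
  qed
  show ?case
    unfolding eq by (rule elementary_symbol.coord[OF elementary_symbol.add[OF elementary_symbol.cmult[OF 1] 2]])
next
  case (coord \<rho> \<phi> i)
  have D: "((\<lambda>x :: real^'n. complex_of_real (x $ i)) has_derivative (\<lambda>h. of_real (h $ i))) (at x)" for x
    by (rule has_derivative_of_real[OF bounded_linear_imp_has_derivative[OF bounded_linear_vec_nth]])
  have "(\<lambda>x :: real^'n. complex_of_real (x $ i)) differentiable at x" for x
    using D unfolding differentiable_def by blast
  moreover have "partial_deriv j (\<lambda>x :: real^'n. complex_of_real (x $ i)) x = (if i = j then 1 else 0)" for x
    using partial_deriv_eq[OF D] by (simp add: axis_def)
  ultimately have "partial_deriv j (\<lambda>x. of_real (x $ i) * \<phi> x) =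
      (\<lambda>x. (if i = j then 1 else 0) * \<phi> x + of_real (x $ i) * partial_deriv j \<phi> x)"
    by (intro ext, subst partial_deriv_mult) (auto intro: elementary_symbol_differentiable coord)
  moreover have "elementary_symbol \<rho> \<phi>" by (rule elementary_symbol_mono[OF coord(1)]) simp
  ultimately show ?case
    by (simp only:) (rule elementary_symbol.add[OF elementary_symbol.cmult elementary_symbol.coord[OF coord.IH]])
next
  case (cmult \<rho> \<phi> c)
  have "partial_deriv j (\<lambda>x. c * \<phi> x) = (\<lambda>x. c * partial_deriv j \<phi> x)"
    by (intro ext partial_deriv_cmult elementary_symbol_differentiable[OF cmult(1)])
  then show ?case using cmult by (simp only: elementary_symbol.cmult)
next
  case (add \<rho> \<phi> \<psi>)
  have "partial_deriv j (\<lambda>x. \<phi> x + \<psi> x) = (\<lambda>x. partial_deriv j \<phi> x + partial_deriv j \<psi> x)"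
    by (intro ext partial_deriv_add elementary_symbol_differentiable[OF add(1)]
        elementary_symbol_differentiable[OF add(2)])
  then show ?case using elementary_symbol.add[OF add.IH] by simp
qed

lemma powr_exp_bounded:
  fixes t :: real
  assumes "0 < t"
  shows "\<exists>C. \<forall>s\<ge>1. s powr p * exp (- t * s) \<le> C"
proof -
  define q where "q = max p 1"
  have q: "p \<le> q" "0 < q" unfolding q_def by auto
  have "s powr p * exp (- t * s) \<le> exp (- q - q * ln (t / q))" if "1 \<le> s" for s
  proof -
    have "ln (s * (t / q)) \<le> s * (t / q) - 1" using that assms q by (intro ln_le_minus_one) auto
    then have "ln s \<le> s * t / q - 1 - ln (t / q)" using that assms q by (subst (asm) ln_mult) auto
    then have "q * ln s \<le> q * (s * t / q - 1 - ln (t / q))" using q by (intro mult_left_mono) auto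
    also have "\<dots> = s * t - q - q * ln (t / q)" using q by (simp add: algebra_simps)
    finally have le: "q * ln s - t * s \<le> - q - q * ln (t / q)" by (simp add: algebra_simps)
    have "s powr p \<le> s powr q" using that q by (intro powr_mono) auto
    then have "s powr p * exp (- t * s) \<le> s powr q * exp (- t * s)" by (intro mult_right_mono) auto
    also have "\<dots> = exp (q * ln s - t * s)"
      using that unfolding powr_def by (simp add: exp_diff exp_minus divide_inverse)
    also have "\<dots> \<le> exp (- q - q * ln (t / q))" using le by simp
    finally show ?thesis .
  qed
  then show ?thesis by blast
qed

lemma radial_powr_le:
  assumes "0 < y"
  shows "\<exists>C\<ge>0. \<forall>x :: real^'n. (y\<^sup>2 + (norm x)\<^sup>2) powr r \<le> C * bracket x powr r"
proof -
  define a b where "a = min 1 (y\<^sup>2)" and "b = max 1 (y\<^sup>2)"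
  have ab: "0 < a" "0 < b" unfolding a_def b_def using assms by auto
  have "(y\<^sup>2 + (norm x)\<^sup>2) powr r \<le> (a powr r + b powr r) * bracket x powr r" for x :: "real^'n"
  proof -
    have le: "a * bracket x \<le> y\<^sup>2 + (norm x)\<^sup>2" "y\<^sup>2 + (norm x)\<^sup>2 \<le> b * bracket x"
      unfolding bracket_def distrib_left
      using mult_right_mono[of a 1 "(norm x)\<^sup>2"] mult_right_mono[of 1 b "(norm x)\<^sup>2"]
      by (auto simp: a_def b_def)
    have "(y\<^sup>2 + (norm x)\<^sup>2) powr r \<le> a powr r * bracket x powr r \<or>
        (y\<^sup>2 + (norm x)\<^sup>2) powr r \<le> b powr r * bracket x powr r"
    proof (cases "0 \<le> r")
      case True
      have "(y\<^sup>2 + (norm x)\<^sup>2) powr r \<le> (b * bracket x) powr r" using le(2) True by (intro powr_mono2) auto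
      then show ?thesis using ab by (simp add: powr_mult)
    next
      case False
      have "(y\<^sup>2 + (norm x)\<^sup>2) powr r \<le> (a * bracket x) powr r"
        using le(1) False ab by (intro powr_mono2') auto
      then show ?thesis using ab by (simp add: powr_mult)
    qed
    then show ?thesis by (elim disjE) (auto simp: distrib_right intro: add_increasing add_increasing2)
  qed
  then show ?thesis by (intro exI[of _ "a powr r + b powr r"]) auto
qed

lemma elementary_symbol_bound:
  fixes \<phi> :: "real^'n \<Rightarrow> complex"
  shows "elementary_symbol \<rho> \<phi> \<Longrightarrow> \<exists>C. \<forall>x. cmod (\<phi> x) \<le> C * bracket x powr \<rho>"
proof (induction rule: elementary_symbol.induct)
  case (base y t r \<rho>)
  obtain C where C: "0 \<le> C" "\<And>x :: real^'n. (y\<^sup>2 + (norm x)\<^sup>2) powr r \<le> C * bracket x powr r"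
    using radial_powr_le[OF base(1)] by metis
  have "\<exists>D\<ge>0. \<forall>x :: real^'n. bracket x powr r * exp (- t * (norm x)\<^sup>2) \<le> D * bracket x powr \<rho>"
  proof (cases "0 < t")
    case True
    then obtain D where D: "\<And>s. 1 \<le> s \<Longrightarrow> s powr (r - \<rho>) * exp (- t * s) \<le> D"
      using powr_exp_bounded by blast
    have "0 \<le> D" using D[of 1] by (simp add: order_trans[OF exp_ge_zero])
    moreover have "bracket x powr r * exp (- t * (norm x)\<^sup>2) \<le> (exp t * D) * bracket x powr \<rho>" for x :: "real^'n"
    proof -
      have "bracket x powr r * exp (- t * (norm x)\<^sup>2) =
          (bracket x powr (r - \<rho>) * exp (- t * bracket x)) * exp t * bracket x powr \<rho>"
        by (simp add: powr_diff bracket_def exp_add[symmetric] algebra_simps)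
      also have "\<dots> \<le> D * exp t * bracket x powr \<rho>"
        by (intro mult_right_mono D) auto
      finally show ?thesis by (simp add: algebra_simps)
    qed
    ultimately show ?thesis by (intro exI[of _ "exp t * D"]) auto
  next
    case False
    then show ?thesis using base by (intro exI[of _ 1]) (auto intro: bracket_powr_mono)
  qed
  then obtain D where D: "0 \<le> D" "\<And>x :: real^'n. bracket x powr r * exp (- t * (norm x)\<^sup>2) \<le> D * bracket x powr \<rho>"
    by blast
  have "(y\<^sup>2 + (norm x)\<^sup>2) powr r * exp (- t * (norm x)\<^sup>2) \<le> (C * D) * bracket x powr \<rho>" for x :: "real^'n"
  proof -
    have "(y\<^sup>2 + (norm x)\<^sup>2) powr r * exp (- t * (norm x)\<^sup>2) \<le> (C * bracket x powr r) * exp (- t * (norm x)\<^sup>2)"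
      by (intro mult_right_mono C) auto
    also have "\<dots> \<le> C * (D * bracket x powr \<rho>)"
      unfolding mult.assoc by (intro mult_left_mono D C)
    finally show ?thesis by simp
  qed
  then show ?case by (auto simp: norm_mult)
next
  case (coord \<rho> \<phi> i)
  then obtain C where C: "\<And>x. cmod (\<phi> x) \<le> C * bracket x powr (\<rho> - 1/2)" by auto
  have "cmod (of_real (x $ i) * \<phi> x) \<le> C * bracket x powr \<rho>" for x
  proof -
    have "\<bar>x $ i\<bar> \<le> norm x" by (rule component_le_norm_cart)
    also have "\<dots> \<le> sqrt (bracket x)" unfolding bracket_def by (intro real_le_rsqrt) simp
    also have "\<dots> = bracket x powr (1/2)" by (simp add: powr_half_sqrt)
    finally have "\<bar>x $ i\<bar> * cmod (\<phi> x) \<le> bracket x powr (1/2) * (C * bracket x powr (\<rho> - 1/2))"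
      by (intro mult_mono C) auto
    also have "\<dots> = C * bracket x powr \<rho>" by (simp add: powr_add[symmetric] mult.left_commute)
    finally show ?thesis by (simp add: norm_mult)
  qed
  then show ?case by blast
next
  case (cmult \<rho> \<phi> c)
  then obtain C where C: "\<And>x. cmod (\<phi> x) \<le> C * bracket x powr \<rho>" by auto
  have "cmod (c * \<phi> x) \<le> (cmod c * C) * bracket x powr \<rho>" for x
    using mult_left_mono[OF C[of x], of "cmod c"] by (simp add: norm_mult)
  then show ?case by blast
next
  case (add \<rho> \<phi> \<psi>)
  then obtain C D where C: "\<And>x. cmod (\<phi> x) \<le> C * bracket x powr \<rho>"
    and D: "\<And>x. cmod (\<psi> x) \<le> D * bracket x powr \<rho>" by auto
  have "cmod (\<phi> x + \<psi> x) \<le> (C + D) * bracket x powr \<rho>" for x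
    using norm_triangle_ineq[of "\<phi> x" "\<psi> x"] C[of x] D[of x] by (simp add: distrib_right)
  then show ?case by blast
qed

lemma elementary_symbol_in_symbol_space:
  assumes "elementary_symbol \<rho> \<phi>"
  shows "\<phi> \<in> symbol_space \<rho>"
  by (rule symbol_coinduct[where X="{\<phi>. elementary_symbol \<rho> \<phi>}"])
    (use assms in \<open>auto intro: elementary_symbol_differentiable elementary_symbol_partial_deriv elementary_symbol_bound\<close>)

section \<open>Translations, dilations and reciprocals of symbols\<close>

lemma has_derivative_compose_affine:
  fixes \<phi> :: "real^'n \<Rightarrow> complex"
  assumes "\<phi> differentiable at (l *\<^sub>R x + a)"
  shows "((\<lambda>x. \<phi> (l *\<^sub>R x + a)) has_derivative
    (\<lambda>h. \<Sum>i\<in>UNIV. (l * h $ i) *\<^sub>R partial_deriv i \<phi> (l *\<^sub>R x + a))) (at x)"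
proof -
  have "((\<lambda>x. l *\<^sub>R x + a) has_derivative (\<lambda>h. l *\<^sub>R h)) (at x)"
    by (auto intro!: derivative_eq_intros)
  from has_derivative_compose[OF this has_derivative_partial_derivs[OF assms]] show ?thesis by simp
qed

lemma partial_deriv_affine:
  fixes \<phi> :: "real^'n \<Rightarrow> complex"
  assumes "\<phi> \<in> smooth_space"
  shows "partial_deriv i (\<lambda>x. \<phi> (l *\<^sub>R x + a)) = (\<lambda>x. of_real l * partial_deriv i \<phi> (l *\<^sub>R x + a))"
proof
  fix x
  have "partial_deriv i (\<lambda>x. \<phi> (l *\<^sub>R x + a)) x =
      (\<Sum>j\<in>UNIV. (l * axis i 1 $ j) *\<^sub>R partial_deriv j \<phi> (l *\<^sub>R x + a))"
    by (rule partial_deriv_eq[OF has_derivative_compose_affine[OF smooth_differentiable[OF assms]]])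
  also have "\<dots> = (\<Sum>j\<in>UNIV. if j = i then of_real l * partial_deriv j \<phi> (l *\<^sub>R x + a) else 0)"
    by (intro sum.cong refl) (auto simp: axis_def scaleR_conv_of_real)
  finally show "partial_deriv i (\<lambda>x. \<phi> (l *\<^sub>R x + a)) x = of_real l * partial_deriv i \<phi> (l *\<^sub>R x + a)"
    by simp
qed

lemma smooth_affine:
  fixes \<phi> :: "real^'n \<Rightarrow> complex"
  assumes "\<phi> \<in> smooth_space"
  shows "(\<lambda>x. \<phi> (l *\<^sub>R x + a)) \<in> smooth_space"
proof (rule smooth_coinduct[where X="{\<lambda>x. \<psi> (l *\<^sub>R x + a) | \<psi>. \<psi> \<in> smooth_space}"])
  fix \<zeta> :: "real^'n \<Rightarrow> complex" and x i
  assume "\<zeta> \<in> {\<lambda>x. \<psi> (l *\<^sub>R x + a) | \<psi>. \<psi> \<in> smooth_space}"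
  then obtain \<psi> where \<psi>: "\<psi> \<in> smooth_space" "\<zeta> = (\<lambda>x. \<psi> (l *\<^sub>R x + a))" by auto
  show "\<zeta> differentiable at x"
    using has_derivative_compose_affine[OF smooth_differentiable[OF \<psi>(1)]]
    unfolding \<psi>(2) differentiable_def by blast
  show "partial_deriv i \<zeta> \<in> {\<lambda>x. \<psi> (l *\<^sub>R x + a) | \<psi>. \<psi> \<in> smooth_space}"
    unfolding \<psi>(2) partial_deriv_affine[OF \<psi>(1)]
    by (intro CollectI exI[of _ "\<lambda>x. of_real l * partial_deriv i \<psi> x"] conjI refl
        smooth_cmult smooth_partial_deriv \<psi>(1))
qed (use assms in auto)

text \<open>Each differentiation of a dilated function produces a factor \<open>l\<close>.\<close>

lemma jet_dilate:
  fixes \<phi> :: "real^'n \<Rightarrow> complex"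
  assumes "\<phi> \<in> smooth_space" "0 \<le> l" "l \<le> 1"
  shows "jet m (\<lambda>x. \<phi> (l *\<^sub>R x)) x \<le> cmod (\<phi> (l *\<^sub>R x)) + l * jet m \<phi> (l *\<^sub>R x)"
    and "jet m (\<lambda>x. \<phi> (l *\<^sub>R x)) x \<le> jet m \<phi> (l *\<^sub>R x)"
proof -
  have pd: "partial_deriv i (\<lambda>x. \<psi> (l *\<^sub>R x)) = (\<lambda>x. of_real l * partial_deriv i \<psi> (l *\<^sub>R x))"
    if "\<psi> \<in> smooth_space" for \<psi> :: "real^'n \<Rightarrow> complex" and i
    using partial_deriv_affine[OF that, of i l 0] by simp
  have jc: "jet m (\<lambda>x. of_real l * partial_deriv i \<psi> (l *\<^sub>R x)) x = l * jet m (\<lambda>x. partial_deriv i \<psi> (l *\<^sub>R x)) x"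
    if "\<psi> \<in> smooth_space" for \<psi> :: "real^'n \<Rightarrow> complex" and i m
    using jet_cmult[OF smooth_affine[OF smooth_partial_deriv[OF that], of i l 0], of m "of_real l" x] assms
    by simp
  have le: "jet m (\<lambda>x. \<psi> (l *\<^sub>R x)) x \<le> jet m \<psi> (l *\<^sub>R x)" if "\<psi> \<in> smooth_space" for \<psi> m
    using that
  proof (induction m arbitrary: \<psi>)
    case (Suc m)
    have "jet m (partial_deriv i (\<lambda>x. \<psi> (l *\<^sub>R x))) x \<le> jet m (partial_deriv i \<psi>) (l *\<^sub>R x)" for i
    proof -
      have "jet m (partial_deriv i (\<lambda>x. \<psi> (l *\<^sub>R x))) x = l * jet m (\<lambda>x. partial_deriv i \<psi> (l *\<^sub>R x)) x"
        unfolding pd[OF Suc.prems] by (rule jc[OF Suc.prems])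
      also have "\<dots> \<le> 1 * jet m (\<lambda>x. partial_deriv i \<psi> (l *\<^sub>R x)) x"
        by (intro mult_right_mono assms) simp
      also have "\<dots> \<le> jet m (partial_deriv i \<psi>) (l *\<^sub>R x)"
        using Suc.IH[OF smooth_partial_deriv[OF Suc.prems]] by simp
      finally show ?thesis .
    qed
    then show ?case by (auto intro!: sum_mono)
  qed simp
  show "jet m (\<lambda>x. \<phi> (l *\<^sub>R x)) x \<le> jet m \<phi> (l *\<^sub>R x)" by (rule le[OF assms(1)])
  show "jet m (\<lambda>x. \<phi> (l *\<^sub>R x)) x \<le> cmod (\<phi> (l *\<^sub>R x)) + l * jet m \<phi> (l *\<^sub>R x)"
  proof (cases m)
    case 0
    then show ?thesis using assms by simp
  next
    case (Suc k)
    have "(\<Sum>i\<in>UNIV. jet k (partial_deriv i (\<lambda>x. \<phi> (l *\<^sub>R x))) x) \<le>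
        (\<Sum>i\<in>UNIV. l * jet k (partial_deriv i \<phi>) (l *\<^sub>R x))"
      unfolding pd[OF assms(1)] jc[OF assms(1)]
      by (intro sum_mono mult_left_mono le smooth_partial_deriv assms)
    also have "\<dots> \<le> l * jet m \<phi> (l *\<^sub>R x)"
      using assms unfolding Suc sum_distrib_left[symmetric] by (intro mult_left_mono) auto
    finally show ?thesis by (simp add: Suc)
  qed
qed

lemma translate_eq_affine: "translate \<eta> \<phi> = (\<lambda>x. \<phi> (1 *\<^sub>R x + (- \<eta>)))"
  unfolding translate_def by simp

lemma translate_smooth: "\<phi> \<in> smooth_space \<Longrightarrow> translate \<eta> \<phi> \<in> smooth_space"
  unfolding translate_eq_affine by (rule smooth_affine)

lemma partial_deriv_translate:
  "\<phi> \<in> smooth_space \<Longrightarrow> partial_deriv i (translate \<eta> \<phi>) = translate \<eta> (partial_deriv i \<phi>)"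
  unfolding translate_eq_affine partial_deriv_affine by simp

lemma jet_translate: "\<phi> \<in> smooth_space \<Longrightarrow> jet m (translate \<eta> \<phi>) x = jet m \<phi> (x - \<eta>)"
proof (induction m arbitrary: \<phi>)
  case 0
  then show ?case by (simp add: translate_def)
next
  case (Suc m)
  then show ?case
    by (simp add: partial_deriv_translate smooth_partial_deriv) (simp add: translate_def)
qed

text \<open>
  By Peetre's inequality a translation changes the growth by a constant factor only.
\<close>

lemma symbol_translate:
  assumes "\<phi> \<in> symbol_space \<rho>"
  shows "translate \<eta> \<phi> \<in> symbol_space \<rho>"
proof -
  have "\<exists>C. \<forall>x. jet m (translate \<eta> \<phi>) x \<le> C * bracket x powr \<rho>" for m
  proof -
    obtain C where C: "0 \<le> C" "\<And>x. jet m \<phi> x \<le> C * bracket x powr \<rho>"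
      using symbol_jet_le[OF assms] by metis
    have "jet m (translate \<eta> \<phi>) x \<le> (C * (2 powr \<bar>\<rho>\<bar> * bracket \<eta> powr \<bar>\<rho>\<bar>)) * bracket x powr \<rho>" for x
    proof -
      have "jet m (translate \<eta> \<phi>) x \<le> C * bracket (x + - \<eta>) powr \<rho>"
        using C(2)[of "x - \<eta>"] by (simp add: jet_translate[OF symbol_smooth[OF assms]])
      also have "\<dots> \<le> C * (2 powr \<bar>\<rho>\<bar> * bracket x powr \<rho> * bracket (- \<eta>) powr \<bar>\<rho>\<bar>)"
        by (intro mult_left_mono bracket_powr_add_le C)
      finally show ?thesis by (simp add: mult_ac)
    qed
    then show ?thesis by blast
  qed
  then show ?thesis
    using translate_smooth[OF symbol_smooth[OF assms]] unfolding symbol_space_def by auto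
qed

lemma schwartz_translate: "\<phi> \<in> schwartz_space \<Longrightarrow> translate \<eta> \<phi> \<in> schwartz_space"
  by (rule schwartz_spaceI) (intro symbol_translate schwartz_symbol)

text \<open>The derivatives of \<open>inverse h\<close> are of the form \<open>a * inverse h ^ k\<close> with \<open>a\<close> of order zero.\<close>

lemma symbol_inverse:
  fixes h :: "real^'n \<Rightarrow> complex"
  assumes h: "h \<in> symbol_space 0" and d: "0 < d" "\<And>x. d \<le> cmod (h x)"
  shows "(\<lambda>x. inverse (h x)) \<in> symbol_space 0"
proof (rule symbol_coinduct[where X="{\<lambda>x. a x * inverse (h x) ^ k | a k. a \<in> symbol_space 0}"])
  have nz: "h x \<noteq> 0" for x using d(1) d(2)[of x] by auto
  show "(\<lambda>x. inverse (h x)) \<in> {\<lambda>x. a x * inverse (h x) ^ k | a k. a \<in> symbol_space 0}"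
    by (intro CollectI exI[of _ "\<lambda>_. 1"] exI[of _ 1]) (simp add: symbol_const)
  fix \<phi> :: "real^'n \<Rightarrow> complex" and x i
  assume "\<phi> \<in> {\<lambda>x. a x * inverse (h x) ^ k | a k. a \<in> symbol_space 0}"
  then obtain a k where a: "a \<in> symbol_space 0" and \<phi>: "\<phi> = (\<lambda>x. a x * inverse (h x) ^ k)" by auto
  have D: "((\<lambda>x. inverse (h x) ^ k) has_derivative
    (\<lambda>v. - of_nat k * inverse (h x) ^ Suc k * (\<Sum>i\<in>UNIV. v $ i *\<^sub>R partial_deriv i h x))) (at x)" for x
  proof -
    have 1: "((\<lambda>z. inverse z ^ k) has_field_derivative - of_nat k * inverse (h x) ^ Suc k) (at (h x))"
    proof (cases k)
      case (Suc j)
      show ?thesis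
        using DERIV_power[OF DERIV_inverse[OF nz], of k x UNIV]
        by (rule DERIV_cong) (simp add: Suc algebra_simps)
    qed simp
    have 2: "(h has_derivative (\<lambda>v. \<Sum>i\<in>UNIV. v $ i *\<^sub>R partial_deriv i h x)) (at x)"
      by (rule smooth_has_derivative[OF symbol_smooth[OF h]])
    show ?thesis
      using has_derivative_compose[OF 2 1[unfolded has_field_derivative_def]] by simp
  qed
  then have diff: "(\<lambda>x. inverse (h x) ^ k) differentiable at x" for x
    unfolding differentiable_def by blast
  then show "\<phi> differentiable at x"
    unfolding \<phi> by (intro differentiable_mult smooth_differentiable[OF symbol_smooth[OF a]] diff)
  have "partial_deriv i (\<lambda>x. inverse (h x) ^ k) x = - of_nat k * inverse (h x) ^ Suc k * partial_deriv i h x" for x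
  proof -
    have "(\<Sum>j\<in>UNIV. axis i 1 $ j *\<^sub>R partial_deriv j h x) = (\<Sum>j\<in>UNIV. if j = i then partial_deriv j h x else 0)"
      by (intro sum.cong refl) (auto simp: axis_def)
    then show ?thesis by (subst partial_deriv_eq[OF D]) simp
  qed
  then have "partial_deriv i \<phi> = (\<lambda>x. partial_deriv i a x * inverse (h x) ^ k +
      a x * (- of_nat k * inverse (h x) ^ Suc k * partial_deriv i h x))"
    unfolding \<phi>
    by (intro ext, subst partial_deriv_mult[OF smooth_differentiable[OF symbol_smooth[OF a]] diff]) simp
  also have "\<dots> = (\<lambda>x. (partial_deriv i a x * h x + (- of_nat k) * (a x * partial_deriv i h x)) * inverse (h x) ^ Suc k)"
    by (intro ext) (use nz in \<open>simp add: field_simps\<close>)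
  finally show "partial_deriv i \<phi> \<in> {\<lambda>x. a x * inverse (h x) ^ k | a k. a \<in> symbol_space 0}"
    by (simp only:) (intro CollectI exI[of _ "\<lambda>x. partial_deriv i a x * h x + (- of_nat k) * (a x * partial_deriv i h x)"]
        exI[of _ "Suc k"] conjI refl symbol_add symbol_cmult symbol_mult_B symbol_partial_deriv a h)
  obtain C where C: "0 \<le> C" "\<And>x. cmod (a x) \<le> C"
    using symbol_jet_bounded[OF a, of 0] by auto
  have "cmod (\<phi> x) \<le> C * inverse d ^ k" for x
    unfolding \<phi> norm_mult norm_power norm_inverse
    by (intro mult_mono C power_mono le_imp_inverse_le d) (use C d in auto)
  then show "\<exists>C. \<forall>x. cmod (\<phi> x) \<le> C * bracket x powr 0" by auto
qed

section \<open>Increments of symbols\<close>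

text \<open>
  The mean value inequality on the segment from \<open>z\<close> to \<open>z + h\<close>.
\<close>

lemma increment_le:
  fixes \<phi> :: "real^'n \<Rightarrow> complex"
  assumes der: "\<And>x. (\<phi> has_derivative (\<lambda>v. \<Sum>i\<in>UNIV. v $ i *\<^sub>R D i x)) (at x)"
    and bound: "\<And>k. norm k \<le> norm h \<Longrightarrow> (\<Sum>i\<in>UNIV. cmod (D i (z + k))) \<le> A"
  shows "cmod (\<phi> (z + h) - \<phi> z) \<le> A * norm h"
proof -
  have "onorm (\<lambda>v. \<Sum>i\<in>UNIV. v $ i *\<^sub>R D i \<xi>) \<le> A" if \<xi>: "\<xi> \<in> closed_segment z (z + h)" for \<xi>
  proof (rule onorm_bound)
    have le: "(\<Sum>i\<in>UNIV. cmod (D i \<xi>)) \<le> A"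
      using bound[of "\<xi> - z"] segment_bound(1)[OF \<xi>] by simp
    then show "0 \<le> A" by (rule order_trans[rotated]) (simp add: sum_nonneg)
    fix v :: "real^'n"
    have "norm (\<Sum>i\<in>UNIV. v $ i *\<^sub>R D i \<xi>) \<le> (\<Sum>i\<in>UNIV. \<bar>v $ i\<bar> * cmod (D i \<xi>))"
      by (rule order_trans[OF norm_sum]) simp
    also have "\<dots> \<le> (\<Sum>i\<in>UNIV. norm v * cmod (D i \<xi>))"
      by (intro sum_mono mult_right_mono component_le_norm_cart) auto
    also have "\<dots> \<le> A * norm v"
      unfolding sum_distrib_left[symmetric] using mult_left_mono[OF le, of "norm v"] by (simp add: mult.commute)
    finally show "norm (\<Sum>i\<in>UNIV. v $ i *\<^sub>R D i \<xi>) \<le> A * norm v" .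
  qed
  then have "norm (\<phi> (z + h) - \<phi> z) \<le> A * norm ((z + h) - z)"
    by (intro differentiable_bound[OF convex_closed_segment has_derivative_at_withinI[OF der]]) auto
  then show ?thesis by simp
qed

lemma increment_symbol_le:
  fixes \<phi> :: "real^'n \<Rightarrow> complex"
  assumes "\<phi> \<in> smooth_space" and C: "0 \<le> C" "\<And>i x. cmod (partial_deriv i \<phi> x) \<le> C * bracket x powr \<rho>"
  shows "cmod (\<phi> (z + h) - \<phi> z) \<le>
    real CARD('n) * C * 2 powr \<bar>\<rho>\<bar> * norm h * (bracket z powr \<rho> * bracket h powr \<bar>\<rho>\<bar>)"
proof -
  have "cmod (\<phi> (z + h) - \<phi> z) \<le>
      (real CARD('n) * (C * (2 powr \<bar>\<rho>\<bar> * bracket z powr \<rho> * bracket h powr \<bar>\<rho>\<bar>))) * norm h"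
  proof (rule increment_le[OF smooth_has_derivative[OF assms(1)]])
    fix k :: "real^'n" assume k: "norm k \<le> norm h"
    have "cmod (partial_deriv i \<phi> (z + k)) \<le> C * (2 powr \<bar>\<rho>\<bar> * bracket z powr \<rho> * bracket h powr \<bar>\<rho>\<bar>)" for i
    proof -
      have "bracket (z + k) powr \<rho> \<le> 2 powr \<bar>\<rho>\<bar> * bracket z powr \<rho> * bracket k powr \<bar>\<rho>\<bar>"
        by (rule bracket_powr_add_le)
      also have "\<dots> \<le> 2 powr \<bar>\<rho>\<bar> * bracket z powr \<rho> * bracket h powr \<bar>\<rho>\<bar>"
        by (intro mult_left_mono powr_mono2 bracket_mono k) auto
      finally show ?thesis using C by (meson mult_left_mono order_trans)
    qed
    then show "(\<Sum>i\<in>UNIV. cmod (partial_deriv i \<phi> (z + k))) \<le>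
        real CARD('n) * (C * (2 powr \<bar>\<rho>\<bar> * bracket z powr \<rho> * bracket h powr \<bar>\<rho>\<bar>))"
      by (rule sum_bounded_above[where A=UNIV, simplified])
  qed
  then show ?thesis by (simp add: mult_ac)
qed

lemma second_increment_symbol_le:
  fixes \<phi> :: "real^'n \<Rightarrow> complex"
  assumes \<phi>: "\<phi> \<in> symbol_space \<rho>"
  obtains C where "0 \<le> C"
    "\<And>z h. cmod (\<phi> (z + h) - \<phi> z - (\<Sum>i\<in>UNIV. h $ i *\<^sub>R partial_deriv i \<phi> z)) \<le>
      C * (norm h)\<^sup>2 * (bracket z powr \<rho> * bracket h powr \<bar>\<rho>\<bar>)"
proof -
  obtain B where B: "0 \<le> B" "\<And>x. jet 2 \<phi> x \<le> B * bracket x powr \<rho>" by (rule symbol_jet_le[OF \<phi>]) (rule that)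
  have B2: "cmod (partial_deriv j (partial_deriv i \<phi>) x) \<le> B * bracket x powr \<rho>" for i j x
    using order_trans[OF pderivs_le_jet[of "[j, i]" 2 \<phi> x] B(2)] by simp
  let ?n = "real CARD('n)"
  define K where "K = ?n * B * 2 powr \<bar>\<rho>\<bar>"
  have K: "0 \<le> K" unfolding K_def using B by simp
  have "cmod (\<phi> (z + h) - \<phi> z - (\<Sum>i\<in>UNIV. h $ i *\<^sub>R partial_deriv i \<phi> z)) \<le>
      (?n * K) * (norm h)\<^sup>2 * (bracket z powr \<rho> * bracket h powr \<bar>\<rho>\<bar>)" for z h
  proof -
    \<comment> \<open>The remainder is an increment of \<open>\<phi>\<close> minus its linear part at \<open>z\<close>.\<close>
    let ?\<psi> = "\<lambda>y. \<phi> y - (\<Sum>i\<in>UNIV. y $ i *\<^sub>R partial_deriv i \<phi> z)"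
    have "cmod (?\<psi> (z + h) - ?\<psi> z) \<le> (?n * (K * norm h * (bracket z powr \<rho> * bracket h powr \<bar>\<rho>\<bar>))) * norm h"
    proof (rule increment_le)
      fix x
      have "((\<lambda>y. \<Sum>i\<in>UNIV. y $ i *\<^sub>R partial_deriv i \<phi> z) has_derivative
          (\<lambda>y. \<Sum>i\<in>UNIV. y $ i *\<^sub>R partial_deriv i \<phi> z)) (at x)"
        by (intro has_derivative_sum has_derivative_scaleR_left bounded_linear_imp_has_derivative
            bounded_linear_vec_nth)
      from has_derivative_diff[OF smooth_has_derivative[OF symbol_smooth[OF \<phi>]] this]
      show "(?\<psi> has_derivative (\<lambda>v. \<Sum>i\<in>UNIV. v $ i *\<^sub>R (partial_deriv i \<phi> x - partial_deriv i \<phi> z))) (at x)"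
        by (simp add: sum_subtractf scaleR_diff_right)
    next
      fix k :: "real^'n" assume k: "norm k \<le> norm h"
      have "cmod (partial_deriv i \<phi> (z + k) - partial_deriv i \<phi> z) \<le>
          K * norm h * (bracket z powr \<rho> * bracket h powr \<bar>\<rho>\<bar>)" for i
      proof -
        have "cmod (partial_deriv i \<phi> (z + k) - partial_deriv i \<phi> z) \<le>
            K * norm k * (bracket z powr \<rho> * bracket k powr \<bar>\<rho>\<bar>)"
          unfolding K_def
          by (rule increment_symbol_le[OF smooth_partial_deriv[OF symbol_smooth[OF \<phi>]] B(1) B2])
        also have "\<dots> \<le> K * norm h * (bracket z powr \<rho> * bracket h powr \<bar>\<rho>\<bar>)"
          by (intro mult_mono mult_left_mono powr_mono2 bracket_mono k K) (use K in auto)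
        finally show ?thesis .
      qed
      then show "(\<Sum>i\<in>UNIV. cmod (partial_deriv i \<phi> (z + k) - partial_deriv i \<phi> z)) \<le>
          ?n * (K * norm h * (bracket z powr \<rho> * bracket h powr \<bar>\<rho>\<bar>))"
        by (rule sum_bounded_above[where A=UNIV, simplified])
    qed
    moreover have "?\<psi> (z + h) - ?\<psi> z = \<phi> (z + h) - \<phi> z - (\<Sum>i\<in>UNIV. h $ i *\<^sub>R partial_deriv i \<phi> z)"
      by (simp add: scaleR_left_distrib sum.distrib)
    ultimately have "cmod (\<phi> (z + h) - \<phi> z - (\<Sum>i\<in>UNIV. h $ i *\<^sub>R partial_deriv i \<phi> z)) \<le>
        (?n * (K * norm h * (bracket z powr \<rho> * bracket h powr \<bar>\<rho>\<bar>))) * norm h"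
      by (simp only:)
    then show ?thesis by (simp add: power2_eq_square mult_ac)
  qed
  moreover have "0 \<le> ?n * K" using K by simp
  ultimately show ?thesis by (rule that[rotated])
qed

section \<open>Convolution\<close>

lemma smooth_continuous: "\<phi> \<in> smooth_space \<Longrightarrow> continuous_on UNIV \<phi>"
  by (intro continuous_at_imp_continuous_on ballI differentiable_imp_continuous_within smooth_differentiable)

lemma smooth_measurable: "\<phi> \<in> smooth_space \<Longrightarrow> \<phi> \<in> borel_measurable borel"
  by (intro borel_measurable_continuous_onI smooth_continuous)

lemma bracket_measurable [measurable]: "bracket \<in> borel_measurable borel"
  unfolding bracket_def by measurable

lemma lborel_reflect:
  fixes x :: "'a::euclidean_space"
  shows "lborel = distr lborel borel (\<lambda>\<eta>. x - \<eta>)"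
  by (subst lborel_affine[of "-1" x]) (simp_all add: density_1)

lemma integrable_reflect:
  fixes f :: "'a::euclidean_space \<Rightarrow> 'b::{banach, second_countable_topology}"
  assumes "integrable lborel f"
  shows "integrable lborel (\<lambda>\<eta>. f (x - \<eta>))"
  using assms by (subst (asm) lborel_reflect[of x]) (erule integrable_distr[rotated], simp)

lemma integral_reflect:
  fixes f :: "'a::euclidean_space \<Rightarrow> 'b::{banach, second_countable_topology}"
  assumes [measurable]: "f \<in> borel_measurable borel"
  shows "(\<integral>\<eta>. f (x - \<eta>) \<partial>lborel) = (\<integral>\<eta>. f \<eta> \<partial>lborel)"
  by (subst (2) lborel_reflect[of x], subst integral_distr) auto

text \<open>Dyadic decomposition: the ball of radius \<open>2 ^ k\<close> has volume of order \<open>2 ^ (k * n)\<close>.\<close>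

lemma integrable_bracket_powr:
  assumes s: "real CARD('n) / 2 < s"
  shows "integrable lborel (\<lambda>x :: real^'n. bracket x powr - s)"
proof (rule integrableI_bounded)
  show "(\<lambda>x :: real^'n. bracket x powr - s) \<in> borel_measurable lborel" by measurable
  \<comment> \<open>The ratio of the geometric series that majorizes the integral.\<close>
  define q where "q = 4 powr - s * 2 ^ CARD('n)"
  define V where "V = unit_ball_vol (real CARD('n))"
  have V: "0 \<le> V" unfolding V_def by simp
  have "q = 2 powr (real CARD('n) - 2 * s)"
  proof -
    have "(4::real) powr - s = 2 powr (2 * - s)"
      using powr_powr[of "2::real" 2 "- s"] by simp
    moreover have "(2::real) ^ CARD('n) = 2 powr real CARD('n)" by (rule powr_realpow[symmetric]) simp
    ultimately have "q = 2 powr (2 * - s) * 2 powr real CARD('n)" unfolding q_def by (simp only:)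
    also have "\<dots> = 2 powr (2 * - s + real CARD('n))" by (rule powr_add[symmetric])
    finally show ?thesis by simp
  qed
  moreover have "2 powr (real CARD('n) - 2 * s) < 2 powr 0" using s by (intro powr_less_mono) auto
  ultimately have q: "0 \<le> q" "q < 1" by simp_all
  have le: "ennreal (bracket x powr - s) \<le>
      (\<Sum>k. ennreal (4 powr s * (4 powr - s) ^ k) * indicator (ball 0 (2 ^ k)) x)" for x :: "real^'n"
  proof -
    \<comment> \<open>The dyadic shell that contains \<open>x\<close>.\<close>
    define k where "k = (LEAST k. norm x < 2 ^ k)"
    have "\<exists>k. norm x < 2 ^ k" using real_arch_pow[of 2 "norm x"] by auto
    then have k: "norm x < 2 ^ k" unfolding k_def by (rule LeastI_ex)
    have "bracket x powr - s \<le> 4 powr s * (4 powr - s) ^ k"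
    proof (cases k)
      case 0
      have "bracket x powr - s \<le> 1 powr - s" using s by (intro powr_mono2') auto
      moreover have "1 \<le> 4 powr s" using s by (intro ge_one_powr_ge_zero) auto
      ultimately show ?thesis using 0 by simp
    next
      case (Suc j)
      have "\<not> norm x < 2 ^ j" using not_less_Least[of j "\<lambda>k. norm x < 2 ^ k"] Suc unfolding k_def by simp
      then have "(2 ^ j)\<^sup>2 \<le> (norm x)\<^sup>2" by (intro power_mono) auto
      also have "(2 ^ j)\<^sup>2 = (4::real) ^ j" by (simp add: power2_eq_square flip: power_mult_distrib)
      finally have "(4::real) ^ j \<le> bracket x" unfolding bracket_def by simp
      then have "bracket x powr - s \<le> (4 ^ j) powr - s" using s by (intro powr_mono2') auto
      also have "\<dots> = (4 powr - s) ^ j"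
        by (simp add: powr_realpow[symmetric] powr_powr mult.commute)
      also have "\<dots> = 4 powr s * (4 powr - s) ^ k"
        unfolding Suc by (simp add: powr_minus)
      finally show ?thesis .
    qed
    then have "ennreal (bracket x powr - s) \<le>
        (\<Sum>j\<in>{k}. ennreal (4 powr s * (4 powr - s) ^ j) * indicator (ball 0 (2 ^ j)) x)"
      using k by (simp add: ennreal_leI)
    also have "\<dots> \<le> (\<Sum>j. ennreal (4 powr s * (4 powr - s) ^ j) * indicator (ball 0 (2 ^ j)) x)"
      by (rule sum_le_suminf) auto
    finally show ?thesis .
  qed
  have "(\<integral>\<^sup>+ x. ennreal (norm (bracket x powr - s)) \<partial>(lborel :: (real^'n) measure)) \<le>
      (\<integral>\<^sup>+ x. (\<Sum>k. ennreal (4 powr s * (4 powr - s) ^ k) * indicator (ball 0 (2 ^ k)) x) \<partial>(lborel :: (real^'n) measure))"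
  proof (rule nn_integral_mono)
    fix x :: "real^'n"
    have "norm (bracket x powr - s) = bracket x powr - s" by (simp only: real_norm_def abs_of_nonneg[OF powr_ge_zero])
    then show "ennreal (norm (bracket x powr - s)) \<le>
        (\<Sum>k. ennreal (4 powr s * (4 powr - s) ^ k) * indicator (ball 0 (2 ^ k)) x)"
      using le[of x] by (simp only:)
  qed
  also have "\<dots> = (\<Sum>k. \<integral>\<^sup>+ x. ennreal (4 powr s * (4 powr - s) ^ k) * indicator (ball 0 (2 ^ k)) x \<partial>(lborel :: (real^'n) measure))"
  proof (rule nn_integral_suminf)
    fix k
    have "(indicator (ball 0 (2 ^ k)) :: real^'n \<Rightarrow> ennreal) \<in> borel_measurable lborel"
      by (rule borel_measurable_indicator) simp
    then show "(\<lambda>x :: real^'n. ennreal (4 powr s * (4 powr - s) ^ k) * indicator (ball 0 (2 ^ k)) x)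
        \<in> borel_measurable lborel"
      by (rule borel_measurable_times_ennreal[OF borel_measurable_const])
  qed
  also have "\<dots> = (\<Sum>k. ennreal (4 powr s * V * q ^ k))"
  proof (rule suminf_cong)
    fix k
    have "(\<integral>\<^sup>+ x. ennreal (4 powr s * (4 powr - s) ^ k) * indicator (ball 0 (2 ^ k)) x \<partial>(lborel :: (real^'n) measure)) =
        ennreal (4 powr s * (4 powr - s) ^ k) * ennreal (V * (2 ^ k) ^ CARD('n))"
      by (subst nn_integral_cmult_indicator) (simp_all add: emeasure_ball V_def)
    also have "\<dots> = ennreal (4 powr s * V * q ^ k)"
      using V by (subst ennreal_mult[symmetric])
        (auto simp: q_def power_mult_distrib power_mult[symmetric] mult_ac)
    finally show "(\<integral>\<^sup>+ x. ennreal (4 powr s * (4 powr - s) ^ k) * indicator (ball 0 (2 ^ k)) x \<partial>(lborel :: (real^'n) measure)) =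
        ennreal (4 powr s * V * q ^ k)" .
  qed
  also have "\<dots> = ennreal (\<Sum>k. 4 powr s * V * q ^ k)"
    using q V by (intro suminf_ennreal2 summable_mult summable_geometric) auto
  also have "\<dots> < \<infinity>" by simp
  finally show "(\<integral>\<^sup>+ x. ennreal (norm (bracket x powr - s)) \<partial>(lborel :: (real^'n) measure)) < \<infinity>" .
qed

definition convolution :: "(real^'n \<Rightarrow> complex) \<Rightarrow> (real^'n \<Rightarrow> complex) \<Rightarrow> real^'n \<Rightarrow> complex" where
  "convolution a \<phi> x = (\<integral>\<eta>. a \<eta> * \<phi> (x - \<eta>) \<partial>lborel)"

text \<open>
  The convolutions of this theory converge since \<open>a\<close> is integrable against the growth of \<open>\<phi>\<close>; by
  Peetre's inequality this does not depend on the point \<open>x\<close>.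
\<close>

lemma bracket_reflect_le: "bracket (x - \<eta>) powr \<rho> \<le> (2 powr \<bar>\<rho>\<bar> * bracket x powr \<bar>\<rho>\<bar>) * bracket \<eta> powr \<rho>"
  using bracket_powr_add_le[of "- \<eta>" x \<rho>] by (simp add: mult_ac)

lemma convolution_integrable:
  fixes \<phi> :: "real^'n \<Rightarrow> complex"
  assumes [measurable]: "a \<in> borel_measurable borel"
    and a: "integrable lborel (\<lambda>\<eta>. cmod (a \<eta>) * bracket \<eta> powr \<rho>)"
    and \<phi>: "\<phi> \<in> symbol_space \<rho>"
  shows "integrable lborel (\<lambda>\<eta>. a \<eta> * \<phi> (x - \<eta>))"
proof -
  have [measurable]: "\<phi> \<in> borel_measurable borel" by (rule smooth_measurable[OF symbol_smooth[OF \<phi>]])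
  obtain C where C: "0 \<le> C" "\<And>x. jet 0 \<phi> x \<le> C * bracket x powr \<rho>" by (rule symbol_jet_le[OF \<phi>]) (rule that)
  have "integrable lborel (\<lambda>\<eta>. (C * (2 powr \<bar>\<rho>\<bar> * bracket x powr \<bar>\<rho>\<bar>)) * (cmod (a \<eta>) * bracket \<eta> powr \<rho>))"
    by (intro integrable_mult_right a)
  then show ?thesis
  proof (rule Bochner_Integration.integrable_bound)
    show "AE \<eta> in lborel. norm (a \<eta> * \<phi> (x - \<eta>)) \<le>
        norm ((C * (2 powr \<bar>\<rho>\<bar> * bracket x powr \<bar>\<rho>\<bar>)) * (cmod (a \<eta>) * bracket \<eta> powr \<rho>))"
    proof (rule AE_I2)
      fix \<eta>
      have "cmod (\<phi> (x - \<eta>)) \<le> C * ((2 powr \<bar>\<rho>\<bar> * bracket x powr \<bar>\<rho>\<bar>) * bracket \<eta> powr \<rho>)"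
        by (rule order_trans[OF C(2)[of "x - \<eta>", simplified] mult_left_mono[OF bracket_reflect_le C(1)]])
      then have "cmod (a \<eta>) * cmod (\<phi> (x - \<eta>)) \<le>
          cmod (a \<eta>) * (C * ((2 powr \<bar>\<rho>\<bar> * bracket x powr \<bar>\<rho>\<bar>) * bracket \<eta> powr \<rho>))"
        by (intro mult_left_mono) auto
      then show "norm (a \<eta> * \<phi> (x - \<eta>)) \<le>
        norm ((C * (2 powr \<bar>\<rho>\<bar> * bracket x powr \<bar>\<rho>\<bar>)) * (cmod (a \<eta>) * bracket \<eta> powr \<rho>))"
        using C(1) by (simp add: norm_mult abs_mult mult_ac)
    qed
  qed measurable
qed

text \<open>
  Differentiation under the integral: by Peetre's inequality the remainder of the first order
  expansion of \<open>\<phi> (x - \<eta>)\<close> is \<open>O(\<bar>h\<bar>\<^sup>2)\<close>, with a constant that is integrable against \<open>a\<close>.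
\<close>

lemma convolution_has_derivative:
  fixes \<phi> :: "real^'n \<Rightarrow> complex"
  assumes am [measurable]: "a \<in> borel_measurable borel"
    and a: "integrable lborel (\<lambda>\<eta>. cmod (a \<eta>) * bracket \<eta> powr \<rho>)"
    and \<phi>: "\<phi> \<in> symbol_space \<rho>"
  shows "(convolution a \<phi> has_derivative
    (\<lambda>v. \<Sum>i\<in>UNIV. v $ i *\<^sub>R convolution a (partial_deriv i \<phi>) x)) (at x)"
proof -
  note int = convolution_integrable[OF am a]
  obtain C where C: "0 \<le> C"
    "\<And>z h. cmod (\<phi> (z + h) - \<phi> z - (\<Sum>i\<in>UNIV. h $ i *\<^sub>R partial_deriv i \<phi> z)) \<le>
      C * (norm h)\<^sup>2 * (bracket z powr \<rho> * bracket h powr \<bar>\<rho>\<bar>)"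
    by (rule second_increment_symbol_le[OF \<phi>]) (rule that)
  define M where "M = C * 2 powr \<bar>\<rho>\<bar> * (2 powr \<bar>\<rho>\<bar> * bracket x powr \<bar>\<rho>\<bar>)"
  define K where "K = (\<integral>\<eta>. M * (cmod (a \<eta>) * bracket \<eta> powr \<rho>) \<partial>lborel)"
  have M: "0 \<le> M" unfolding M_def using C(1) by auto
  show ?thesis
  proof (rule has_derivativeI_sandwich[of 1])
    show "bounded_linear (\<lambda>v. \<Sum>i\<in>UNIV. v $ i *\<^sub>R convolution a (partial_deriv i \<phi>) x)"
      by (intro bounded_linear_sum bounded_linear_scaleR_const bounded_linear_vec_nth)
    show "((\<lambda>y. K * norm (y - x)) \<longlongrightarrow> 0) (at x)"
      using tendsto_mult[OF tendsto_const[of K] tendsto_norm[OF tendsto_diff[OF tendsto_ident_at tendsto_const[of x]]], of x UNIV]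
      by simp
    fix y assume y: "y \<noteq> x" "dist y x < 1"
    define h where "h = y - x"
    have h: "norm h \<le> 1" "h \<noteq> 0" "y = x + h" using y unfolding h_def by (auto simp: dist_norm)
    let ?R = "\<lambda>\<eta>. \<phi> ((x - \<eta>) + h) - \<phi> (x - \<eta>) - (\<Sum>i\<in>UNIV. h $ i *\<^sub>R partial_deriv i \<phi> (x - \<eta>))"
    have i1: "integrable lborel (\<lambda>\<eta>. a \<eta> * \<phi> ((x - \<eta>) + h))"
      using int[OF \<phi>, of "x + h"] by (simp add: algebra_simps)
    have i2: "integrable lborel (\<lambda>\<eta>. h $ i *\<^sub>R (a \<eta> * partial_deriv i \<phi> (x - \<eta>)))" for i
      by (intro integrable_scaleR_right int symbol_partial_deriv \<phi>)
    have eq: "a \<eta> * ?R \<eta> = (a \<eta> * \<phi> ((x - \<eta>) + h) - a \<eta> * \<phi> (x - \<eta>)) -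
        (\<Sum>i\<in>UNIV. h $ i *\<^sub>R (a \<eta> * partial_deriv i \<phi> (x - \<eta>)))" for \<eta>
      by (simp add: algebra_simps sum_distrib_left)
    have "(\<integral>\<eta>. a \<eta> * ?R \<eta> \<partial>lborel) =
        (convolution a \<phi> y - convolution a \<phi> x) - (\<Sum>i\<in>UNIV. h $ i *\<^sub>R convolution a (partial_deriv i \<phi>) x)"
    proof -
      have "(\<integral>\<eta>. a \<eta> * ?R \<eta> \<partial>lborel) =
          ((\<integral>\<eta>. a \<eta> * \<phi> ((x - \<eta>) + h) \<partial>lborel) - (\<integral>\<eta>. a \<eta> * \<phi> (x - \<eta>) \<partial>lborel)) -
          (\<Sum>i\<in>UNIV. \<integral>\<eta>. h $ i *\<^sub>R (a \<eta> * partial_deriv i \<phi> (x - \<eta>)) \<partial>lborel)"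
        unfolding eq
        by (simp only: Bochner_Integration.integral_diff Bochner_Integration.integral_sum
            Bochner_Integration.integrable_diff Bochner_Integration.integrable_sum i1 i2 int[OF \<phi>])
      then show ?thesis
        unfolding convolution_def h(3) by (simp add: algebra_simps)
    qed
    moreover have "cmod (\<integral>\<eta>. a \<eta> * ?R \<eta> \<partial>lborel) \<le> (\<integral>\<eta>. (norm h)\<^sup>2 * (M * (cmod (a \<eta>) * bracket \<eta> powr \<rho>)) \<partial>lborel)"
    proof (rule Bochner_Integration.integral_norm_bound_integral)
      show "integrable lborel (\<lambda>\<eta>. a \<eta> * ?R \<eta>)"
        unfolding eq
        by (intro Bochner_Integration.integrable_diff Bochner_Integration.integrable_sum i1 i2 int[OF \<phi>])
      show "integrable lborel (\<lambda>\<eta>. (norm h)\<^sup>2 * (M * (cmod (a \<eta>) * bracket \<eta> powr \<rho>)))"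
        by (intro integrable_mult_right a)
      fix \<eta>
      have "bracket h \<le> 2" using h(1) unfolding bracket_def by (simp add: power_le_one)
      then have b: "bracket h powr \<bar>\<rho>\<bar> \<le> 2 powr \<bar>\<rho>\<bar>" by (intro powr_mono2) auto
      have "cmod (?R \<eta>) \<le> C * (norm h)\<^sup>2 * (bracket (x - \<eta>) powr \<rho> * bracket h powr \<bar>\<rho>\<bar>)" by (rule C(2))
      also have "\<dots> \<le> C * (norm h)\<^sup>2 * (((2 powr \<bar>\<rho>\<bar> * bracket x powr \<bar>\<rho>\<bar>) * bracket \<eta> powr \<rho>) * 2 powr \<bar>\<rho>\<bar>)"
        using C(1) by (intro mult_left_mono mult_mono bracket_reflect_le b) auto
      also have "\<dots> = (norm h)\<^sup>2 * (M * bracket \<eta> powr \<rho>)" unfolding M_def by (simp add: mult_ac)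
      finally have "cmod (a \<eta>) * cmod (?R \<eta>) \<le> cmod (a \<eta>) * ((norm h)\<^sup>2 * (M * bracket \<eta> powr \<rho>))"
        by (intro mult_left_mono) auto
      then show "cmod (a \<eta> * ?R \<eta>) \<le> (norm h)\<^sup>2 * (M * (cmod (a \<eta>) * bracket \<eta> powr \<rho>))"
        by (simp add: norm_mult mult_ac)
    qed
    moreover have "(\<integral>\<eta>. (norm h)\<^sup>2 * (M * (cmod (a \<eta>) * bracket \<eta> powr \<rho>)) \<partial>lborel) = (norm h)\<^sup>2 * K"
      unfolding K_def by simp
    ultimately have "norm ((convolution a \<phi> y - convolution a \<phi> x) -
        (\<Sum>i\<in>UNIV. h $ i *\<^sub>R convolution a (partial_deriv i \<phi>) x)) \<le> (norm h)\<^sup>2 * K"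
      by (simp only:)
    then show "norm (convolution a \<phi> y - convolution a \<phi> x -
        (\<Sum>i\<in>UNIV. (y - x) $ i *\<^sub>R convolution a (partial_deriv i \<phi>) x)) / norm (y - x) \<le> K * norm (y - x)"
      using h unfolding h_def[symmetric] by (simp add: divide_le_eq power2_eq_square mult_ac)
  qed auto
qed

lemma partial_deriv_convolution:
  fixes \<phi> :: "real^'n \<Rightarrow> complex"
  assumes "a \<in> borel_measurable borel" "integrable lborel (\<lambda>\<eta>. cmod (a \<eta>) * bracket \<eta> powr \<rho>)"
    and \<phi>: "\<phi> \<in> symbol_space \<rho>"
  shows "partial_deriv i (convolution a \<phi>) = convolution a (partial_deriv i \<phi>)"
proof
  fix x
  have "(\<Sum>j\<in>UNIV. axis i 1 $ j *\<^sub>R convolution a (partial_deriv j \<phi>) x) =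
      (\<Sum>j\<in>UNIV. if j = i then convolution a (partial_deriv j \<phi>) x else 0)"
    by (intro sum.cong refl) (auto simp: axis_def)
  then show "partial_deriv i (convolution a \<phi>) x = convolution a (partial_deriv i \<phi>) x"
    by (subst partial_deriv_eq[OF convolution_has_derivative[OF assms]]) simp
qed

lemma symbol_pderivs: "\<phi> \<in> symbol_space \<rho> \<Longrightarrow> pderivs \<beta> \<phi> \<in> symbol_space \<rho>"
  by (induction \<beta>) (auto intro: symbol_partial_deriv)

lemma pderivs_convolution:
  assumes "a \<in> borel_measurable borel" "integrable lborel (\<lambda>\<eta>. cmod (a \<eta>) * bracket \<eta> powr \<rho>)"
    and \<phi>: "\<phi> \<in> symbol_space \<rho>"
  shows "pderivs \<beta> (convolution a \<phi>) = convolution a (pderivs \<beta> \<phi>)"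
  by (induction \<beta>) (auto simp: partial_deriv_convolution[OF assms(1,2) symbol_pderivs[OF \<phi>]])

lemma convolution_smooth:
  assumes a: "a \<in> borel_measurable borel" "integrable lborel (\<lambda>\<eta>. cmod (a \<eta>) * bracket \<eta> powr \<rho>)"
    and \<phi>: "\<phi> \<in> symbol_space \<rho>"
  shows "convolution a \<phi> \<in> smooth_space"
proof (rule smooth_coinduct[where X="convolution a ` symbol_space \<rho>"])
  fix \<zeta> x i assume "\<zeta> \<in> convolution a ` symbol_space \<rho>"
  then obtain \<psi> where \<psi>: "\<psi> \<in> symbol_space \<rho>" "\<zeta> = convolution a \<psi>" by auto
  show "\<zeta> differentiable at x"
    unfolding \<psi> differentiable_def using convolution_has_derivative[OF a \<psi>(1)] by blast
  show "partial_deriv i \<zeta> \<in> convolution a ` symbol_space \<rho>"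
    unfolding \<psi> partial_deriv_convolution[OF a \<psi>(1)] by (intro imageI symbol_partial_deriv \<psi>(1))
qed (use \<phi> in auto)

text \<open>
  Convolution of a function of order \<open>\<sigma>\<close> with a rapidly decreasing one has order \<open>\<sigma>\<close>, with an
  explicit dependence of the bound on both factors: Peetre's inequality moves the growth of \<open>a\<close>
  from \<open>\<eta>\<close> to \<open>x\<close> at the expense of the decay of \<open>\<phi>\<close>.
\<close>

definition peetre_constant :: "'n::finite itself \<Rightarrow> real \<Rightarrow> real" where
  "peetre_constant _ \<sigma> = 2 powr \<bar>\<sigma>\<bar> * (\<integral>z. bracket (z :: real^'n) powr (- real CARD('n)) \<partial>lborel)"

lemma peetre_constant_nonneg [simp]: "0 \<le> peetre_constant t \<sigma>"
  unfolding peetre_constant_def by simp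

lemma integrable_order:
  fixes a :: "real^'n \<Rightarrow> complex"
  assumes [measurable]: "a \<in> borel_measurable borel"
    and aA: "\<And>\<eta>. cmod (a \<eta>) \<le> A * bracket \<eta> powr \<sigma>"
  shows "integrable lborel (\<lambda>\<eta>. cmod (a \<eta>) * bracket \<eta> powr (- \<bar>\<sigma>\<bar> - real CARD('n)))"
proof -
  have A: "0 \<le> A"
    using order_trans[OF norm_ge_zero aA[of 0]] by (simp add: bracket_def)
  have "integrable lborel (\<lambda>\<eta> :: real^'n. A * bracket \<eta> powr - real CARD('n))"
    by (intro integrable_mult_right integrable_bracket_powr) simp
  then show ?thesis
  proof (rule Bochner_Integration.integrable_bound)
    show "AE \<eta> in lborel. norm (cmod (a \<eta>) * bracket \<eta> powr (- \<bar>\<sigma>\<bar> - real CARD('n))) \<le>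
        norm (A * bracket \<eta> powr - real CARD('n))"
    proof (rule AE_I2)
      fix \<eta> :: "real^'n"
      have "cmod (a \<eta>) * bracket \<eta> powr (- \<bar>\<sigma>\<bar> - real CARD('n)) \<le>
          (A * bracket \<eta> powr \<sigma>) * bracket \<eta> powr (- \<bar>\<sigma>\<bar> - real CARD('n))"
        by (intro mult_right_mono aA) auto
      also have "\<dots> = A * bracket \<eta> powr (\<sigma> - \<bar>\<sigma>\<bar> - real CARD('n))"
        by (simp add: mult.assoc powr_add[symmetric] algebra_simps)
      also have "\<dots> \<le> A * bracket \<eta> powr - real CARD('n)"
        by (intro mult_left_mono bracket_powr_mono A) auto
      finally show "norm (cmod (a \<eta>) * bracket \<eta> powr (- \<bar>\<sigma>\<bar> - real CARD('n))) \<le>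
        norm (A * bracket \<eta> powr - real CARD('n))" using A by simp
    qed
  qed measurable
qed

lemma cmod_convolution_le:
  fixes a :: "real^'n \<Rightarrow> complex"
  assumes [measurable]: "a \<in> borel_measurable borel"
    and aA: "\<And>\<eta>. cmod (a \<eta>) \<le> A * bracket \<eta> powr \<sigma>"
    and \<phi>: "\<phi> \<in> symbol_space (- \<bar>\<sigma>\<bar> - real CARD('n))"
    and Q: "\<And>x. cmod (\<phi> x) \<le> Q * bracket x powr (- \<bar>\<sigma>\<bar> - real CARD('n))"
  shows "cmod (convolution a \<phi> x) \<le> peetre_constant TYPE('n) \<sigma> * A * Q * bracket x powr \<sigma>"
proof -
  have A: "0 \<le> A"
    using order_trans[OF norm_ge_zero aA[of 0]] by (simp add: bracket_def)
  have Q0: "0 \<le> Q"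
    using order_trans[OF norm_ge_zero Q[of 0]] by (simp add: bracket_def)
  let ?M = "A * Q * (2 powr \<bar>\<sigma>\<bar> * bracket x powr \<sigma>)"
  have i: "integrable lborel (\<lambda>z :: real^'n. bracket z powr - real CARD('n))"
    by (rule integrable_bracket_powr) simp
  have "cmod (convolution a \<phi> x) \<le> (\<integral>\<eta>. ?M * bracket (x - \<eta>) powr - real CARD('n) \<partial>lborel)"
    unfolding convolution_def
  proof (rule Bochner_Integration.integral_norm_bound_integral)
    show "integrable lborel (\<lambda>\<eta>. a \<eta> * \<phi> (x - \<eta>))"
      by (rule convolution_integrable[OF assms(1) integrable_order[OF assms(1) aA] \<phi>])
    show "integrable lborel (\<lambda>\<eta>. ?M * bracket (x - \<eta>) powr - real CARD('n))"
      by (intro integrable_mult_right integrable_reflect[OF i])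
    fix \<eta>
    have "bracket \<eta> powr \<sigma> \<le> 2 powr \<bar>\<sigma>\<bar> * bracket x powr \<sigma> * bracket (x - \<eta>) powr \<bar>\<sigma>\<bar>"
      using bracket_powr_add_le[of x "- (x - \<eta>)" \<sigma>] by (simp only: bracket_minus) simp
    then have "cmod (a \<eta>) \<le> A * (2 powr \<bar>\<sigma>\<bar> * bracket x powr \<sigma> * bracket (x - \<eta>) powr \<bar>\<sigma>\<bar>)"
      using order_trans[OF aA mult_left_mono[OF _ A]] by blast
    then have "cmod (a \<eta> * \<phi> (x - \<eta>)) \<le> (A * (2 powr \<bar>\<sigma>\<bar> * bracket x powr \<sigma> * bracket (x - \<eta>) powr \<bar>\<sigma>\<bar>)) *
        (Q * bracket (x - \<eta>) powr (- \<bar>\<sigma>\<bar> - real CARD('n)))"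
      unfolding norm_mult using A by (intro mult_mono Q) auto
    also have "\<dots> = ?M * (bracket (x - \<eta>) powr \<bar>\<sigma>\<bar> * bracket (x - \<eta>) powr (- \<bar>\<sigma>\<bar> - real CARD('n)))"
      by (simp only: mult_ac)
    also have "\<dots> = ?M * bracket (x - \<eta>) powr - real CARD('n)"
      unfolding powr_add[symmetric] by simp
    finally show "cmod (a \<eta> * \<phi> (x - \<eta>)) \<le> ?M * bracket (x - \<eta>) powr - real CARD('n)" .
  qed
  also have "\<dots> = ?M * (\<integral>\<eta>. bracket (x - \<eta>) powr - real CARD('n) \<partial>lborel)" by simp
  also have "(\<integral>\<eta>. bracket (x - \<eta>) powr - real CARD('n) \<partial>lborel) = (\<integral>z. bracket (z :: real^'n) powr - real CARD('n) \<partial>lborel)"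
    by (rule integral_reflect) measurable
  finally show ?thesis unfolding peetre_constant_def by (simp add: mult_ac)
qed

lemma jet_convolution_le:
  fixes a :: "real^'n \<Rightarrow> complex"
  assumes a: "a \<in> borel_measurable borel" and aA: "\<And>\<eta>. cmod (a \<eta>) \<le> A * bracket \<eta> powr \<sigma>"
    and \<phi>: "\<phi> \<in> symbol_space (- \<bar>\<sigma>\<bar> - real CARD('n))"
    and Q: "\<And>x. jet m \<phi> x \<le> Q * bracket x powr (- \<bar>\<sigma>\<bar> - real CARD('n))"
  shows "jet m (convolution a \<phi>) x \<le>
    real (CARD('n) + 1) ^ m * (peetre_constant TYPE('n) \<sigma> * A * Q * bracket x powr \<sigma>)"
proof (rule jet_le_pderivs)
  fix \<beta> :: "'n list" assume "length \<beta> \<le> m"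
  then show "cmod (pderivs \<beta> (convolution a \<phi>) x) \<le> peetre_constant TYPE('n) \<sigma> * A * Q * bracket x powr \<sigma>"
    unfolding pderivs_convolution[OF a integrable_order[OF a aA] \<phi>]
    by (intro cmod_convolution_le[OF a aA] symbol_pderivs[OF \<phi>] order_trans[OF pderivs_le_jet Q])
qed

lemma convolution_schwartz_symbol:
  fixes a :: "real^'n \<Rightarrow> complex"
  assumes a: "a \<in> borel_measurable borel" and aA: "\<And>\<eta>. cmod (a \<eta>) \<le> A * bracket \<eta> powr \<sigma>"
    and \<phi>: "\<phi> \<in> schwartz_space"
  shows "convolution a \<phi> \<in> symbol_space \<sigma>"
proof -
  have "\<exists>C. \<forall>x. jet m (convolution a \<phi>) x \<le> C * bracket x powr \<sigma>" for m
  proof -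
    obtain Q where Q: "\<And>x. jet m \<phi> x \<le> Q * bracket x powr (- \<bar>\<sigma>\<bar> - real CARD('n))"
      by (rule symbol_jet_le[OF schwartz_symbol[OF \<phi>]]) (rule that)
    show ?thesis
      using jet_convolution_le[OF a aA schwartz_symbol[OF \<phi>] Q]
      by (intro exI[of _ "real (CARD('n) + 1) ^ m * (peetre_constant TYPE('n) \<sigma> * A * Q)"])
        (simp add: mult_ac)
  qed
  moreover have "convolution a \<phi> \<in> smooth_space"
    by (rule convolution_smooth[OF a integrable_order[OF a aA] schwartz_symbol[OF \<phi>]])
  ultimately show ?thesis unfolding symbol_space_def by simp
qed

section \<open>Continuous linear forms commute with convolution\<close>

lemma linear_form_on_sum:
  assumes u: "linear_form_on V u" and V: "function_space V"
    and "finite I" "\<And>i. i \<in> I \<Longrightarrow> \<phi> i \<in> V"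
  shows "(\<lambda>x. \<Sum>i\<in>I. c i * \<phi> i x) \<in> V \<and> u (\<lambda>x. \<Sum>i\<in>I. c i * \<phi> i x) = (\<Sum>i\<in>I. c i * u (\<phi> i))"
  using assms(3,4)
proof (induction I rule: finite_induct)
  case empty
  show ?case
    using function_space_zero[OF V] linear_form_on_cmult[OF u function_space_zero[OF V], of 0] by simp
next
  case (insert i I)
  have i: "(\<lambda>x. c i * \<phi> i x) \<in> V" using insert by (intro function_space_cmult[OF V]) auto
  have I: "(\<lambda>x. \<Sum>i\<in>I. c i * \<phi> i x) \<in> V" "u (\<lambda>x. \<Sum>i\<in>I. c i * \<phi> i x) = (\<Sum>i\<in>I. c i * u (\<phi> i))"
    using insert by auto
  have "u (\<lambda>x. c i * \<phi> i x) = c i * u (\<phi> i)" using insert by (intro linear_form_on_cmult[OF u]) auto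
  then show ?case
    using function_space_add[OF V i I(1)] linear_form_on_add[OF u i I(1)] I(2) insert by simp
qed

lemma pderivs_sum:
  assumes "finite I" "\<And>i. i \<in> I \<Longrightarrow> \<phi> i \<in> smooth_space"
  shows "(\<lambda>x. \<Sum>i\<in>I. c i * \<phi> i x) \<in> smooth_space \<and>
    pderivs \<beta> (\<lambda>x. \<Sum>i\<in>I. c i * \<phi> i x) = (\<lambda>x. \<Sum>i\<in>I. c i * pderivs \<beta> (\<phi> i) x)"
  using assms
proof (induction I rule: finite_induct)
  case empty
  have "pderivs \<beta> (\<lambda>x. 0 * (0 :: complex)) = (\<lambda>x. 0)"
    by (subst pderivs_cmult[OF smooth_const]) simp
  then show ?case by (simp add: smooth_const)
next
  case (insert i I)
  have i: "(\<lambda>x. c i * \<phi> i x) \<in> smooth_space" using insert by (intro smooth_cmult) auto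
  have I: "(\<lambda>x. \<Sum>i\<in>I. c i * \<phi> i x) \<in> smooth_space"
    "pderivs \<beta> (\<lambda>x. \<Sum>i\<in>I. c i * \<phi> i x) = (\<lambda>x. \<Sum>i\<in>I. c i * pderivs \<beta> (\<phi> i) x)"
    using insert by auto
  have "pderivs \<beta> (\<lambda>x. c i * \<phi> i x) = (\<lambda>x. c i * pderivs \<beta> (\<phi> i) x)"
    using insert by (intro pderivs_cmult) auto
  then show ?case
    using smooth_add[OF i I(1)] pderivs_add[OF i I(1), of \<beta>] I(2) insert by simp
qed

lemma pderivs_translate:
  "\<phi> \<in> smooth_space \<Longrightarrow> pderivs \<beta> (translate \<eta> \<phi>) = translate \<eta> (pderivs \<beta> \<phi>)"
  by (induction \<beta>) (auto simp: partial_deriv_translate smooth_pderivs)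

text \<open>
  For a function that depends on its variable through a simple function the integral is a finite sum.  With \<open>H\<close> a form applied to
  translates this is the case of \<open>linear_form_convolution\<close> in which linearity suffices.
\<close>

lemma simple_function_integral:
  fixes a :: "'a \<Rightarrow> complex" and s :: "'a \<Rightarrow> 'b"
  assumes s: "simple_function M s" and a: "integrable M a"
  shows "integrable M (\<lambda>\<eta>. a \<eta> * H (s \<eta>))"
    and "(\<integral>\<eta>. a \<eta> * H (s \<eta>) \<partial>M) =
      (\<Sum>v\<in>s ` space M. (\<integral>\<eta>. indicator (s -` {v} \<inter> space M) \<eta> *\<^sub>R a \<eta> \<partial>M) * H v)"
proof -
  let ?I = "\<lambda>v. s -` {v} \<inter> space M"
  have fin: "finite (s ` space M)" and sets: "v \<in> s ` space M \<Longrightarrow> ?I v \<in> sets M" for v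
    using s by (auto simp: simple_function_def)
  have eq: "a \<eta> * H (s \<eta>) = (\<Sum>v\<in>s ` space M. (indicator (?I v) \<eta> *\<^sub>R a \<eta>) * H v)" if "\<eta> \<in> space M" for \<eta>
  proof -
    have "(\<Sum>v\<in>s ` space M. (indicator (?I v) \<eta> *\<^sub>R a \<eta>) * H v) = (\<Sum>v\<in>s ` space M. if v = s \<eta> then a \<eta> * H v else 0)"
      using that by (intro sum.cong refl) (auto simp: indicator_def)
    then show ?thesis using fin that by simp
  qed
  have i: "integrable M (\<lambda>\<eta>. (indicator (?I v) \<eta> *\<^sub>R a \<eta>) * H v)" if "v \<in> s ` space M" for v
    by (intro integrable_mult_left integrable_mult_indicator sets that a)
  have "integrable M (\<lambda>\<eta>. \<Sum>v\<in>s ` space M. (indicator (?I v) \<eta> *\<^sub>R a \<eta>) * H v)"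
    by (intro Bochner_Integration.integrable_sum i)
  then show "integrable M (\<lambda>\<eta>. a \<eta> * H (s \<eta>))"
    by (subst Bochner_Integration.integrable_cong[OF refl eq])
  have "(\<integral>\<eta>. a \<eta> * H (s \<eta>) \<partial>M) = (\<integral>\<eta>. (\<Sum>v\<in>s ` space M. (indicator (?I v) \<eta> *\<^sub>R a \<eta>) * H v) \<partial>M)"
    by (rule Bochner_Integration.integral_cong[OF refl eq])
  also have "\<dots> = (\<Sum>v\<in>s ` space M. (\<integral>\<eta>. (indicator (?I v) \<eta> *\<^sub>R a \<eta>) * H v \<partial>M))"
    by (rule Bochner_Integration.integral_sum[OF i])
  finally show "(\<integral>\<eta>. a \<eta> * H (s \<eta>) \<partial>M) =
      (\<Sum>v\<in>s ` space M. (\<integral>\<eta>. indicator (?I v) \<eta> *\<^sub>R a \<eta> \<partial>M) * H v)"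
    by (simp only: integral_mult_left_zero)
qed

lemma norm_le_bracket: "norm x \<le> bracket x"
proof -
  have "2 * norm x \<le> bracket x"
    using zero_le_power2[of "norm x - 1"] unfolding bracket_def power2_diff by simp
  moreover have "norm x \<le> 2 * norm x" by simp
  ultimately show ?thesis by (rule order_trans[rotated])
qed

lemma pderivs_diff:
  assumes "\<phi> \<in> smooth_space" "\<psi> \<in> smooth_space"
  shows "pderivs \<beta> (\<lambda>x. \<phi> x - \<psi> x) = (\<lambda>x. pderivs \<beta> \<phi> x - pderivs \<beta> \<psi> x)"
  using pderivs_add[OF assms(1) smooth_cmult[OF assms(2), of "-1"], of \<beta>] pderivs_cmult[OF assms(2), of \<beta> "-1"]
  by simp

lemma integrable_bracket_weaken:
  fixes a :: "real^'n \<Rightarrow> complex"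
  assumes [measurable]: "a \<in> borel_measurable borel"
    and a: "integrable lborel (\<lambda>\<eta>. cmod (a \<eta>) * bracket \<eta> powr \<sigma>)" and "\<rho> \<le> \<sigma>"
  shows "integrable lborel (\<lambda>\<eta>. cmod (a \<eta>) * bracket \<eta> powr \<rho>)"
proof (rule Bochner_Integration.integrable_bound[OF a])
  show "AE \<eta> in lborel. norm (cmod (a \<eta>) * bracket \<eta> powr \<rho>) \<le> norm (cmod (a \<eta>) * bracket \<eta> powr \<sigma>)"
  proof (rule AE_I2)
    fix \<eta>
    have "cmod (a \<eta>) * bracket \<eta> powr \<rho> \<le> cmod (a \<eta>) * bracket \<eta> powr \<sigma>"
      by (intro mult_left_mono bracket_powr_mono assms) simp
    then show "norm (cmod (a \<eta>) * bracket \<eta> powr \<rho>) \<le> norm (cmod (a \<eta>) * bracket \<eta> powr \<sigma>)"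
      by simp
  qed
qed measurable

lemma convolution_symbol:
  fixes a :: "real^'n \<Rightarrow> complex"
  assumes am [measurable]: "a \<in> borel_measurable borel"
    and a: "integrable lborel (\<lambda>\<eta>. cmod (a \<eta>) * bracket \<eta> powr \<bar>\<rho>\<bar>)"
    and \<phi>: "\<phi> \<in> symbol_space \<rho>"
  shows "convolution a \<phi> \<in> symbol_space \<rho>"
proof -
  have a\<rho>: "integrable lborel (\<lambda>\<eta>. cmod (a \<eta>) * bracket \<eta> powr \<rho>)"
    by (rule integrable_bracket_weaken[OF am a]) simp
  have "\<exists>C. \<forall>x. jet m (convolution a \<phi>) x \<le> C * bracket x powr \<rho>" for m
  proof -
    obtain C where C: "0 \<le> C" "\<And>x. jet m \<phi> x \<le> C * bracket x powr \<rho>"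
      by (rule symbol_jet_le[OF \<phi>]) (rule that)
    define I where "I = (\<integral>\<eta>. cmod (a \<eta>) * bracket \<eta> powr \<bar>\<rho>\<bar> \<partial>lborel)"
    have "jet m (convolution a \<phi>) x \<le> real (CARD('n) + 1) ^ m * (C * 2 powr \<bar>\<rho>\<bar> * bracket x powr \<rho> * I)" for x
    proof (rule jet_le_pderivs)
      fix \<beta> :: "'n list" assume \<beta>: "length \<beta> \<le> m"
      have "cmod (convolution a (pderivs \<beta> \<phi>) x) \<le>
          (\<integral>\<eta>. (C * 2 powr \<bar>\<rho>\<bar> * bracket x powr \<rho>) * (cmod (a \<eta>) * bracket \<eta> powr \<bar>\<rho>\<bar>) \<partial>lborel)"
        unfolding convolution_def
      proof (rule Bochner_Integration.integral_norm_bound_integral)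
        show "integrable lborel (\<lambda>\<eta>. a \<eta> * pderivs \<beta> \<phi> (x - \<eta>))"
          by (rule convolution_integrable[OF am a\<rho> symbol_pderivs[OF \<phi>]])
        show "integrable lborel (\<lambda>\<eta>. (C * 2 powr \<bar>\<rho>\<bar> * bracket x powr \<rho>) * (cmod (a \<eta>) * bracket \<eta> powr \<bar>\<rho>\<bar>))"
          by (intro integrable_mult_right a)
        fix \<eta>
        have "cmod (pderivs \<beta> \<phi> (x - \<eta>)) \<le> C * bracket (x + - \<eta>) powr \<rho>"
          using order_trans[OF pderivs_le_jet[OF \<beta>] C(2)] by simp
        also have "\<dots> \<le> C * (2 powr \<bar>\<rho>\<bar> * bracket x powr \<rho> * bracket (- \<eta>) powr \<bar>\<rho>\<bar>)"
          by (intro mult_left_mono bracket_powr_add_le C)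
        finally have "cmod (a \<eta>) * cmod (pderivs \<beta> \<phi> (x - \<eta>)) \<le>
            cmod (a \<eta>) * (C * (2 powr \<bar>\<rho>\<bar> * bracket x powr \<rho> * bracket (- \<eta>) powr \<bar>\<rho>\<bar>))"
          by (intro mult_left_mono) auto
        then show "cmod (a \<eta> * pderivs \<beta> \<phi> (x - \<eta>)) \<le>
            (C * 2 powr \<bar>\<rho>\<bar> * bracket x powr \<rho>) * (cmod (a \<eta>) * bracket \<eta> powr \<bar>\<rho>\<bar>)"
          by (simp add: norm_mult mult_ac)
      qed
      then show "cmod (pderivs \<beta> (convolution a \<phi>) x) \<le> C * 2 powr \<bar>\<rho>\<bar> * bracket x powr \<rho> * I"
        unfolding pderivs_convolution[OF am a\<rho> \<phi>] I_def by simp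
    qed
    then show ?thesis
      by (intro exI[of _ "real (CARD('n) + 1) ^ m * (C * 2 powr \<bar>\<rho>\<bar> * I)"]) (simp add: mult_ac)
  qed
  moreover have "convolution a \<phi> \<in> smooth_space" by (rule convolution_smooth[OF am a\<rho> \<phi>])
  ultimately show ?thesis unfolding symbol_space_def by simp
qed

text \<open>
  A convolution is a limit, in the topology of symbols, of linear combinations of translates:
  replace \<open>\<eta>\<close> by a simple function \<open>s i \<eta>\<close> that approximates it.  The error is controlled by the
  increments of \<open>\<phi>\<close> between \<open>\<eta>\<close> and \<open>s i \<eta>\<close>, weighted with \<open>a\<close>, and tends to zero by dominated
  convergence.
\<close>

theorem linear_form_convolution:
  fixes a \<phi> :: "real^'n \<Rightarrow> complex" and L :: "(real^'n \<Rightarrow> complex) \<Rightarrow> complex"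
  assumes L: "linear_form_on (symbol_space \<rho>) L" and C: "0 \<le> C"
    and Lb: "\<And>\<psi> B. \<psi> \<in> symbol_space \<rho> \<Longrightarrow> (\<And>x. jet m \<psi> x \<le> B * bracket x powr \<rho>) \<Longrightarrow> cmod (L \<psi>) \<le> C * B"
    and am [measurable]: "a \<in> borel_measurable borel"
    and a: "integrable lborel (\<lambda>\<eta>. cmod (a \<eta>) * bracket \<eta> powr (2 * \<bar>\<rho>\<bar> + 1))"
    and \<phi>: "\<phi> \<in> symbol_space \<rho>"
  shows "integrable lborel (\<lambda>\<eta>. a \<eta> * L (translate \<eta> \<phi>))"
    and "L (convolution a \<phi>) = (\<integral>\<eta>. a \<eta> * L (translate \<eta> \<phi>) \<partial>lborel)"
proof -
  let ?r = "\<bar>\<rho>\<bar>"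
  note sm = symbol_smooth[OF \<phi>] and V = function_space_symbol[of \<rho>]
  have a\<rho>: "integrable lborel (\<lambda>\<eta>. cmod (a \<eta>) * bracket \<eta> powr \<rho>)"
    and ar: "integrable lborel (\<lambda>\<eta>. cmod (a \<eta>) * bracket \<eta> powr ?r)"
    and a0: "integrable lborel (\<lambda>\<eta>. cmod (a \<eta>) * bracket \<eta> powr 0)"
    by (rule integrable_bracket_weaken[OF am a]; simp)+
  have ai: "integrable lborel a"
    by (rule Bochner_Integration.integrable_bound[OF a0]) auto
  obtain C1 where C1: "0 \<le> C1" "\<And>x. jet (Suc m) \<phi> x \<le> C1 * bracket x powr \<rho>"
    by (rule symbol_jet_le[OF \<phi>]) (rule that)
  define N where "N = real (CARD('n) + 1) ^ m"
  define K where "K = real CARD('n) * C1 * 2 powr ?r * 2 powr ?r"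
  \<comment> \<open>Up to constants, the increment of a derivative of \<open>\<phi>\<close> between \<open>x - \<eta>\<close> and \<open>x - \<eta>'\<close>.\<close>
  define D where "D \<eta> \<eta>' = norm (\<eta> - \<eta>') * (bracket \<eta> powr ?r * bracket (\<eta> - \<eta>') powr ?r)" for \<eta> \<eta>' :: "real^'n"
  have N: "0 \<le> N" and K: "0 \<le> K" and D0: "0 \<le> D \<eta> \<eta>'" for \<eta> \<eta>'
    unfolding N_def K_def D_def using C1 by auto
  have inc: "cmod (pderivs \<beta> \<phi> (x - \<eta>') - pderivs \<beta> \<phi> (x - \<eta>)) \<le> K * D \<eta> \<eta>' * bracket x powr \<rho>"
    if \<beta>: "length \<beta> \<le> m" for \<beta> x \<eta> \<eta>'
  proof -
    have "cmod (partial_deriv i (pderivs \<beta> \<phi>) x) \<le> C1 * bracket x powr \<rho>" for i x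
      using order_trans[OF pderivs_le_jet[of "i # \<beta>" "Suc m" \<phi> x] C1(2)] \<beta> by simp
    from increment_symbol_le[OF smooth_pderivs[OF sm] C1(1) this, of "x - \<eta>" "\<eta> - \<eta>'"]
    have "cmod (pderivs \<beta> \<phi> (x - \<eta>') - pderivs \<beta> \<phi> (x - \<eta>)) \<le>
        real CARD('n) * C1 * 2 powr ?r * norm (\<eta> - \<eta>') * (bracket (x + - \<eta>) powr \<rho> * bracket (\<eta> - \<eta>') powr ?r)"
      by simp
    also have "\<dots> \<le> real CARD('n) * C1 * 2 powr ?r * norm (\<eta> - \<eta>') *
        ((2 powr ?r * bracket x powr \<rho> * bracket (- \<eta>) powr ?r) * bracket (\<eta> - \<eta>') powr ?r)"
      by (intro mult_left_mono mult_right_mono bracket_powr_add_le) (use C1 in auto)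
    also have "\<dots> = K * D \<eta> \<eta>' * bracket x powr \<rho>"
      unfolding K_def D_def by (simp add: mult_ac)
    finally show ?thesis .
  qed
  define F where "F \<eta> = L (translate \<eta> \<phi>)" for \<eta>
  have tr: "translate \<eta> \<phi> \<in> symbol_space \<rho>" for \<eta> by (rule symbol_translate[OF \<phi>])
  have Finc: "cmod (F \<eta>' - F \<eta>) \<le> C * (N * K * D \<eta> \<eta>')" for \<eta> \<eta>'
    unfolding F_def linear_form_on_diff[OF L V tr tr, symmetric]
  proof (rule Lb[OF symbol_diff[OF tr tr]])
    fix x
    have "jet m (\<lambda>x. translate \<eta>' \<phi> x - translate \<eta> \<phi> x) x \<le> N * (K * D \<eta> \<eta>' * bracket x powr \<rho>)"
      unfolding N_def
    proof (rule jet_le_pderivs)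
      fix \<beta> :: "'n list" assume "length \<beta> \<le> m"
      from inc[OF this] show "cmod (pderivs \<beta> (\<lambda>x. translate \<eta>' \<phi> x - translate \<eta> \<phi> x) x) \<le> K * D \<eta> \<eta>' * bracket x powr \<rho>"
        by (simp add: pderivs_diff translate_smooth sm pderivs_translate) (simp add: translate_def)
    qed
    then show "jet m (\<lambda>x. translate \<eta>' \<phi> x - translate \<eta> \<phi> x) x \<le> N * K * D \<eta> \<eta>' * bracket x powr \<rho>"
      by (simp add: mult_ac)
  qed
  define C3 where "C3 = C * (C1 * 2 powr ?r)"
  have C3: "0 \<le> C3" unfolding C3_def using C C1 by simp
  have Fb: "cmod (F \<eta>) \<le> C3 * bracket \<eta> powr ?r" for \<eta>
  proof -
    have "cmod (F \<eta>) \<le> C * (C1 * 2 powr ?r * bracket \<eta> powr ?r)"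
      unfolding F_def
    proof (rule Lb[OF tr])
      fix x
      have "jet m (translate \<eta> \<phi>) x \<le> C1 * bracket (x + - \<eta>) powr \<rho>"
        using order_trans[OF jet_le_Suc C1(2)] by (simp add: jet_translate sm)
      also have "\<dots> \<le> C1 * (2 powr ?r * bracket x powr \<rho> * bracket (- \<eta>) powr ?r)"
        by (intro mult_left_mono bracket_powr_add_le C1)
      finally show "jet m (translate \<eta> \<phi>) x \<le> C1 * 2 powr ?r * bracket \<eta> powr ?r * bracket x powr \<rho>"
        by (simp add: mult_ac)
    qed
    then show ?thesis unfolding C3_def by (simp add: mult_ac)
  qed

  \<comment> \<open>Simple functions converging to the identity; the factor 2 keeps them below an integrable majorant.\<close>
  obtain s :: "nat \<Rightarrow> real^'n \<Rightarrow> real^'n" where s: "\<And>i. simple_function lborel (s i)"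
    and s_lim: "\<And>\<eta>. (\<lambda>i. s i \<eta>) \<longlonglongrightarrow> \<eta>" and s_le: "\<And>i \<eta>. norm (s i \<eta>) \<le> 2 * norm \<eta>"
    using borel_measurable_implies_sequence_metric[of "\<lambda>x :: real^'n. x" lborel 0]
    by (auto simp: dist_norm)
  have sm_i [measurable]: "s i \<in> borel_measurable borel" for i
    using borel_measurable_simple_function[OF s[of i]] by simp
  have fin: "finite (range (s i))" for i using s[of i] by (simp add: simple_function_def)
  have br: "bracket (\<eta> - s i \<eta>) \<le> 9 * bracket \<eta>" "bracket (s i \<eta>) \<le> 4 * bracket \<eta>" for i \<eta>
  proof -
    have "norm (\<eta> - s i \<eta>) \<le> 3 * norm \<eta>" using norm_triangle_ineq4[of \<eta> "s i \<eta>"] s_le[of i \<eta>] by simp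
    then have "(norm (\<eta> - s i \<eta>))\<^sup>2 \<le> (3 * norm \<eta>)\<^sup>2" by (intro power_mono) auto
    then show "bracket (\<eta> - s i \<eta>) \<le> 9 * bracket \<eta>" unfolding bracket_def by (simp add: power_mult_distrib)
    have "(norm (s i \<eta>))\<^sup>2 \<le> (2 * norm \<eta>)\<^sup>2" by (intro power_mono s_le) auto
    then show "bracket (s i \<eta>) \<le> 4 * bracket \<eta>" unfolding bracket_def by (simp add: power_mult_distrib)
  qed
  have D_le: "D \<eta> (s i \<eta>) \<le> norm (\<eta> - s i \<eta>) * (9 powr ?r * bracket \<eta> powr (2 * ?r))" for i \<eta>
  proof -
    have "bracket (\<eta> - s i \<eta>) powr ?r \<le> (9 * bracket \<eta>) powr ?r" by (intro powr_mono2 br) auto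
    then have "D \<eta> (s i \<eta>) \<le> norm (\<eta> - s i \<eta>) * (bracket \<eta> powr ?r * (9 * bracket \<eta>) powr ?r)"
      unfolding D_def by (intro mult_left_mono) auto
    also have "(9 * bracket \<eta>) powr ?r = 9 powr ?r * bracket \<eta> powr ?r" by (simp add: powr_mult)
    finally show ?thesis unfolding mult_2 powr_add by (simp only: mult_ac)
  qed
  have D_lim: "(\<lambda>i. D \<eta> (s i \<eta>)) \<longlonglongrightarrow> 0" for \<eta>
  proof (rule tendsto_sandwich[OF _ _ tendsto_const])
    have "(\<lambda>i. norm (\<eta> - s i \<eta>)) \<longlonglongrightarrow> norm (\<eta> - \<eta>)"
      by (intro tendsto_norm tendsto_diff tendsto_const s_lim)
    then have "(\<lambda>i. norm (\<eta> - s i \<eta>)) \<longlonglongrightarrow> 0" by simp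
    from tendsto_mult_left_zero[OF this]
    show "(\<lambda>i. norm (\<eta> - s i \<eta>) * (9 powr ?r * bracket \<eta> powr (2 * ?r))) \<longlonglongrightarrow> 0" .
  qed (auto intro: always_eventually D0 D_le)
  have D_dom: "D \<eta> (s i \<eta>) \<le> 3 * 9 powr ?r * bracket \<eta> powr (2 * ?r + 1)" for i \<eta>
  proof -
    have "norm (\<eta> - s i \<eta>) \<le> 3 * bracket \<eta>"
      using norm_triangle_ineq4[of \<eta> "s i \<eta>"] s_le[of i \<eta>] norm_le_bracket[of \<eta>] by linarith
    then have "norm (\<eta> - s i \<eta>) * (9 powr ?r * bracket \<eta> powr (2 * ?r)) \<le>
        (3 * bracket \<eta>) * (9 powr ?r * bracket \<eta> powr (2 * ?r))"
      by (intro mult_right_mono) auto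
    with D_le[of \<eta> i] have "D \<eta> (s i \<eta>) \<le> (3 * bracket \<eta>) * (9 powr ?r * bracket \<eta> powr (2 * ?r))"
      by (rule order_trans)
    also have "\<dots> = 3 * 9 powr ?r * bracket \<eta> powr (2 * ?r + 1)"
      by (simp add: powr_add)
    finally show ?thesis .
  qed
  have D_meas [measurable]: "(\<lambda>\<eta>. D \<eta> (s i \<eta>)) \<in> borel_measurable borel" for i
    unfolding D_def by measurable
  have D_dom': "cmod (a \<eta>) * D \<eta> (s i \<eta>) \<le> (3 * 9 powr ?r) * (cmod (a \<eta>) * bracket \<eta> powr (2 * ?r + 1))" for i \<eta>
    using mult_left_mono[OF D_dom[of \<eta> i], of "cmod (a \<eta>)"] by (simp add: mult_ac)
  have iD: "integrable lborel (\<lambda>\<eta>. cmod (a \<eta>) * D \<eta> (s i \<eta>))" for i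
  proof (rule Bochner_Integration.integrable_bound[OF integrable_mult_right[OF a, of "3 * 9 powr ?r"]])
    show "AE \<eta> in lborel. norm (cmod (a \<eta>) * D \<eta> (s i \<eta>)) \<le>
        norm ((3 * 9 powr ?r) * (cmod (a \<eta>) * bracket \<eta> powr (2 * ?r + 1)))"
      using D_dom'[of _ i] D0 by (intro AE_I2) simp
  qed measurable
  define \<delta> where "\<delta> i = (\<integral>\<eta>. cmod (a \<eta>) * D \<eta> (s i \<eta>) \<partial>lborel)" for i
  have "\<delta> \<longlonglongrightarrow> (\<integral>\<eta>. 0 \<partial>(lborel :: (real^'n) measure))"
    unfolding \<delta>_def
  proof (rule integral_dominated_convergence[where w="\<lambda>\<eta>. (3 * 9 powr ?r) * (cmod (a \<eta>) * bracket \<eta> powr (2 * ?r + 1))"])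
    show "AE \<eta> in lborel. (\<lambda>i. cmod (a \<eta>) * D \<eta> (s i \<eta>)) \<longlonglongrightarrow> 0"
      by (intro AE_I2 tendsto_mult_right_zero D_lim)
    show "AE \<eta> in lborel. norm (cmod (a \<eta>) * D \<eta> (s i \<eta>)) \<le> (3 * 9 powr ?r) * (cmod (a \<eta>) * bracket \<eta> powr (2 * ?r + 1))" for i
      using D_dom' D0 by (intro AE_I2) simp
    show "integrable lborel (\<lambda>\<eta>. (3 * 9 powr ?r) * (cmod (a \<eta>) * bracket \<eta> powr (2 * ?r + 1)))"
      by (intro integrable_mult_right a)
  qed auto
  then have \<delta>_lim: "\<delta> \<longlonglongrightarrow> 0" by simp

  \<comment> \<open>\<open>S i\<close> is the convolution with the kernel variable rounded to the finitely many values of \<open>s i\<close>.\<close>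
  define A where "A i v = (\<integral>\<eta>. indicator (s i -` {v}) \<eta> *\<^sub>R a \<eta> \<partial>lborel)" for i v
  define S where "S i x = (\<Sum>v\<in>range (s i). A i v * translate v \<phi> x)" for i x
  have sfi: "integrable lborel (\<lambda>\<eta>. a \<eta> * H (s i \<eta>))"
    "(\<integral>\<eta>. a \<eta> * H (s i \<eta>) \<partial>lborel) = (\<Sum>v\<in>range (s i). A i v * H v)" for i and H :: "real^'n \<Rightarrow> complex"
    using simple_function_integral[OF s[of i] ai, of H] unfolding A_def by simp_all
  have S_eq: "S i = (\<lambda>x. \<Sum>v\<in>range (s i). A i v * translate v \<phi> x)" for i
    by (rule ext) (rule S_def)
  have S: "S i \<in> symbol_space \<rho>" "L (S i) = (\<integral>\<eta>. a \<eta> * F (s i \<eta>) \<partial>lborel)" for i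
  proof -
    note * = linear_form_on_sum[OF L V fin[of i], of "\<lambda>v. translate v \<phi>" "A i", OF tr]
    show "S i \<in> symbol_space \<rho>" unfolding S_eq by (rule conjunct1[OF *])
    show "L (S i) = (\<integral>\<eta>. a \<eta> * F (s i \<eta>) \<partial>lborel)"
      unfolding S_eq sfi(2)[where H=F] unfolding F_def by (rule conjunct2[OF *])
  qed
  have S_pd: "pderivs \<beta> (S i) x = (\<integral>\<eta>. a \<eta> * pderivs \<beta> \<phi> (x - s i \<eta>) \<partial>lborel)" for \<beta> i x
  proof -
    have "pderivs \<beta> (S i) x = (\<Sum>v\<in>range (s i). A i v * pderivs \<beta> (translate v \<phi>) x)"
      unfolding S_eq using conjunct2[OF pderivs_sum[OF fin[of i] translate_smooth[OF sm], of "A i" "\<lambda>v. v" \<beta>]]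
      by (rule fun_cong)
    then show ?thesis
      unfolding pderivs_translate[OF sm] sfi(2)[where H="\<lambda>v. pderivs \<beta> \<phi> (x - v)"]
      unfolding translate_def .
  qed
  have conv: "convolution a \<phi> \<in> symbol_space \<rho>" by (rule convolution_symbol[OF am ar \<phi>])
  have "cmod (L (convolution a \<phi>) - L (S i)) \<le> C * (N * K * \<delta> i)" for i
    unfolding linear_form_on_diff[OF L V conv S(1), symmetric]
  proof (rule Lb[OF symbol_diff[OF conv S(1)]])
    fix x
    have "jet m (\<lambda>x. convolution a \<phi> x - S i x) x \<le> N * ((K * bracket x powr \<rho>) * \<delta> i)"
      unfolding N_def
    proof (rule jet_le_pderivs)
      fix \<beta> :: "'n list" assume \<beta>: "length \<beta> \<le> m"
      have i1: "integrable lborel (\<lambda>\<eta>. a \<eta> * pderivs \<beta> \<phi> (x - \<eta>))"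
        by (rule convolution_integrable[OF am a\<rho> symbol_pderivs[OF \<phi>]])
      have i2: "integrable lborel (\<lambda>\<eta>. a \<eta> * pderivs \<beta> \<phi> (x - s i \<eta>))"
        by (rule sfi(1)[of "\<lambda>v. pderivs \<beta> \<phi> (x - v)"])
      have "pderivs \<beta> (\<lambda>x. convolution a \<phi> x - S i x) x =
          (\<integral>\<eta>. a \<eta> * pderivs \<beta> \<phi> (x - \<eta>) - a \<eta> * pderivs \<beta> \<phi> (x - s i \<eta>) \<partial>lborel)"
        unfolding pderivs_diff[OF symbol_smooth[OF conv] symbol_smooth[OF S(1)]] S_pd
          pderivs_convolution[OF am a\<rho> \<phi>]
        unfolding convolution_def by (rule Bochner_Integration.integral_diff[OF i1 i2, symmetric])
      moreover have "cmod (\<integral>\<eta>. a \<eta> * pderivs \<beta> \<phi> (x - \<eta>) - a \<eta> * pderivs \<beta> \<phi> (x - s i \<eta>) \<partial>lborel) \<le>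
          (\<integral>\<eta>. (K * bracket x powr \<rho>) * (cmod (a \<eta>) * D \<eta> (s i \<eta>)) \<partial>lborel)"
      proof (rule Bochner_Integration.integral_norm_bound_integral)
        show "integrable lborel (\<lambda>\<eta>. a \<eta> * pderivs \<beta> \<phi> (x - \<eta>) - a \<eta> * pderivs \<beta> \<phi> (x - s i \<eta>))"
          by (rule Bochner_Integration.integrable_diff[OF i1 i2])
        show "integrable lborel (\<lambda>\<eta>. (K * bracket x powr \<rho>) * (cmod (a \<eta>) * D \<eta> (s i \<eta>)))"
          by (rule integrable_mult_right[OF iD])
        fix \<eta>
        have "cmod (a \<eta> * pderivs \<beta> \<phi> (x - \<eta>) - a \<eta> * pderivs \<beta> \<phi> (x - s i \<eta>)) =
            cmod (a \<eta>) * cmod (pderivs \<beta> \<phi> (x - s i \<eta>) - pderivs \<beta> \<phi> (x - \<eta>))"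
          unfolding right_diff_distrib[symmetric] norm_mult by (simp add: norm_minus_commute)
        also have "\<dots> \<le> cmod (a \<eta>) * (K * D \<eta> (s i \<eta>) * bracket x powr \<rho>)"
          by (intro mult_left_mono inc[OF \<beta>]) simp
        finally show "cmod (a \<eta> * pderivs \<beta> \<phi> (x - \<eta>) - a \<eta> * pderivs \<beta> \<phi> (x - s i \<eta>)) \<le>
            (K * bracket x powr \<rho>) * (cmod (a \<eta>) * D \<eta> (s i \<eta>))"
          by (simp add: mult_ac)
      qed
      ultimately show "cmod (pderivs \<beta> (\<lambda>x. convolution a \<phi> x - S i x) x) \<le> (K * bracket x powr \<rho>) * \<delta> i"
        unfolding \<delta>_def by (simp only: integral_mult_right_zero)
    qed
    then show "jet m (\<lambda>x. convolution a \<phi> x - S i x) x \<le> N * K * \<delta> i * bracket x powr \<rho>"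
      by (simp add: mult_ac)
  qed
  then have "(\<lambda>i. L (convolution a \<phi>) - L (S i)) \<longlonglongrightarrow> 0"
    by (intro Lim_null_comparison[OF always_eventually tendsto_mult_right_zero[OF tendsto_mult_right_zero[OF \<delta>_lim]]] allI)
  then have lim1: "(\<lambda>i. L (S i)) \<longlonglongrightarrow> L (convolution a \<phi>)"
    using tendsto_diff[OF tendsto_const, of "\<lambda>i. L (convolution a \<phi>) - L (S i)" 0 sequentially "L (convolution a \<phi>)"]
    by simp

  \<comment> \<open>As a limit of the simple functions \<open>F (s i \<eta>)\<close>, the function \<open>F\<close> is measurable.\<close>
  have F_lim: "(\<lambda>i. F (s i \<eta>)) \<longlonglongrightarrow> F \<eta>" for \<eta>
  proof -
    have "(\<lambda>i. F (s i \<eta>) - F \<eta>) \<longlonglongrightarrow> 0"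
      by (intro Lim_null_comparison[OF always_eventually tendsto_mult_right_zero[OF tendsto_mult_right_zero[OF D_lim[of \<eta>]],
          where c1="N * K" and c=C]] allI Finc)
    then show ?thesis by (rule LIM_zero_cancel[of "\<lambda>i. F (s i \<eta>)"])
  qed
  have Fs_meas: "(\<lambda>\<eta>. F (s i \<eta>)) \<in> borel_measurable lborel" for i
    using borel_measurable_simple_function[OF simple_function_compose[OF s, of F]] by (simp add: comp_def)
  have F_meas: "F \<in> borel_measurable lborel"
    by (rule borel_measurable_LIMSEQ_metric[OF Fs_meas F_lim])
  have dom: "cmod (a \<eta> * F (s i \<eta>)) \<le> (C3 * 4 powr ?r) * (cmod (a \<eta>) * bracket \<eta> powr ?r)" for \<eta> i
  proof -
    have "cmod (F (s i \<eta>)) \<le> C3 * bracket (s i \<eta>) powr ?r" by (rule Fb)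
    also have "\<dots> \<le> C3 * (4 * bracket \<eta>) powr ?r" by (intro mult_left_mono powr_mono2 br C3) auto
    also have "(4 * bracket \<eta>) powr ?r = 4 powr ?r * bracket \<eta> powr ?r" by (simp add: powr_mult)
    finally have "cmod (a \<eta>) * cmod (F (s i \<eta>)) \<le> cmod (a \<eta>) * (C3 * (4 powr ?r * bracket \<eta> powr ?r))"
      by (intro mult_left_mono) auto
    then show ?thesis by (simp add: norm_mult mult_ac)
  qed
  have "integrable lborel (\<lambda>\<eta>. a \<eta> * F \<eta>)"
    and lim2: "(\<lambda>i. \<integral>\<eta>. a \<eta> * F (s i \<eta>) \<partial>lborel) \<longlonglongrightarrow> (\<integral>\<eta>. a \<eta> * F \<eta> \<partial>lborel)"
  proof -
    let ?w = "\<lambda>\<eta>. (C3 * 4 powr ?r) * (cmod (a \<eta>) * bracket \<eta> powr ?r)"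
    have 1: "(\<lambda>\<eta>. a \<eta> * F \<eta>) \<in> borel_measurable lborel"
      by (intro borel_measurable_times F_meas) simp
    have 2: "(\<lambda>\<eta>. a \<eta> * F (s i \<eta>)) \<in> borel_measurable lborel" for i
      by (intro borel_measurable_times Fs_meas) simp
    have 3: "integrable lborel ?w" by (rule integrable_mult_right[OF ar])
    have 4: "AE \<eta> in lborel. (\<lambda>i. a \<eta> * F (s i \<eta>)) \<longlonglongrightarrow> a \<eta> * F \<eta>"
      by (intro AE_I2 tendsto_mult tendsto_const F_lim)
    have 5: "AE \<eta> in lborel. norm (a \<eta> * F (s i \<eta>)) \<le> ?w \<eta>" for i
      by (intro AE_I2 dom)
    show "integrable lborel (\<lambda>\<eta>. a \<eta> * F \<eta>)" by (rule integrable_dominated_convergence[OF 1 2 3 4 5])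
    show "(\<lambda>i. \<integral>\<eta>. a \<eta> * F (s i \<eta>) \<partial>lborel) \<longlonglongrightarrow> (\<integral>\<eta>. a \<eta> * F \<eta> \<partial>lborel)"
      by (rule integral_dominated_convergence[OF 1 2 3 4 5])
  qed
  then show "integrable lborel (\<lambda>\<eta>. a \<eta> * L (translate \<eta> \<phi>))" unfolding F_def by simp
  show "L (convolution a \<phi>) = (\<integral>\<eta>. a \<eta> * L (translate \<eta> \<phi>) \<partial>lborel)"
    using LIMSEQ_unique[OF lim1[unfolded S(2)] lim2] unfolding F_def .
qed

section \<open>Gaussian cutoffs\<close>

definition cutoff :: "real \<Rightarrow> real^'n \<Rightarrow> complex" where
  "cutoff l x = of_real (exp (- (l\<^sup>2) * (norm x)\<^sup>2))"

lemma cutoff_schwartz: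
  assumes "0 < l"
  shows "(cutoff l :: real^'n \<Rightarrow> complex) \<in> schwartz_space"
proof (rule schwartz_spaceI)
  fix \<rho>
  have "elementary_symbol \<rho> (\<lambda>x :: real^'n. of_real ((1\<^sup>2 + (norm x)\<^sup>2) powr 0 * exp (- (l\<^sup>2) * (norm x)\<^sup>2)))"
    using assms by (intro elementary_symbol.base) auto
  moreover have "(\<lambda>x :: real^'n. complex_of_real ((1\<^sup>2 + (norm x)\<^sup>2) powr 0 * exp (- (l\<^sup>2) * (norm x)\<^sup>2))) = cutoff l"
  proof
    fix x :: "real^'n"
    have "(1 :: real)\<^sup>2 + (norm x)\<^sup>2 \<noteq> 0" using bracket_nonzero[of x] unfolding bracket_def by simp
    then show "complex_of_real ((1\<^sup>2 + (norm x)\<^sup>2) powr 0 * exp (- (l\<^sup>2) * (norm x)\<^sup>2)) = cutoff l x"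
      unfolding cutoff_def by simp
  qed
  ultimately show "(cutoff l :: real^'n \<Rightarrow> complex) \<in> symbol_space \<rho>"
    using elementary_symbol_in_symbol_space[of \<rho> "cutoff l"] by (simp only:)
qed

lemma cutoff_dilate: "cutoff l = (\<lambda>x. cutoff 1 (l *\<^sub>R x))"
  unfolding cutoff_def by (auto simp: power_mult_distrib)

lemma cmod_cutoff_le: "cmod (cutoff l x) \<le> 1"
  unfolding cutoff_def by simp

lemma cmod_one_minus_cutoff: "cmod (1 - cutoff l x) = 1 - exp (- (l\<^sup>2) * (norm x)\<^sup>2)"
proof -
  have "1 - cutoff l x = of_real (1 - exp (- (l\<^sup>2) * (norm x)\<^sup>2))" unfolding cutoff_def by simp
  moreover have "0 \<le> 1 - exp (- (l\<^sup>2) * (norm x)\<^sup>2)" by simp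
  ultimately show ?thesis by (simp only: norm_of_real abs_of_nonneg)
qed

lemma cmod_one_minus_cutoff_le:
  shows "cmod (1 - cutoff l x) \<le> 1" and "cmod (1 - cutoff l x) \<le> l\<^sup>2 * (norm x)\<^sup>2"
  unfolding cmod_one_minus_cutoff using exp_ge_add_one_self[of "- (l\<^sup>2) * (norm x)\<^sup>2"] by auto

lemma cutoff_mult_schwartz:
  assumes "\<phi> \<in> B_space" "0 < l"
  shows "(\<lambda>x. cutoff l x * \<phi> x) \<in> schwartz_space"
  using schwartz_mult_symbol[OF assms(1)[unfolded B_space_eq] cutoff_schwartz[OF assms(2)]]
  by (simp add: mult.commute)

lemma one_minus_cutoff_symbol:
  assumes "0 < l"
  shows "(\<lambda>x. 1 - cutoff l x) \<in> symbol_space 0"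
  by (rule symbol_diff[OF symbol_const schwartz_symbol[OF cutoff_schwartz[OF assms]]])

lemma jet_const_minus:
  assumes "\<phi> \<in> smooth_space"
  shows "jet m (\<lambda>x. c - \<phi> x) x - cmod (c - \<phi> x) = jet m \<phi> x - cmod (\<phi> x)"
proof (cases m)
  case (Suc k)
  have "partial_deriv i (\<lambda>x. c - \<phi> x) = (\<lambda>x. (-1) * partial_deriv i \<phi> x)" for i
  proof
    fix x
    have "partial_deriv i (\<lambda>x. c + (-1) * \<phi> x) x = partial_deriv i (\<lambda>x. c) x + partial_deriv i (\<lambda>x. (-1) * \<phi> x) x"
      by (rule partial_deriv_add[OF smooth_differentiable[OF smooth_const] smooth_differentiable[OF smooth_cmult[OF assms]]])
    also have "partial_deriv i (\<lambda>x. (-1) * \<phi> x) x = (-1) * partial_deriv i \<phi> x"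
      by (rule partial_deriv_cmult[OF smooth_differentiable[OF assms]])
    finally show "partial_deriv i (\<lambda>x. c - \<phi> x) x = (-1) * partial_deriv i \<phi> x"
      by (simp add: partial_deriv_const)
  qed
  then show ?thesis
    using jet_cmult[OF smooth_partial_deriv[OF assms], of k "-1"] by (simp add: Suc)
qed simp

text \<open>
  The complementary cutoffs cost no constant in the limit of wide cutoffs: their derivatives are
  \<open>O(l)\<close>.
\<close>

lemma jet_one_minus_cutoff_mult:
  obtains G where "0 \<le> G"
    "\<And>l \<psi> x. 0 < l \<Longrightarrow> l \<le> 1 \<Longrightarrow> \<psi> \<in> smooth_space \<Longrightarrow>
      jet m (\<lambda>x. (1 - cutoff l x) * \<psi> x) x \<le> (cmod (1 - cutoff l x) + l * G) * jet m \<psi> (x :: real^'n)"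
proof -
  have c1: "cutoff 1 \<in> (schwartz_space :: (real^'n \<Rightarrow> complex) set)" by (rule cutoff_schwartz) simp
  obtain G where G: "0 \<le> G" "\<And>x :: real^'n. jet m (cutoff 1) x \<le> G"
    by (rule symbol_jet_bounded[OF schwartz_symbol[OF c1]]) (rule that)
  have "jet m (\<lambda>x. (1 - cutoff l x) * \<psi> x) x \<le> (cmod (1 - cutoff l x) + l * (2 ^ m * G)) * jet m \<psi> x"
    if l: "0 < l" "l \<le> 1" and \<psi>: "\<psi> \<in> smooth_space" for l \<psi> and x :: "real^'n"
  proof -
    have sm: "cutoff l \<in> smooth_space" by (rule schwartz_smooth[OF cutoff_schwartz[OF l(1)]])
    have "jet m (\<lambda>x. 1 - cutoff l x) x - cmod (1 - cutoff l x) = jet m (cutoff l) x - cmod (cutoff l x)"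
      by (rule jet_const_minus[OF sm])
    also have "\<dots> \<le> l * jet m (cutoff 1) (l *\<^sub>R x)"
      unfolding cutoff_dilate[of l] using jet_dilate(1)[OF schwartz_smooth[OF c1], of l m x] l by simp
    also have "\<dots> \<le> l * G" using l by (intro mult_left_mono G) auto
    finally have le: "jet m (\<lambda>x. 1 - cutoff l x) x - cmod (1 - cutoff l x) \<le> l * G" .
    have "jet m (\<lambda>x. (1 - cutoff l x) * \<psi> x) x \<le>
        (cmod (1 - cutoff l x) + 2 ^ m * (jet m (\<lambda>x. 1 - cutoff l x) x - cmod (1 - cutoff l x))) * jet m \<psi> x"
      by (rule jet_mult_sharp[OF symbol_smooth[OF one_minus_cutoff_symbol[OF l(1)]] \<psi>])
    also have "\<dots> \<le> (cmod (1 - cutoff l x) + 2 ^ m * (l * G)) * jet m \<psi> x"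
      by (intro mult_right_mono add_left_mono mult_left_mono le) auto
    finally show ?thesis by (simp add: mult_ac)
  qed
  moreover have "0 \<le> 2 ^ m * G" using G by simp
  ultimately show ?thesis by (rule that[rotated])
qed

lemma jet_cutoff_mult:
  obtains G where "1 \<le> G"
    "\<And>l \<psi> x. 0 < l \<Longrightarrow> l \<le> 1 \<Longrightarrow> \<psi> \<in> smooth_space \<Longrightarrow>
      jet m (\<lambda>x. cutoff l x * \<psi> x) x \<le> G * jet m \<psi> (x :: real^'n)"
proof -
  have c1: "cutoff 1 \<in> (schwartz_space :: (real^'n \<Rightarrow> complex) set)" by (rule cutoff_schwartz) simp
  obtain G where G: "0 \<le> G" "\<And>x :: real^'n. jet m (cutoff 1) x \<le> G"
    by (rule symbol_jet_bounded[OF schwartz_symbol[OF c1]]) (rule that)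
  have "jet m (\<lambda>x. cutoff l x * \<psi> x) x \<le> (2 ^ m * G + 1) * jet m \<psi> x"
    if l: "0 < l" "l \<le> 1" and \<psi>: "\<psi> \<in> smooth_space" for l \<psi> and x :: "real^'n"
  proof -
    have "jet m (cutoff l) x \<le> G"
      unfolding cutoff_dilate[of l] using order_trans[OF jet_dilate(2)[OF schwartz_smooth[OF c1], of l m x] G(2)] l by simp
    then have "2 ^ m * jet m (cutoff l) x * jet m \<psi> x \<le> 2 ^ m * G * jet m \<psi> x"
      by (intro mult_right_mono mult_left_mono) auto
    also have "\<dots> \<le> (2 ^ m * G + 1) * jet m \<psi> x" by (simp add: distrib_right)
    finally show ?thesis
      by (rule order_trans[OF jet_mult[OF schwartz_smooth[OF cutoff_schwartz[OF l(1)]] \<psi>]])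
  qed
  moreover have "1 \<le> 2 ^ m * G + 1" using G by simp
  ultimately show ?thesis by (rule that[rotated])
qed

lemma schwartz_jet_decay:
  assumes "\<phi> \<in> schwartz_space" "0 < d"
  shows "\<exists>r>0. \<forall>x. r \<le> norm x \<longrightarrow> jet m \<phi> x \<le> d"
proof -
  obtain C where C: "0 \<le> C" "\<And>x. jet m \<phi> x \<le> C * bracket x powr - 1"
    by (rule symbol_jet_le[OF schwartz_symbol[OF assms(1)]]) (rule that)
  have "jet m \<phi> x \<le> d" if "C / d + 1 \<le> norm x" for x
  proof -
    have "C / d \<le> bracket x" using that norm_le_bracket[of x] by linarith
    then have "C \<le> d * bracket x" using assms(2) by (simp add: field_simps)
    then have "C * bracket x powr - 1 \<le> d" by (simp add: powr_minus_divide divide_le_eq)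
    then show ?thesis using C(2)[of x] by (rule order_trans[rotated])
  qed
  moreover have "0 < C / d + 1" using C assms by (intro add_nonneg_pos) auto
  ultimately show ?thesis by (intro exI[of _ "C / d + 1"]) auto
qed

section \<open>Integrable distributions\<close>

definition jet_bounded_form :: "nat \<Rightarrow> real \<Rightarrow> 'n::finite form \<Rightarrow> bool" where
  "jet_bounded_form m C u \<longleftrightarrow> linear_form_on schwartz_space u \<and> 0 \<le> C \<and>
    (\<forall>\<psi>\<in>schwartz_space. \<forall>B. (\<forall>x. jet m \<psi> x \<le> B) \<longrightarrow> cmod (u \<psi>) \<le> C * B)"

lemma jet_bounded_formD:
  assumes "jet_bounded_form m C u"
  shows "linear_form_on schwartz_space u" "0 \<le> C"
    "\<And>\<psi> B. \<psi> \<in> schwartz_space \<Longrightarrow> (\<And>x. jet m \<psi> x \<le> B) \<Longrightarrow> cmod (u \<psi>) \<le> C * B"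
  using assms unfolding jet_bounded_form_def by auto

text \<open>
  A form bounded by a jet is concentrated on bounded sets: if \<open>\<psi>0\<close> almost attains the
  norm of \<open>u\<close> and \<open>\<psi>1\<close> is a competitor of norm one that lives far away from \<open>\<psi>0\<close>, then
  \<open>\<psi>0 + \<psi>1\<close>, up to a phase, still has norm about one, so that \<open>\<bar>u \<psi>1\<bar>\<close> must be small.
\<close>

lemma jet_bounded_form_tail:
  fixes u :: "'n::finite form"
  assumes u: "jet_bounded_form m C u" and \<epsilon>: "0 < \<epsilon>"
  obtains l0 where "0 < l0" "l0 \<le> 1"
    "\<And>l \<psi> B. 0 < l \<Longrightarrow> l \<le> l0 \<Longrightarrow> \<psi> \<in> schwartz_space \<Longrightarrow> (\<forall>x. jet m \<psi> x \<le> B) \<Longrightarrow>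
      cmod (u (\<lambda>x. (1 - cutoff l x) * \<psi> x)) \<le> \<epsilon> * B"
proof -
  note lin = jet_bounded_formD(1)[OF u] and C = jet_bounded_formD(2)[OF u] and ub = jet_bounded_formD(3)[OF u]
  note V = function_space_schwartz
  define X where "X = {cmod (u \<psi>) | \<psi>. \<psi> \<in> schwartz_space \<and> (\<forall>x. jet m \<psi> x \<le> 1)}"
  define M where "M = Sup X"
  have z: "(\<lambda>_. 0) \<in> schwartz_space" "u (\<lambda>_. 0) = 0" "jet m (\<lambda>_. 0) x = 0" for x :: "real^'n"
    using function_space_zero[OF V] linear_form_on_cmult[OF lin function_space_zero[OF V], of 0]
      jet_cmult[OF smooth_const, of m 0 0 x] by auto
  have bdd: "bdd_above X" unfolding X_def using ub[of _ 1] by (intro bdd_aboveI[of _ C]) auto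
  have "cmod (u (\<lambda>_. 0)) \<in> X"
    unfolding X_def by (intro CollectI exI[of _ "\<lambda>_. 0"]) (simp add: z)
  then have ne: "X \<noteq> {}" and M0: "0 \<le> M" unfolding M_def using cSup_upper[OF _ bdd] z(2) by auto
  have MC: "M \<le> C" unfolding M_def using ub[of _ 1] by (intro cSup_least[OF ne]) (auto simp: X_def)
  have uM: "cmod (u \<psi>) \<le> M * B" if \<psi>: "\<psi> \<in> schwartz_space" and B: "0 < B" "\<And>x. jet m \<psi> x \<le> B" for \<psi> B
  proof -
    let ?\<zeta> = "\<lambda>x. of_real (1 / B) * \<psi> x"
    have "jet m ?\<zeta> x \<le> 1" for x
      unfolding jet_cmult[OF schwartz_smooth[OF \<psi>]] using B(1) B(2)[of x] by (simp add: norm_divide field_simps)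
    then have "cmod (u ?\<zeta>) \<in> X"
      unfolding X_def using function_space_cmult[OF V \<psi>, of "of_real (1 / B)"] by blast
    then have "cmod (u ?\<zeta>) \<le> M" unfolding M_def by (rule cSup_upper[OF _ bdd])
    moreover have "cmod (u ?\<zeta>) = cmod (u \<psi>) / B"
      using B(1) by (simp only: linear_form_on_cmult[OF lin \<psi>] norm_mult norm_of_real) simp
    ultimately show ?thesis using B(1) by (simp add: divide_le_eq)
  qed
  \<comment> \<open>The argument below yields the bound \<open>d + 2 * d * C\<close>.\<close>
  define d where "d = \<epsilon> / (1 + 2 * C)"
  have d: "0 < d" unfolding d_def using \<epsilon> C by (intro divide_pos_pos) auto
  have "M - d < Sup X" unfolding M_def using d by simp
  then obtain \<psi>0 where \<psi>0: "\<psi>0 \<in> schwartz_space" "\<And>x. jet m \<psi>0 x \<le> 1" "M - d < cmod (u \<psi>0)"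
    using less_cSup_iff[OF ne bdd] unfolding X_def by auto
  obtain r where r: "0 < r" "\<And>x. r \<le> norm x \<Longrightarrow> jet m \<psi>0 x \<le> d"
    using schwartz_jet_decay[OF \<psi>0(1) d, of m] by auto
  obtain G where G: "0 \<le> G" "\<And>l \<psi> x. 0 < l \<Longrightarrow> l \<le> 1 \<Longrightarrow> \<psi> \<in> smooth_space \<Longrightarrow>
      jet m (\<lambda>x. (1 - cutoff l x) * \<psi> x) x \<le> (cmod (1 - cutoff l x) + l * G) * jet m \<psi> (x :: real^'n)"
    by (rule jet_one_minus_cutoff_mult[of m]) (rule that)
  define l0 where "l0 = min 1 (d / (G + r\<^sup>2 + 1))"
  have Gr: "0 < G + r\<^sup>2 + 1" using G by (intro add_nonneg_pos add_nonneg_nonneg) auto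
  have l0: "0 < l0" "l0 \<le> 1" unfolding l0_def using d Gr by auto
  have small: "l * G \<le> d" "l\<^sup>2 * r\<^sup>2 \<le> d" if "0 < l" "l \<le> l0" for l
  proof -
    have "l \<le> d / (G + r\<^sup>2 + 1)" using that unfolding l0_def by simp
    then have *: "l * (G + r\<^sup>2 + 1) \<le> d" using Gr by (simp add: pos_le_divide_eq)
    have "l * G \<le> l * (G + r\<^sup>2 + 1)" "l * r\<^sup>2 \<le> l * (G + r\<^sup>2 + 1)" using that G by (intro mult_left_mono; simp)+
    moreover have "l\<^sup>2 * r\<^sup>2 \<le> l * r\<^sup>2"
      using that l0 by (intro mult_right_mono) (auto simp: power2_eq_square mult_left_le)
    ultimately show "l * G \<le> d" "l\<^sup>2 * r\<^sup>2 \<le> d" using * by linarith+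
  qed
  have unit: "cmod (u (\<lambda>x. (1 - cutoff l x) * \<psi> x)) \<le> \<epsilon>"
    if l: "0 < l" "l \<le> l0" and \<psi>: "\<psi> \<in> schwartz_space" and B: "\<And>x. jet m \<psi> x \<le> 1" for l \<psi>
  proof -
    define \<psi>1 where "\<psi>1 = (\<lambda>x. (1 - cutoff l x) * \<psi> x)"
    have \<psi>1: "\<psi>1 \<in> schwartz_space"
      unfolding \<psi>1_def by (rule schwartz_mult_symbol[OF one_minus_cutoff_symbol[OF l(1)] \<psi>])
    \<comment> \<open>The phase that rotates \<open>z\<close> onto the nonnegative reals.\<close>
    define c where "c z = (if z = 0 then 1 else cnj z / of_real (cmod z))" for z :: complex
    have c: "cmod (c z) = 1" "c z * z = of_real (cmod z)" for z
      unfolding c_def by (auto simp: norm_divide field_simps complex_norm_square[symmetric] power2_eq_square)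
    let ?T = "\<lambda>x. c (u \<psi>0) * \<psi>0 x + c (u \<psi>1) * \<psi>1 x"
    have T: "(\<lambda>x. c (u \<psi>0) * \<psi>0 x) \<in> schwartz_space" "(\<lambda>x. c (u \<psi>1) * \<psi>1 x) \<in> schwartz_space"
      by (intro function_space_cmult[OF V] \<psi>0 \<psi>1)+
    have jT: "jet m ?T x \<le> 1 + 2 * d" for x
    proof -
      have l1: "l \<le> 1" using l l0 by simp
      have 1: "jet m ?T x \<le> jet m \<psi>0 x + jet m \<psi>1 x"
        using jet_add[OF schwartz_smooth[OF T(1)] schwartz_smooth[OF T(2)], of m x]
        by (simp add: jet_cmult[OF schwartz_smooth] \<psi>0 \<psi>1 c)
      have 2: "jet m \<psi>1 x \<le> (cmod (1 - cutoff l x) + d) * 1"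
        unfolding \<psi>1_def
        by (rule order_trans[OF G(2)[OF l(1) l1 schwartz_smooth[OF \<psi>]]])
          (intro mult_mono add_mono small[OF l] B order_refl, use d in auto)
      \<comment> \<open>Where \<open>\<psi>0\<close> is not small, the complementary cutoff is.\<close>
      have 3: "jet m \<psi>0 x + cmod (1 - cutoff l x) \<le> 1 + d"
      proof (cases "r \<le> norm x")
        case True
        then show ?thesis using r(2)[of x] cmod_one_minus_cutoff_le(1)[of l x] by simp
      next
        case False
        then have "l\<^sup>2 * (norm x)\<^sup>2 \<le> l\<^sup>2 * r\<^sup>2" by (intro mult_left_mono power_mono) auto
        then show ?thesis
          using \<psi>0(2)[of x] cmod_one_minus_cutoff_le(2)[of l x] small(2)[OF l] by linarith
      qed
      show ?thesis using 1 2 3 by argo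
    qed
    have "cmod (u ?T) \<le> M * (1 + 2 * d)"
      by (rule uM[OF function_space_add[OF V T] _ jT]) (use d in simp)
    moreover have uT: "u ?T = of_real (cmod (u \<psi>0) + cmod (u \<psi>1))"
      using linear_form_on_add[OF lin T] by (simp add: linear_form_on_cmult[OF lin] \<psi>0 \<psi>1 c)
    ultimately have "cmod (u \<psi>0) + cmod (u \<psi>1) \<le> M * (1 + 2 * d)"
      unfolding uT norm_of_real by simp
    then have "cmod (u \<psi>1) \<le> d + 2 * d * M" using \<psi>0(3) by (simp add: algebra_simps)
    also have "\<dots> \<le> d + 2 * d * C" using d MC by simp
    also have "\<dots> = d * (1 + 2 * C)" by (simp add: algebra_simps)
    also have "\<dots> = \<epsilon>"
    proof -
      have "1 + 2 * C \<noteq> 0" using C by simp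
      then show ?thesis unfolding d_def by simp
    qed
    finally show ?thesis unfolding \<psi>1_def .
  qed
  have "cmod (u (\<lambda>x. (1 - cutoff l x) * \<psi> x)) \<le> \<epsilon> * B"
    if l: "0 < l" "l \<le> l0" and \<psi>: "\<psi> \<in> schwartz_space" and "\<forall>x. jet m \<psi> x \<le> B" for l \<psi> B
  proof -
    have B: "jet m \<psi> x \<le> B" for x using that by simp
    show ?thesis
    proof (cases "B = 0")
      case True
      then have "\<psi> x = 0" for x using order_trans[OF cmod_le_jet B, of x] by simp
      then show ?thesis using True by (simp add: z)
    next
      case False
      then have B0: "0 < B" using order_trans[OF jet_nonneg B] by (simp add: less_le)
      let ?\<zeta> = "\<lambda>x. of_real (1 / B) * \<psi> x"
      have \<psi>1: "(\<lambda>x. (1 - cutoff l x) * \<psi> x) \<in> schwartz_space"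
        by (rule schwartz_mult_symbol[OF one_minus_cutoff_symbol[OF l(1)] \<psi>])
      have "jet m ?\<zeta> x \<le> 1" for x
        unfolding jet_cmult[OF schwartz_smooth[OF \<psi>]] using B0 B[of x] by (simp add: norm_divide field_simps)
      then have "cmod (u (\<lambda>x. (1 - cutoff l x) * ?\<zeta> x)) \<le> \<epsilon>"
        by (intro unit l function_space_cmult[OF V \<psi>])
      moreover have "(\<lambda>x. (1 - cutoff l x) * ?\<zeta> x) = (\<lambda>x. of_real (1 / B) * ((1 - cutoff l x) * \<psi> x))"
        by (simp add: mult_ac)
      ultimately have "cmod (of_real (1 / B) * u (\<lambda>x. (1 - cutoff l x) * \<psi> x)) \<le> \<epsilon>"
        by (simp only: linear_form_on_cmult[OF lin \<psi>1])
      then show ?thesis using B0 by (simp add: norm_mult norm_divide field_simps)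
    qed
  qed
  with l0 show ?thesis by (rule that)
qed

text \<open>
  By the tail estimate, a form bounded by a jet extends from the Schwartz functions to all of
  \<open>B_space\<close> as a limit along wider and wider cutoffs.
\<close>

definition extension :: "'n::finite form \<Rightarrow> 'n form" where
  "extension u \<phi> = lim (\<lambda>k. u (\<lambda>x. cutoff (inverse (real (Suc k))) x * \<phi> x))"

lemma extension_approximation:
  fixes u :: "'n::finite form"
  assumes u: "jet_bounded_form m C u" and \<epsilon>: "0 < \<epsilon>"
  obtains l0 where "0 < l0" "l0 \<le> 1"
    "\<And>l \<phi> B. 0 < l \<Longrightarrow> l \<le> l0 \<Longrightarrow> \<phi> \<in> B_space \<Longrightarrow> (\<forall>x. jet m \<phi> x \<le> B) \<Longrightarrow>
      cmod (extension u \<phi> - u (\<lambda>x. cutoff l x * \<phi> x)) \<le> \<epsilon> * B"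
    "\<And>\<phi>. \<phi> \<in> B_space \<Longrightarrow>
      (\<lambda>k. u (\<lambda>x. cutoff (inverse (real (Suc k))) x * \<phi> x)) \<longlonglongrightarrow> extension u \<phi>"
proof -
  note lin = jet_bounded_formD(1)[OF u]
  note V = function_space_schwartz
  obtain G where G: "1 \<le> G" "\<And>l \<psi> x. 0 < l \<Longrightarrow> l \<le> 1 \<Longrightarrow> \<psi> \<in> smooth_space \<Longrightarrow>
      jet m (\<lambda>x. cutoff l x * \<psi> x) x \<le> G * jet m \<psi> (x :: real^'n)"
    by (rule jet_cutoff_mult[of m]) (rule that)
  have diff: "\<exists>l0>0. l0 \<le> 1 \<and> (\<forall>l l' \<phi> B. 0 < l \<longrightarrow> l \<le> l0 \<longrightarrow> 0 < l' \<longrightarrow> l' \<le> l0 \<longrightarrow> \<phi> \<in> B_space \<longrightarrow>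
      (\<forall>x. jet m \<phi> x \<le> B) \<longrightarrow> cmod (u (\<lambda>x. cutoff l x * \<phi> x) - u (\<lambda>x. cutoff l' x * \<phi> x)) \<le> \<epsilon> * B)"
    if \<epsilon>: "0 < \<epsilon>" for \<epsilon>
  proof -
    have \<epsilon>2: "0 < \<epsilon> / (2 * G)" using \<epsilon> G(1) by simp
    obtain l0 where l0: "0 < l0" "l0 \<le> 1"
      "\<And>l \<psi> B. 0 < l \<Longrightarrow> l \<le> l0 \<Longrightarrow> \<psi> \<in> schwartz_space \<Longrightarrow> (\<forall>x. jet m \<psi> x \<le> B) \<Longrightarrow>
        cmod (u (\<lambda>x. (1 - cutoff l x) * \<psi> x)) \<le> \<epsilon> / (2 * G) * B"
      by (rule jet_bounded_form_tail[OF u \<epsilon>2]) (rule that)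
    have "cmod (u (\<lambda>x. cutoff l x * \<phi> x) - u (\<lambda>x. cutoff l' x * \<phi> x)) \<le> \<epsilon> * B"
      if l: "0 < l" "l \<le> l0" "0 < l'" "l' \<le> l0" and \<phi>: "\<phi> \<in> B_space" and B: "\<forall>x. jet m \<phi> x \<le> B" for l l' \<phi> B
    proof -
      have sm: "\<phi> \<in> smooth_space" using \<phi> unfolding B_space_def by simp
      have half: "(\<lambda>x. (1 - cutoff l' x) * (cutoff l x * \<phi> x)) \<in> schwartz_space"
        "cmod (u (\<lambda>x. (1 - cutoff l' x) * (cutoff l x * \<phi> x))) \<le> \<epsilon> / 2 * B"
        if l: "0 < l" "l \<le> l0" "0 < l'" "l' \<le> l0" for l l'
      proof -
        have s: "(\<lambda>x. cutoff l x * \<phi> x) \<in> schwartz_space" by (rule cutoff_mult_schwartz[OF \<phi> l(1)])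
        then show "(\<lambda>x. (1 - cutoff l' x) * (cutoff l x * \<phi> x)) \<in> schwartz_space"
          by (rule schwartz_mult_symbol[OF one_minus_cutoff_symbol[OF l(3)]])
        have "jet m (\<lambda>x. cutoff l x * \<phi> x) x \<le> G * B" for x
        proof -
          have "jet m (\<lambda>x. cutoff l x * \<phi> x) x \<le> G * jet m \<phi> x"
            by (rule G(2)[OF l(1) _ sm]) (use l l0 in simp)
          also have "\<dots> \<le> G * B" using B G(1) by (intro mult_left_mono) auto
          finally show ?thesis .
        qed
        from l0(3)[OF l(3,4) s allI[OF this]]
        show "cmod (u (\<lambda>x. (1 - cutoff l' x) * (cutoff l x * \<phi> x))) \<le> \<epsilon> / 2 * B"
          using G(1) by simp
      qed
      \<comment> \<open>A difference of two cutoffs is a difference of two tails.\<close>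
      have "(\<lambda>x. cutoff l x * \<phi> x - cutoff l' x * \<phi> x) =
          (\<lambda>x. (1 - cutoff l' x) * (cutoff l x * \<phi> x) - (1 - cutoff l x) * (cutoff l' x * \<phi> x))"
        by (auto simp: algebra_simps)
      then have "u (\<lambda>x. cutoff l x * \<phi> x) - u (\<lambda>x. cutoff l' x * \<phi> x) =
          u (\<lambda>x. (1 - cutoff l' x) * (cutoff l x * \<phi> x)) - u (\<lambda>x. (1 - cutoff l x) * (cutoff l' x * \<phi> x))"
        using linear_form_on_diff[OF lin V cutoff_mult_schwartz[OF \<phi> l(1)] cutoff_mult_schwartz[OF \<phi> l(3)]]
          linear_form_on_diff[OF lin V half(1)[OF l] half(1)[OF l(3,4,1,2)]] by simp
      also have "cmod \<dots> \<le> \<epsilon> / 2 * B + \<epsilon> / 2 * B"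
        by (rule order_trans[OF norm_triangle_ineq4 add_mono[OF half(2)[OF l] half(2)[OF l(3,4,1,2)]]])
      finally show ?thesis by (simp add: field_simps)
    qed
    then show ?thesis using l0(1,2) by blast
  qed
  let ?l = "\<lambda>k. inverse (real (Suc k))"
  have small: "\<forall>\<^sub>F k in sequentially. ?l k \<le> l0" if "0 < l0" for l0
    using order_tendstoD(2)[OF LIMSEQ_inverse_real_of_nat that] by (rule eventually_mono) simp
  have lim: "(\<lambda>k. u (\<lambda>x. cutoff (?l k) x * \<phi> x)) \<longlonglongrightarrow> extension u \<phi>" if \<phi>: "\<phi> \<in> B_space" for \<phi>
  proof -
    obtain B where B: "0 \<le> B" "\<And>x. jet m \<phi> x \<le> B"
      by (rule symbol_jet_bounded[OF \<phi>[unfolded B_space_eq]]) (rule that)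
    have "Cauchy (\<lambda>k. u (\<lambda>x. cutoff (?l k) x * \<phi> x))"
    proof (rule metric_CauchyI)
      fix e :: real assume e: "0 < e"
      then have "0 < e / (B + 1)" using B by simp
      from diff[OF this] obtain l0 where l0: "0 < l0"
        "\<And>l l' \<phi> B'. 0 < l \<Longrightarrow> l \<le> l0 \<Longrightarrow> 0 < l' \<Longrightarrow> l' \<le> l0 \<Longrightarrow> \<phi> \<in> B_space \<Longrightarrow>
          (\<forall>x. jet m \<phi> x \<le> B') \<Longrightarrow> cmod (u (\<lambda>x. cutoff l x * \<phi> x) - u (\<lambda>x. cutoff l' x * \<phi> x)) \<le> e / (B + 1) * B'"
        by (elim exE conjE) blast
      obtain N where N: "\<And>k. N \<le> k \<Longrightarrow> ?l k \<le> l0"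
        using small[OF l0(1)] unfolding eventually_sequentially by auto
      have "dist (u (\<lambda>x. cutoff (?l j) x * \<phi> x)) (u (\<lambda>x. cutoff (?l k) x * \<phi> x)) < e" if "N \<le> j" "N \<le> k" for j k
      proof -
        have "dist (u (\<lambda>x. cutoff (?l j) x * \<phi> x)) (u (\<lambda>x. cutoff (?l k) x * \<phi> x)) \<le> e / (B + 1) * B"
          unfolding dist_norm by (rule l0(2)[OF _ N[OF that(1)] _ N[OF that(2)] \<phi> allI[OF B(2)]]) simp_all
        also have "\<dots> < e" using e B(1) by (simp add: field_simps)
        finally show ?thesis .
      qed
      then show "\<exists>N. \<forall>j\<ge>N. \<forall>k\<ge>N. dist (u (\<lambda>x. cutoff (?l j) x * \<phi> x)) (u (\<lambda>x. cutoff (?l k) x * \<phi> x)) < e"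
        by blast
    qed
    then show ?thesis
      unfolding extension_def using Cauchy_convergent_iff convergent_LIMSEQ_iff by blast
  qed
  from diff[OF \<epsilon>] obtain l0 where l0: "0 < l0" "l0 \<le> 1"
    "\<And>l l' \<phi> B. 0 < l \<Longrightarrow> l \<le> l0 \<Longrightarrow> 0 < l' \<Longrightarrow> l' \<le> l0 \<Longrightarrow> \<phi> \<in> B_space \<Longrightarrow>
      (\<forall>x. jet m \<phi> x \<le> B) \<Longrightarrow> cmod (u (\<lambda>x. cutoff l x * \<phi> x) - u (\<lambda>x. cutoff l' x * \<phi> x)) \<le> \<epsilon> * B"
    by (elim exE conjE) blast
  have "cmod (extension u \<phi> - u (\<lambda>x. cutoff l x * \<phi> x)) \<le> \<epsilon> * B"
    if l: "0 < l" "l \<le> l0" and \<phi>: "\<phi> \<in> B_space" and B: "\<forall>x. jet m \<phi> x \<le> B" for l \<phi> B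
  proof (rule tendsto_upperbound)
    show "(\<lambda>k. cmod (u (\<lambda>x. cutoff (?l k) x * \<phi> x) - u (\<lambda>x. cutoff l x * \<phi> x))) \<longlonglongrightarrow>
        cmod (extension u \<phi> - u (\<lambda>x. cutoff l x * \<phi> x))"
      by (intro tendsto_norm tendsto_diff tendsto_const lim \<phi>)
    show "\<forall>\<^sub>F k in sequentially. cmod (u (\<lambda>x. cutoff (?l k) x * \<phi> x) - u (\<lambda>x. cutoff l x * \<phi> x)) \<le> \<epsilon> * B"
      using small[OF l0(1)] by (rule eventually_mono) (rule l0(3)[OF _ _ l \<phi> B]; simp)
  qed simp
  with l0(1,2) show ?thesis using lim by (rule that)
qed

lemma extension_LIMSEQ:
  fixes u :: "'n::finite form"
  assumes u: "jet_bounded_form m C u" and \<phi>: "\<phi> \<in> B_space"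
  shows "(\<lambda>k. u (\<lambda>x. cutoff (inverse (real (Suc k))) x * \<phi> x)) \<longlonglongrightarrow> extension u \<phi>"
proof (rule extension_approximation[OF u zero_less_one])
  assume lim: "\<And>\<phi>. \<phi> \<in> B_space \<Longrightarrow>
      (\<lambda>k. u (\<lambda>x. cutoff (inverse (real (Suc k))) x * \<phi> x)) \<longlonglongrightarrow> extension u \<phi>"
  show ?thesis by (rule lim[OF \<phi>])
qed

lemma extension_linear:
  fixes u :: "'n::finite form"
  assumes u: "jet_bounded_form m C u"
  shows "linear_form_on B_space (extension u)"
proof -
  note lin = jet_bounded_formD(1)[OF u]
  let ?l = "\<lambda>k. inverse (real (Suc k))"
  have lim: "(\<lambda>k. u (\<lambda>x. cutoff (?l k) x * \<phi> x)) \<longlonglongrightarrow> extension u \<phi>" if "\<phi> \<in> B_space" for \<phi>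
    by (rule extension_LIMSEQ[OF u that])
  have V: "function_space (B_space :: (real^'n \<Rightarrow> complex) set)"
    unfolding B_space_eq by (rule function_space_symbol)
  have cs: "(\<lambda>x. cutoff (?l k) x * \<phi> x) \<in> schwartz_space" if "\<phi> \<in> B_space" for \<phi> k
    by (rule cutoff_mult_schwartz[OF that]) simp
  show ?thesis
    unfolding linear_form_on_def
  proof (intro conjI ballI allI)
    fix \<phi> \<psi> :: "real^'n \<Rightarrow> complex" assume \<phi>: "\<phi> \<in> B_space" and \<psi>: "\<psi> \<in> B_space"
    have "u (\<lambda>x. cutoff (?l k) x * (\<phi> x + \<psi> x)) = u (\<lambda>x. cutoff (?l k) x * \<phi> x) + u (\<lambda>x. cutoff (?l k) x * \<psi> x)" for k
      using linear_form_on_add[OF lin cs[OF \<phi>] cs[OF \<psi>]] by (simp only: distrib_left)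
    then have "(\<lambda>k. u (\<lambda>x. cutoff (?l k) x * (\<phi> x + \<psi> x))) \<longlonglongrightarrow> extension u \<phi> + extension u \<psi>"
      using tendsto_add[OF lim[OF \<phi>] lim[OF \<psi>]] by (simp only:)
    then show "extension u (\<lambda>x. \<phi> x + \<psi> x) = extension u \<phi> + extension u \<psi>"
      by (rule LIMSEQ_unique[OF lim[OF function_space_add[OF V \<phi> \<psi>]]])
  next
    fix c and \<phi> :: "real^'n \<Rightarrow> complex" assume \<phi>: "\<phi> \<in> B_space"
    have "u (\<lambda>x. cutoff (?l k) x * (c * \<phi> x)) = c * u (\<lambda>x. cutoff (?l k) x * \<phi> x)" for k
      using linear_form_on_cmult[OF lin cs[OF \<phi>], of c] by (simp only: mult.left_commute)
    then have "(\<lambda>k. u (\<lambda>x. cutoff (?l k) x * (c * \<phi> x))) \<longlonglongrightarrow> c * extension u \<phi>"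
      using tendsto_mult_left[OF lim[OF \<phi>], of c] by (simp only:)
    then show "extension u (\<lambda>x. c * \<phi> x) = c * extension u \<phi>"
      by (rule LIMSEQ_unique[OF lim[OF function_space_cmult[OF V \<phi>]]])
  qed
qed

lemma half_quotient_le:
  fixes B e :: real
  assumes "0 \<le> B" "0 \<le> e"
  shows "e / (2 * (B + 1)) * B \<le> e / 2"
proof -
  have "e / 2 * (B / (B + 1)) \<le> e / 2 * 1"
    using assms by (intro mult_left_mono) (auto simp: divide_le_eq)
  moreover have "e / (2 * (B + 1)) * B = e / 2 * (B / (B + 1))" by simp
  ultimately show ?thesis by (simp only: mult_1_right)
qed

text \<open>
  Both a Schwartz function and its extended value are approximated by the same cutoffs.
\<close>

lemma extension_schwartz:
  fixes u :: "'n::finite form"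
  assumes u: "jet_bounded_form m C u" and \<psi>: "\<psi> \<in> schwartz_space"
  shows "extension u \<psi> = u \<psi>"
proof -
  note lin = jet_bounded_formD(1)[OF u]
  have \<psi>B: "\<psi> \<in> B_space" using \<psi> schwartz_subset_B by auto
  obtain B where B: "0 \<le> B" "\<And>x. jet m \<psi> x \<le> B"
    by (rule symbol_jet_bounded[OF schwartz_symbol[OF \<psi>]]) (rule that)
  have "cmod (extension u \<psi> - u \<psi>) \<le> 0 + e" if e: "0 < e" for e
  proof -
    have e': "0 < e / (2 * (B + 1))" using e B by simp
    obtain l1 where l1: "0 < l1" "l1 \<le> 1"
      "\<And>l \<psi> B'. 0 < l \<Longrightarrow> l \<le> l1 \<Longrightarrow> \<psi> \<in> schwartz_space \<Longrightarrow> (\<forall>x. jet m \<psi> x \<le> B') \<Longrightarrow>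
        cmod (u (\<lambda>x. (1 - cutoff l x) * \<psi> x)) \<le> e / (2 * (B + 1)) * B'"
      by (rule jet_bounded_form_tail[OF u e']) (rule that)
    obtain l2 where l2: "0 < l2" "l2 \<le> 1"
      "\<And>l \<phi> B'. 0 < l \<Longrightarrow> l \<le> l2 \<Longrightarrow> \<phi> \<in> B_space \<Longrightarrow> (\<forall>x. jet m \<phi> x \<le> B') \<Longrightarrow>
        cmod (extension u \<phi> - u (\<lambda>x. cutoff l x * \<phi> x)) \<le> e / (2 * (B + 1)) * B'"
      by (rule extension_approximation[OF u e']) (rule that)
    define l where "l = min l1 l2"
    have l: "0 < l" "l \<le> l1" "l \<le> l2" unfolding l_def using l1(1) l2(1) by auto
    have "(\<lambda>x. (1 - cutoff l x) * \<psi> x) = (\<lambda>x. \<psi> x - cutoff l x * \<psi> x)" by (auto simp: algebra_simps)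
    then have "u \<psi> - u (\<lambda>x. cutoff l x * \<psi> x) = u (\<lambda>x. (1 - cutoff l x) * \<psi> x)"
      using linear_form_on_diff[OF lin function_space_schwartz \<psi> cutoff_mult_schwartz[OF \<psi>B l(1)]] by (simp only:)
    then have 1: "cmod (u \<psi> - u (\<lambda>x. cutoff l x * \<psi> x)) \<le> e / (2 * (B + 1)) * B"
      using l1(3)[OF l(1,2) \<psi> allI[OF B(2)]] by (simp only:)
    have 2: "cmod (extension u \<psi> - u (\<lambda>x. cutoff l x * \<psi> x)) \<le> e / (2 * (B + 1)) * B"
      by (rule l2(3)[OF l(1,3) \<psi>B allI[OF B(2)]])
    have "cmod (extension u \<psi> - u \<psi>) \<le>
        cmod (extension u \<psi> - u (\<lambda>x. cutoff l x * \<psi> x)) + cmod (u \<psi> - u (\<lambda>x. cutoff l x * \<psi> x))"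
      using norm_triangle_ineq4[of "extension u \<psi> - u (\<lambda>x. cutoff l x * \<psi> x)" "u \<psi> - u (\<lambda>x. cutoff l x * \<psi> x)"] by simp
    also have "\<dots> \<le> e / (2 * (B + 1)) * B + e / (2 * (B + 1)) * B" by (rule add_mono[OF 2 1])
    also have "\<dots> \<le> e / 2 + e / 2"
      by (rule add_mono; rule half_quotient_le) (use B(1) e in simp_all)
    also have "\<dots> = 0 + e" by simp
    finally show ?thesis .
  qed
  then have "cmod (extension u \<psi> - u \<psi>) \<le> 0" by (rule field_le_epsilon)
  then show ?thesis by simp
qed

lemma extension_bound:
  fixes u :: "'n::finite form"
  assumes u: "jet_bounded_form m C u"
  obtains D where "0 \<le> D"
    "\<And>\<phi> B. \<phi> \<in> B_space \<Longrightarrow> (\<forall>x. jet m \<phi> x \<le> B) \<Longrightarrow> cmod (extension u \<phi>) \<le> D * B"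
proof -
  note C = jet_bounded_formD(2)[OF u] and ub = jet_bounded_formD(3)[OF u]
  obtain G where G: "1 \<le> G" "\<And>l \<psi> x. 0 < l \<Longrightarrow> l \<le> 1 \<Longrightarrow> \<psi> \<in> smooth_space \<Longrightarrow>
      jet m (\<lambda>x. cutoff l x * \<psi> x) x \<le> G * jet m \<psi> (x :: real^'n)"
    by (rule jet_cutoff_mult[of m]) (rule that)
  obtain l0 where l0: "0 < l0" "l0 \<le> 1"
    "\<And>l \<phi> B. 0 < l \<Longrightarrow> l \<le> l0 \<Longrightarrow> \<phi> \<in> B_space \<Longrightarrow> (\<forall>x. jet m \<phi> x \<le> B) \<Longrightarrow>
      cmod (extension u \<phi> - u (\<lambda>x. cutoff l x * \<phi> x)) \<le> 1 * B"
    by (rule extension_approximation[OF u zero_less_one]) (rule that)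
  have "cmod (extension u \<phi>) \<le> (1 + C * G) * B" if \<phi>: "\<phi> \<in> B_space" and B: "\<forall>x. jet m \<phi> x \<le> B" for \<phi> B
  proof -
    have sm: "\<phi> \<in> smooth_space" using \<phi> unfolding B_space_def by simp
    have "jet m (\<lambda>x. cutoff l0 x * \<phi> x) x \<le> G * B" for x
      by (rule order_trans[OF G(2)[OF l0(1,2) sm] mult_left_mono[OF spec[OF B]]]) (use G(1) in simp)
    then have 1: "cmod (u (\<lambda>x. cutoff l0 x * \<phi> x)) \<le> C * (G * B)"
      by (rule ub[OF cutoff_mult_schwartz[OF \<phi> l0(1)]])
    have 2: "cmod (extension u \<phi> - u (\<lambda>x. cutoff l0 x * \<phi> x)) \<le> 1 * B"
      by (rule l0(3)[OF l0(1) order_refl \<phi> B])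
    have "cmod (extension u \<phi>) \<le> cmod (extension u \<phi> - u (\<lambda>x. cutoff l0 x * \<phi> x)) + cmod (u (\<lambda>x. cutoff l0 x * \<phi> x))"
      using norm_triangle_ineq[of "extension u \<phi> - u (\<lambda>x. cutoff l0 x * \<phi> x)" "u (\<lambda>x. cutoff l0 x * \<phi> x)"] by simp
    also have "\<dots> \<le> 1 * B + C * (G * B)" by (rule add_mono[OF 2 1])
    finally show ?thesis by (simp add: algebra_simps)
  qed
  moreover have "0 \<le> 1 + C * G" using C G(1) by simp
  ultimately show ?thesis by (rule that[rotated])
qed

text \<open>Smallness of the jet on a large ball makes the extension small, uniformly on bounded sets.\<close>

lemma extension_local:
  fixes u :: "'n::finite form"
  assumes u: "jet_bounded_form m C u" and e: "0 < e" and B: "0 \<le> B"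
  obtains r d where "0 < r" "0 < d"
    "\<And>\<phi>. \<phi> \<in> B_space \<Longrightarrow> (\<forall>x. jet m \<phi> x \<le> B) \<Longrightarrow> (\<forall>x. norm x \<le> r \<longrightarrow> jet m \<phi> x \<le> d) \<Longrightarrow>
      cmod (extension u \<phi>) \<le> e"
proof -
  note C = jet_bounded_formD(2)[OF u] and ub = jet_bounded_formD(3)[OF u]
  obtain G where G: "1 \<le> G" "\<And>l \<psi> x. 0 < l \<Longrightarrow> l \<le> 1 \<Longrightarrow> \<psi> \<in> smooth_space \<Longrightarrow>
      jet m (\<lambda>x. cutoff l x * \<psi> x) x \<le> G * jet m \<psi> (x :: real^'n)"
    by (rule jet_cutoff_mult[of m]) (rule that)
  have e': "0 < e / (2 * (B + 1))" using e B by simp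
  obtain l where l: "0 < l" "l \<le> 1"
    "\<And>l' \<phi> B'. 0 < l' \<Longrightarrow> l' \<le> l \<Longrightarrow> \<phi> \<in> B_space \<Longrightarrow> (\<forall>x. jet m \<phi> x \<le> B') \<Longrightarrow>
      cmod (extension u \<phi> - u (\<lambda>x. cutoff l' x * \<phi> x)) \<le> e / (2 * (B + 1)) * B'"
    by (rule extension_approximation[OF u e']) (rule that)
  define t where "t = e / (2 * (C + 1))"
  have t: "0 < t" unfolding t_def using e C by simp
  have cl: "cutoff l \<in> (schwartz_space :: (real^'n \<Rightarrow> complex) set)" by (rule cutoff_schwartz[OF l(1)])
  have "0 < t / (2 ^ m * (B + 1))" using t B by simp
  then obtain r where r: "0 < r" "\<And>x :: real^'n. r \<le> norm x \<Longrightarrow> jet m (cutoff l) x \<le> t / (2 ^ m * (B + 1))"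
    using schwartz_jet_decay[OF cl, of _ m] by blast
  have "cmod (extension u \<phi>) \<le> e"
    if \<phi>: "\<phi> \<in> B_space" and \<phi>B: "\<forall>x. jet m \<phi> x \<le> B" and \<phi>d: "\<forall>x. norm x \<le> r \<longrightarrow> jet m \<phi> x \<le> t / G" for \<phi>
  proof -
    have sm: "\<phi> \<in> smooth_space" using \<phi> unfolding B_space_def by simp
    \<comment> \<open>On the ball of radius \<open>r\<close> the function is small by assumption, outside of it the cutoff is.\<close>
    have "jet m (\<lambda>x. cutoff l x * \<phi> x) x \<le> t" for x
    proof (cases "norm x \<le> r")
      case True
      have "jet m (\<lambda>x. cutoff l x * \<phi> x) x \<le> G * (t / G)"
        by (rule order_trans[OF G(2)[OF l(1,2) sm] mult_left_mono[OF \<phi>d[rule_format, OF True]]]) (use G(1) in simp)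
      then show ?thesis using G(1) by simp
    next
      case False
      have "jet m (\<lambda>x. cutoff l x * \<phi> x) x \<le> 2 ^ m * jet m (cutoff l) x * jet m \<phi> x"
        by (rule jet_mult[OF schwartz_smooth[OF cl] sm])
      also have "\<dots> \<le> 2 ^ m * (t / (2 ^ m * (B + 1))) * B"
        using False t B by (intro mult_mono mult_left_mono r spec[OF \<phi>B]) auto
      also have "\<dots> = t * (B / (B + 1))" by simp
      also have "\<dots> \<le> t * 1" using t B by (intro mult_left_mono) (auto simp: divide_le_eq)
      finally show ?thesis by simp
    qed
    then have 1: "cmod (u (\<lambda>x. cutoff l x * \<phi> x)) \<le> C * t"
      by (rule ub[OF cutoff_mult_schwartz[OF \<phi> l(1)]])
    have 2: "cmod (extension u \<phi> - u (\<lambda>x. cutoff l x * \<phi> x)) \<le> e / (2 * (B + 1)) * B"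
      by (rule l(3)[OF l(1) order_refl \<phi> \<phi>B])
    have h: "C * t \<le> e / 2" "e / (2 * (B + 1)) * B \<le> e / 2"
      unfolding t_def using half_quotient_le[OF B, of e] half_quotient_le[OF C, of e] e
      by (simp_all add: mult.commute)
    have "cmod (extension u \<phi>) \<le> cmod (extension u \<phi> - u (\<lambda>x. cutoff l x * \<phi> x)) + cmod (u (\<lambda>x. cutoff l x * \<phi> x))"
      using norm_triangle_ineq[of "extension u \<phi> - u (\<lambda>x. cutoff l x * \<phi> x)" "u (\<lambda>x. cutoff l x * \<phi> x)"] by simp
    also have "\<dots> \<le> e / 2 + e / 2" by (rule add_mono[OF order_trans[OF 2 h(2)] order_trans[OF 1 h(1)]])
    finally show ?thesis by simp
  qed
  moreover have "0 < t / G" using t G(1) by simp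
  ultimately show ?thesis by (rule that[OF r(1), rotated])
qed

section \<open>The topologies of the test function spaces\<close>

lemma function_space_B: "function_space B_space"
  unfolding B_space_eq by (rule function_space_symbol)

lemma bdd_above_B_seminorm:
  assumes "\<phi> \<in> B_space"
  shows "bdd_above (range (\<lambda>x. cmod (pderivs \<beta> \<phi> x)))"
proof -
  have "bounded (range (pderivs \<beta> \<phi>))" using assms unfolding B_space_def by auto
  then obtain C where C: "\<And>x. cmod (pderivs \<beta> \<phi> x) \<le> C" unfolding bounded_iff by auto
  show ?thesis by (rule bdd_aboveI2) (rule C)
qed

lemma B_smooth: "\<phi> \<in> B_space \<Longrightarrow> \<phi> \<in> smooth_space"
  unfolding B_space_def by simp

lemma seminorm_on_B_seminorms: "\<forall>p\<in>(B_seminorms :: ((real^'n \<Rightarrow> complex) \<Rightarrow> real) set). seminorm_on B_space p"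
proof
  fix p :: "(real^'n \<Rightarrow> complex) \<Rightarrow> real" assume "p \<in> B_seminorms"
  then obtain \<beta> where p: "p = (\<lambda>\<phi>. SUP x. cmod (pderivs \<beta> \<phi> x))" unfolding B_seminorms_def by auto
  have "seminorm_on B_space (\<lambda>\<phi>. SUP x. 1 * cmod (pderivs \<beta> \<phi> x))"
    by (rule seminorm_on_SUP[OF function_space_B])
      (auto simp: pderivs_add pderivs_cmult B_smooth intro: bdd_above_B_seminorm)
  then show "seminorm_on B_space p" unfolding p by simp
qed

abbreviation smooth_seminorms :: "((real^'n \<Rightarrow> complex) \<Rightarrow> real) set" where
  "smooth_seminorms \<equiv> {(\<lambda>\<phi>. SUP x\<in>K. cmod (pderivs \<beta> \<phi> x)) | K \<beta>. compact K \<and> K \<noteq> {}}"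

lemma bdd_above_smooth_seminorm:
  assumes "\<phi> \<in> smooth_space" "compact K"
  shows "bdd_above ((\<lambda>x. cmod (pderivs \<beta> \<phi> x)) ` K)"
proof -
  have "continuous_on K (\<lambda>x. cmod (pderivs \<beta> \<phi> x))"
    by (intro continuous_on_norm continuous_on_subset[OF smooth_continuous[OF smooth_pderivs[OF assms(1)]]]) simp
  then show ?thesis by (intro bounded_imp_bdd_above compact_imp_bounded compact_continuous_image assms)
qed

lemma seminorm_on_smooth_seminorms: "\<forall>p\<in>(smooth_seminorms :: ((real^'n \<Rightarrow> complex) \<Rightarrow> real) set). seminorm_on smooth_space p"
proof
  fix p :: "(real^'n \<Rightarrow> complex) \<Rightarrow> real" assume "p \<in> smooth_seminorms"
  then obtain K \<beta> where p: "p = (\<lambda>\<phi>. SUP x\<in>K. cmod (pderivs \<beta> \<phi> x))" and K: "compact K" "K \<noteq> {}" by auto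
  have "seminorm_on smooth_space (\<lambda>\<phi>. SUP x\<in>K. 1 * cmod (pderivs \<beta> \<phi> x))"
    by (rule seminorm_on_SUP[OF function_space_smooth K(2)])
      (auto simp: pderivs_add pderivs_cmult intro: bdd_above_smooth_seminorm K)
  then show "seminorm_on smooth_space p" unfolding p by simp
qed

lemma smooth_seminorm_le:
  assumes "K \<noteq> {}" "\<And>x. x \<in> K \<Longrightarrow> jet (length \<beta>) \<phi> x \<le> e"
  shows "(SUP x\<in>K. cmod (pderivs \<beta> \<phi> x)) \<le> e"
  by (rule cSUP_least[OF assms(1)]) (rule order_trans[OF pderivs_le_jet[OF order_refl] assms(2)])

lemma finite_words: "finite {\<beta> :: 'n::finite list. length \<beta> \<le> m}"
  using finite_lists_length_le[of "UNIV :: 'n set" m] by simp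

lemma bounded_jets:
  fixes A :: "(real^'n \<Rightarrow> complex) set"
  assumes "B_bounded A"
  obtains C where "0 \<le> C" "\<And>\<phi> x. \<phi> \<in> A \<Longrightarrow> jet m \<phi> x \<le> C"
proof -
  have AB: "A \<subseteq> B_space" using assms unfolding B_bounded_def by simp
  have "\<forall>\<beta>. \<exists>C. \<forall>\<phi>\<in>A. (SUP x. cmod (pderivs \<beta> \<phi> x)) \<le> C"
  proof
    fix \<beta> :: "'n list"
    have "bounded ((\<lambda>\<phi>. SUP x. cmod (pderivs \<beta> \<phi> x)) ` A)"
      using assms unfolding B_bounded_def B_seminorms_def by auto
    then obtain C where "\<forall>\<phi>\<in>A. \<bar>SUP x. cmod (pderivs \<beta> \<phi> x)\<bar> \<le> C" unfolding bounded_iff by auto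
    then show "\<exists>C. \<forall>\<phi>\<in>A. (SUP x. cmod (pderivs \<beta> \<phi> x)) \<le> C"
      by (intro exI[of _ C]) auto
  qed
  then obtain c where c: "\<And>\<beta> \<phi>. \<phi> \<in> A \<Longrightarrow> (SUP x. cmod (pderivs \<beta> \<phi> x)) \<le> c \<beta>"
    by (auto dest!: choice)
  define D where "D = (\<Sum>\<beta> | length (\<beta> :: 'n list) \<le> m. \<bar>c \<beta>\<bar>)"
  have D: "0 \<le> D" unfolding D_def by (simp add: sum_nonneg)
  have "jet m \<phi> x \<le> real (CARD('n) + 1) ^ m * D" if \<phi>: "\<phi> \<in> A" for \<phi> x
  proof (rule jet_le_pderivs)
    fix \<beta> :: "'n list" assume \<beta>: "length \<beta> \<le> m"
    have "cmod (pderivs \<beta> \<phi> x) \<le> (SUP x. cmod (pderivs \<beta> \<phi> x))"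
      using \<phi> AB by (intro cSUP_upper bdd_above_B_seminorm) auto
    also have "\<dots> \<le> \<bar>c \<beta>\<bar>" using c[OF \<phi>, of \<beta>] by simp
    also have "\<dots> \<le> D"
      unfolding D_def by (rule member_le_sum[OF _ _ finite_words]) (use \<beta> in auto)
    finally show "cmod (pderivs \<beta> \<phi> x) \<le> D" .
  qed
  moreover have "0 \<le> real (CARD('n) + 1) ^ m * D" using D by simp
  ultimately show ?thesis by (intro that[of "real (CARD('n) + 1) ^ m * D"])
qed

lemma B_boundedI:
  fixes A :: "(real^'n \<Rightarrow> complex) set"
  assumes "A \<subseteq> B_space" and jets: "\<And>m. \<exists>C. \<forall>\<phi>\<in>A. \<forall>x. jet m \<phi> x \<le> C"
  shows "B_bounded A"
  unfolding B_bounded_def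
proof (intro conjI ballI assms(1))
  fix p :: "(real^'n \<Rightarrow> complex) \<Rightarrow> real" assume p: "p \<in> B_seminorms"
  then obtain \<beta> where \<beta>: "p = (\<lambda>\<phi>. SUP x. cmod (pderivs \<beta> \<phi> x))" unfolding B_seminorms_def by auto
  obtain C where C: "\<And>\<phi> x. \<phi> \<in> A \<Longrightarrow> jet (length \<beta>) \<phi> x \<le> C" using jets[of "length \<beta>"] by auto
  have "\<bar>p \<phi>\<bar> \<le> C" if \<phi>: "\<phi> \<in> A" for \<phi>
  proof -
    have "0 \<le> p \<phi>" using seminorm_on_nonneg[OF bspec[OF seminorm_on_B_seminorms p]] \<phi> assms(1) by auto
    moreover have "p \<phi> \<le> C" unfolding \<beta> by (rule smooth_seminorm_le) (use C[OF \<phi>] in auto)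
    ultimately show ?thesis by simp
  qed
  then show "bounded (p ` A)" unfolding bounded_iff by auto
qed

text \<open>
  The largest family of seminorms that is compatible with the condition on bounded sets: it
  contains the seminorms of every admissible topology, and the topology that it generates is
  itself admissible, hence the finest one.
\<close>

definition Bc_seminorms :: "((real^'n \<Rightarrow> complex) \<Rightarrow> real) set" where
  "Bc_seminorms = {p. seminorm_on B_space p \<and>
     (\<forall>A. B_bounded A \<longrightarrow> (\<forall>\<phi>\<in>A. \<forall>\<epsilon>>0. \<exists>F e. finite F \<and> F \<subseteq> smooth_seminorms \<and> 0 < e \<and>
       (\<forall>\<psi>\<in>A. (\<forall>q\<in>F. q (\<lambda>x. \<psi> x - \<phi> x) < e) \<longrightarrow> p (\<lambda>x. \<psi> x - \<phi> x) < \<epsilon>)))}"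

lemma Bc_seminormI:
  assumes "seminorm_on B_space p"
    and "\<And>A \<phi> \<epsilon>. B_bounded A \<Longrightarrow> \<phi> \<in> A \<Longrightarrow> 0 < \<epsilon> \<Longrightarrow>
      \<exists>F e. finite F \<and> F \<subseteq> smooth_seminorms \<and> 0 < e \<and>
       (\<forall>\<psi>\<in>A. (\<forall>q\<in>F. q (\<lambda>x. \<psi> x - \<phi> x) < e) \<longrightarrow> p (\<lambda>x. \<psi> x - \<phi> x) < \<epsilon>)"
  shows "p \<in> Bc_seminorms"
  unfolding Bc_seminorms_def by (intro CollectI conjI allI impI ballI assms)

lemma Bc_seminormD:
  assumes "p \<in> Bc_seminorms" "B_bounded A" "\<phi> \<in> A" "0 < \<epsilon>"
  shows "\<exists>F e. finite F \<and> F \<subseteq> smooth_seminorms \<and> 0 < e \<and>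
       (\<forall>\<psi>\<in>A. (\<forall>q\<in>F. q (\<lambda>x. \<psi> x - \<phi> x) < e) \<longrightarrow> p (\<lambda>x. \<psi> x - \<phi> x) < \<epsilon>)"
  using assms unfolding Bc_seminorms_def by blast

lemma seminorm_on_Bc_seminorms: "\<forall>p\<in>(Bc_seminorms :: ((real^'n \<Rightarrow> complex) \<Rightarrow> real) set). seminorm_on B_space p"
  unfolding Bc_seminorms_def by simp

lemma smooth_seminorms_subset_Bc: "(smooth_seminorms :: ((real^'n \<Rightarrow> complex) \<Rightarrow> real) set) \<subseteq> Bc_seminorms"
proof
  fix p :: "(real^'n \<Rightarrow> complex) \<Rightarrow> real" assume p: "p \<in> smooth_seminorms"
  have "seminorm_on smooth_space p" using seminorm_on_smooth_seminorms p by (rule bspec)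
  then have "seminorm_on B_space p" unfolding seminorm_on_def B_space_def by simp
  moreover have "\<exists>F e. finite F \<and> F \<subseteq> smooth_seminorms \<and> 0 < e \<and>
      (\<forall>\<psi>\<in>A. (\<forall>q\<in>F. q (\<lambda>x. \<psi> x - \<phi> x) < e) \<longrightarrow> p (\<lambda>x. \<psi> x - \<phi> x) < \<epsilon>)"
    if "0 < \<epsilon>" for A :: "(real^'n \<Rightarrow> complex) set" and \<phi> \<epsilon>
  proof (intro exI[of _ "{p}"] exI[of _ \<epsilon>] conjI)
    show "{p} \<subseteq> smooth_seminorms" using p by (simp only: insert_subset empty_subsetI simp_thms)
  qed (simp_all add: that)
  ultimately show "p \<in> Bc_seminorms" by (rule Bc_seminormI)
qed

lemma ex_family_mono:
  "P \<subseteq> Q \<Longrightarrow> \<exists>F e. finite F \<and> F \<subseteq> P \<and> R F e \<Longrightarrow> \<exists>F e. finite F \<and> F \<subseteq> Q \<and> R F e"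
  by blast

lemma common_neighbourhood:
  assumes "finite F" and "\<And>p. p \<in> F \<Longrightarrow> \<exists>G e. finite G \<and> G \<subseteq> Q \<and> 0 < (e :: real) \<and>
      (\<forall>\<psi>\<in>A. (\<forall>q\<in>G. q (\<lambda>x. \<psi> x - \<phi> x) < e) \<longrightarrow> P p \<psi>)"
  shows "\<exists>G e. finite G \<and> G \<subseteq> Q \<and> 0 < e \<and>
      (\<forall>\<psi>\<in>A. (\<forall>q\<in>G. q (\<lambda>x. \<psi> x - \<phi> x) < e) \<longrightarrow> (\<forall>p\<in>F. P p \<psi>))"
  using assms
proof (induction F rule: finite_induct)
  case empty
  show ?case by (intro exI[of _ "{}"] exI[of _ 1]) simp
next
  case (insert p F)
  have "p \<in> insert p F" by simp
  from insert.prems[OF this] obtain G e where G: "finite G" "G \<subseteq> Q" "0 < e"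
    "\<forall>\<psi>\<in>A. (\<forall>q\<in>G. q (\<lambda>x. \<psi> x - \<phi> x) < e) \<longrightarrow> P p \<psi>" by (elim exE conjE)
  have "\<exists>G e. finite G \<and> G \<subseteq> Q \<and> 0 < e \<and>
      (\<forall>\<psi>\<in>A. (\<forall>q\<in>G. q (\<lambda>x. \<psi> x - \<phi> x) < e) \<longrightarrow> (\<forall>p\<in>F. P p \<psi>))"
    by (rule insert.IH, rule insert.prems, rule insertI2)
  then obtain G' e' where G': "finite G'" "G' \<subseteq> Q" "0 < e'"
    "\<forall>\<psi>\<in>A. (\<forall>q\<in>G'. q (\<lambda>x. \<psi> x - \<phi> x) < e') \<longrightarrow> (\<forall>p\<in>F. P p \<psi>)" by (elim exE conjE)
  show ?case using G G' by (intro exI[of _ "G \<union> G'"] exI[of _ "min e e'"]) auto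
qed

lemma Bc_admissible_Bc_seminorms:
  "Bc_admissible (seminorm_topology (B_space :: (real^'n \<Rightarrow> complex) set) Bc_seminorms)"
  unfolding Bc_admissible_def
proof (intro conjI allI impI)
  show "locally_convex_topology B_space (seminorm_topology B_space Bc_seminorms)"
    unfolding locally_convex_topology_def using function_space_B seminorm_on_Bc_seminorms by auto
  fix A :: "(real^'n \<Rightarrow> complex) set" assume A: "B_bounded A"
  have AB: "A \<subseteq> B_space" using A unfolding B_bounded_def by simp
  then have AS: "A \<subseteq> smooth_space" unfolding B_space_def by auto
  note openB = openin_subtopology_seminorm[OF function_space_B seminorm_on_Bc_seminorms AB]
  note openS = openin_subtopology_seminorm[OF function_space_smooth seminorm_on_smooth_seminorms AS,
      folded smooth_topology_def]
  show "subtopology (seminorm_topology B_space Bc_seminorms) A = subtopology smooth_topology A"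
    unfolding topology_eq
  proof (intro allI iffI)
    fix U assume "openin (subtopology smooth_topology A) U"
    note U = this[unfolded openS]
    show "openin (subtopology (seminorm_topology B_space Bc_seminorms) A) U"
      unfolding openB
      by (intro conjI ballI conjunct1[OF U], rule ex_family_mono[OF smooth_seminorms_subset_Bc bspec[OF conjunct2[OF U]]])
  next
    fix U assume "openin (subtopology (seminorm_topology B_space Bc_seminorms) A) U"
    note U = this[unfolded openB]
    show "openin (subtopology smooth_topology A) U"
      unfolding openS
    proof (intro conjI ballI)
      show "U \<subseteq> A" by (rule conjunct1[OF U])
      fix \<phi> assume \<phi>: "\<phi> \<in> U"
      then have \<phi>A: "\<phi> \<in> A" using U by auto
      from bspec[OF conjunct2[OF U] \<phi>] obtain F e where F: "finite F" "F \<subseteq> Bc_seminorms" "0 < e"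
        "\<forall>\<psi>\<in>A. (\<forall>p\<in>F. p (\<lambda>x. \<psi> x - \<phi> x) < e) \<longrightarrow> \<psi> \<in> U" by (elim exE conjE)
      have "\<exists>G d. finite G \<and> G \<subseteq> smooth_seminorms \<and> 0 < d \<and>
          (\<forall>\<psi>\<in>A. (\<forall>q\<in>G. q (\<lambda>x. \<psi> x - \<phi> x) < d) \<longrightarrow> (\<forall>p\<in>F. p (\<lambda>x. \<psi> x - \<phi> x) < e))"
        by (rule common_neighbourhood[OF F(1)], rule Bc_seminormD[OF subsetD[OF F(2)] A \<phi>A F(3)])
      then obtain G d where "finite G" "G \<subseteq> smooth_seminorms" "0 < d"
        "\<forall>\<psi>\<in>A. (\<forall>q\<in>G. q (\<lambda>x. \<psi> x - \<phi> x) < d) \<longrightarrow> (\<forall>p\<in>F. p (\<lambda>x. \<psi> x - \<phi> x) < e)"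
        by (elim exE conjE)
      then show "\<exists>G d. finite G \<and> G \<subseteq> smooth_seminorms \<and> 0 < d \<and>
          (\<forall>\<psi>\<in>A. (\<forall>q\<in>G. q (\<lambda>x. \<psi> x - \<phi> x) < d) \<longrightarrow> \<psi> \<in> U)"
        using F(4) by (intro exI[of _ G] exI[of _ d] conjI) auto
    qed
  qed
qed

text \<open>
  On a bounded set a ball for a seminorm of \<open>T\<close> is open for the topology of \<open>C\<^sup>\<infinity>\<close>, so the
  seminorm belongs to \<open>Bc_seminorms\<close>.
\<close>

lemma Bc_admissible_coarser:
  fixes T :: "(real^'n \<Rightarrow> complex) topology"
  assumes T: "Bc_admissible T"
  shows "finer_topology (seminorm_topology B_space Bc_seminorms) T"
proof -
  obtain P where P: "\<forall>p\<in>P. seminorm_on B_space p" "T = seminorm_topology B_space P"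
    using T unfolding Bc_admissible_def locally_convex_topology_def by auto
  have PB: "P \<subseteq> Bc_seminorms"
  proof
    fix p assume p: "p \<in> P"
    have "\<exists>F e. finite F \<and> F \<subseteq> smooth_seminorms \<and> 0 < e \<and>
        (\<forall>\<psi>\<in>A. (\<forall>q\<in>F. q (\<lambda>x. \<psi> x - \<phi> x) < e) \<longrightarrow> p (\<lambda>x. \<psi> x - \<phi> x) < \<epsilon>)"
      if A: "B_bounded A" and \<phi>: "\<phi> \<in> A" and \<epsilon>: "0 < \<epsilon>" for A \<phi> \<epsilon>
    proof -
      have AB: "A \<subseteq> B_space" using A unfolding B_bounded_def by simp
      then have AS: "A \<subseteq> smooth_space" unfolding B_space_def by auto
      have \<phi>B: "\<phi> \<in> B_space" using \<phi> AB by auto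
      let ?U = "{\<psi>\<in>B_space. \<forall>p\<in>{p}. p (\<lambda>x. \<psi> x - \<phi> x) < \<epsilon>}"
      have "openin T ?U"
        unfolding P(2) by (rule openin_seminorm_ball) (use p \<phi>B \<epsilon> in auto)
      then have "openin (subtopology T A) (?U \<inter> A)" by (auto simp: openin_subtopology)
      then have "openin (subtopology smooth_topology A) (?U \<inter> A)"
        using T A unfolding Bc_admissible_def by simp
      note U = conjunct2[OF this[unfolded smooth_topology_def
            openin_subtopology_seminorm[OF function_space_smooth seminorm_on_smooth_seminorms AS]]]
      have "\<phi> \<in> ?U \<inter> A"
        using \<phi> \<phi>B \<epsilon> seminorm_on_zero[OF bspec[OF P(1) p] function_space_B] by simp
      from bspec[OF U this] obtain F e where "finite F" "F \<subseteq> smooth_seminorms" "0 < e"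
        "\<forall>\<psi>\<in>A. (\<forall>q\<in>F. q (\<lambda>x. \<psi> x - \<phi> x) < e) \<longrightarrow> \<psi> \<in> ?U \<inter> A" by (elim exE conjE)
      then show ?thesis by (intro exI[of _ F] exI[of _ e] conjI) auto
    qed
    then show "p \<in> Bc_seminorms" by (rule Bc_seminormI[OF bspec[OF P(1) p]])
  qed
  show ?thesis
    unfolding finer_topology_def P(2)
  proof (intro allI impI)
    fix U assume "openin (seminorm_topology B_space P) U"
    note U = this[unfolded openin_seminorm_topology[OF function_space_B P(1)]]
    show "openin (seminorm_topology B_space Bc_seminorms) U"
      unfolding openin_seminorm_topology[OF function_space_B seminorm_on_Bc_seminorms]
      by (intro conjI ballI conjunct1[OF U], rule ex_family_mono[OF PB bspec[OF conjunct2[OF U]]])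
  qed
qed

lemma Bc_topology_eq: "(Bc_topology :: (real^'n \<Rightarrow> complex) topology) = seminorm_topology B_space Bc_seminorms"
  unfolding Bc_topology_def
proof (rule the_equality)
  show "Bc_admissible (seminorm_topology B_space Bc_seminorms) \<and>
      (\<forall>T'. Bc_admissible T' \<longrightarrow> finer_topology (seminorm_topology B_space Bc_seminorms) T')"
    using Bc_admissible_Bc_seminorms Bc_admissible_coarser by blast
next
  fix T :: "(real^'n \<Rightarrow> complex) topology"
  assume T: "Bc_admissible T \<and> (\<forall>T'. Bc_admissible T' \<longrightarrow> finer_topology T T')"
  then have "finer_topology T (seminorm_topology B_space Bc_seminorms)"
    using Bc_admissible_Bc_seminorms by blast
  moreover have "finer_topology (seminorm_topology B_space Bc_seminorms) T"
    using T Bc_admissible_coarser by blast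
  ultimately show "T = seminorm_topology B_space Bc_seminorms"
    unfolding finer_topology_def topology_eq by blast
qed

text \<open>
  A sequence with bounded jets lies, together with its limit, in one bounded set, on which
  \<open>Bc_topology\<close> is the topology of \<open>C\<^sup>\<infinity>\<close>.
\<close>

lemma Bc_dual_LIMSEQ:
  fixes U :: "'n::finite form" and \<phi>s :: "nat \<Rightarrow> real^'n \<Rightarrow> complex"
  assumes U: "U \<in> dual_space Bc_topology" and \<phi>s: "\<And>k. \<phi>s k \<in> B_space" and \<phi>: "\<phi> \<in> B_space"
    and bounded: "\<And>m. \<exists>C. \<forall>k x. jet m (\<phi>s k) x \<le> C"
    and conv: "\<And>m r \<epsilon>. 0 < \<epsilon> \<Longrightarrow> \<forall>\<^sub>F k in sequentially. \<forall>x. norm x \<le> r \<longrightarrow> jet m (\<lambda>x. \<phi>s k x - \<phi> x) x \<le> \<epsilon>"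
  shows "(\<lambda>k. U (\<phi>s k)) \<longlonglongrightarrow> U \<phi>"
proof (rule metric_LIMSEQ_I)
  fix \<epsilon> :: real assume \<epsilon>: "0 < \<epsilon>"
  define A where "A = insert \<phi> (range \<phi>s)"
  have AB: "A \<subseteq> B_space" unfolding A_def using \<phi>s \<phi> by auto
  then have AS: "A \<subseteq> smooth_space" unfolding B_space_def by auto
  have A: "B_bounded A"
  proof (rule B_boundedI[OF AB])
    fix m
    obtain C where "\<And>k x. jet m (\<phi>s k) x \<le> C" using bounded[of m] by auto
    moreover obtain C' where "\<And>x. jet m \<phi> x \<le> C'"
      by (rule symbol_jet_bounded[OF \<phi>[unfolded B_space_eq]]) (rule that)
    ultimately have "\<forall>\<psi>\<in>A. \<forall>x. jet m \<psi> x \<le> max C C'"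
      unfolding A_def le_max_iff_disj by auto
    then show "\<exists>C. \<forall>\<psi>\<in>A. \<forall>x. jet m \<psi> x \<le> C" by blast
  qed
  have "continuous_map (subtopology Bc_topology A) euclidean U"
    using U unfolding dual_space_def by (auto intro: continuous_map_from_subtopology)
  moreover have "subtopology Bc_topology A = subtopology smooth_topology A"
    using Bc_admissible_Bc_seminorms A unfolding Bc_topology_eq Bc_admissible_def by blast
  ultimately have "continuous_map (subtopology (seminorm_topology smooth_space smooth_seminorms) A) euclidean U"
    unfolding smooth_topology_def by simp
  note cont = this[unfolded continuous_map_subtopology_seminorm[OF function_space_smooth seminorm_on_smooth_seminorms AS]]
  have "\<phi> \<in> A" unfolding A_def by simp
  from cont[rule_format, OF this \<epsilon>] obtain F e where F: "finite F" "F \<subseteq> smooth_seminorms" "0 < e"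
    "\<forall>\<psi>\<in>A. (\<forall>q\<in>F. q (\<lambda>x. \<psi> x - \<phi> x) < e) \<longrightarrow> cmod (U \<psi> - U \<phi>) < \<epsilon>" by (elim exE conjE)
  have "\<forall>\<^sub>F k in sequentially. q (\<lambda>x. \<phi>s k x - \<phi> x) < e" if q: "q \<in> F" for q
  proof -
    obtain K \<beta> where q: "q = (\<lambda>\<phi>. SUP x\<in>K. cmod (pderivs \<beta> \<phi> x))" and K: "compact K" "K \<noteq> {}"
      using subsetD[OF F(2) q] by auto
    obtain r where r: "\<And>x. x \<in> K \<Longrightarrow> norm x \<le> r" using compact_imp_bounded[OF K(1)] unfolding bounded_iff by auto
    have "0 < e / 2" using F(3) by simp
    from conv[OF this, of r "length \<beta>"] show ?thesis
    proof (rule eventually_mono)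
      fix k assume k: "\<forall>x. norm x \<le> r \<longrightarrow> jet (length \<beta>) (\<lambda>x. \<phi>s k x - \<phi> x) x \<le> e / 2"
      have "q (\<lambda>x. \<phi>s k x - \<phi> x) \<le> e / 2"
        unfolding q by (rule smooth_seminorm_le[OF K(2)]) (use k r in auto)
      then show "q (\<lambda>x. \<phi>s k x - \<phi> x) < e" using F(3) by simp
    qed
  qed
  then have "\<forall>\<^sub>F k in sequentially. \<forall>q\<in>F. q (\<lambda>x. \<phi>s k x - \<phi> x) < e"
    using F(1) by (intro eventually_ball_finite) auto
  then obtain N where N: "\<And>k. N \<le> k \<Longrightarrow> \<forall>q\<in>F. q (\<lambda>x. \<phi>s k x - \<phi> x) < e"
    unfolding eventually_sequentially by auto
  have "dist (U (\<phi>s k)) (U \<phi>) < \<epsilon>" if "N \<le> k" for k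
    using F(4) N[OF that] unfolding A_def dist_norm by auto
  then show "\<exists>N. \<forall>k\<ge>N. dist (U (\<phi>s k)) (U \<phi>) < \<epsilon>" by blast
qed

text \<open>
  By \<open>extension_local\<close>, the absolute value of the extension is one of the seminorms that generate
  \<open>Bc_topology\<close>.
\<close>

lemma extension_in_Bc_dual:
  fixes u :: "'n::finite form"
  assumes u: "jet_bounded_form m C u"
  shows "extension u \<in> dual_space Bc_topology"
proof -
  note lin = extension_linear[OF u]
  have "\<exists>F e. finite F \<and> F \<subseteq> smooth_seminorms \<and> 0 < e \<and>
      (\<forall>\<psi>\<in>A. (\<forall>q\<in>F. q (\<lambda>x. \<psi> x - \<phi> x) < e) \<longrightarrow> cmod (extension u (\<lambda>x. \<psi> x - \<phi> x)) < \<epsilon>)"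
    if A: "B_bounded A" and \<phi>: "\<phi> \<in> A" and \<epsilon>: "0 < \<epsilon>" for A \<phi> \<epsilon>
  proof -
    have AB: "A \<subseteq> B_space" using A unfolding B_bounded_def by simp
    obtain B where B: "0 \<le> B" "\<And>\<phi> x. \<phi> \<in> A \<Longrightarrow> jet m \<phi> x \<le> B"
      by (rule bounded_jets[OF A]) (rule that)
    have \<epsilon>2: "0 < \<epsilon> / 2" and B2: "0 \<le> B + B" using \<epsilon> B(1) by simp_all
    obtain r d where rd: "0 < r" "0 < d"
      "\<And>\<phi>. \<phi> \<in> B_space \<Longrightarrow> (\<forall>x. jet m \<phi> x \<le> B + B) \<Longrightarrow> (\<forall>x. norm x \<le> r \<longrightarrow> jet m \<phi> x \<le> d) \<Longrightarrow>
        cmod (extension u \<phi>) \<le> \<epsilon> / 2"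
      by (rule extension_local[OF u \<epsilon>2 B2]) (rule that)
    define N where "N = real (CARD('n) + 1) ^ m"
    have N: "0 < N" unfolding N_def by simp
    define F where "F = (\<lambda>\<beta> (\<phi> :: real^'n \<Rightarrow> complex). SUP x\<in>cball 0 r. cmod (pderivs \<beta> \<phi> x)) ` {\<beta>. length \<beta> \<le> m}"
    have "finite F" unfolding F_def by (intro finite_imageI finite_words)
    moreover have "F \<subseteq> smooth_seminorms"
    proof
      fix q assume "q \<in> F"
      then obtain \<beta> where "q = (\<lambda>\<phi>. SUP x\<in>cball 0 r. cmod (pderivs \<beta> \<phi> x))" unfolding F_def by auto
      then show "q \<in> smooth_seminorms" using rd(1) by (intro CollectI exI[of _ "cball 0 r"] exI[of _ \<beta>]) simp
    qed
    moreover have "0 < d / N" using rd(2) N by simp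
    moreover have "cmod (extension u (\<lambda>x. \<psi> x - \<phi> x)) < \<epsilon>"
      if \<psi>: "\<psi> \<in> A" and q: "\<forall>q\<in>F. q (\<lambda>x. \<psi> x - \<phi> x) < d / N" for \<psi>
    proof -
      have B\<phi>: "\<psi> \<in> B_space" "\<phi> \<in> B_space" using \<psi> \<phi> AB by auto
      have D: "(\<lambda>x. \<psi> x - \<phi> x) \<in> B_space" by (rule function_space_diff[OF function_space_B B\<phi>])
      have "jet m (\<lambda>x. \<psi> x - \<phi> x) x \<le> B + B" for x
        by (rule order_trans[OF jet_diff[OF B_smooth[OF B\<phi>(1)] B_smooth[OF B\<phi>(2)]]])
          (intro add_mono B \<psi> \<phi>)
      moreover have "jet m (\<lambda>x. \<psi> x - \<phi> x) x \<le> d" if x: "norm x \<le> r" for x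
      proof -
        have "jet m (\<lambda>x. \<psi> x - \<phi> x) x \<le> real (CARD('n) + 1) ^ m * (d / N)"
        proof (rule jet_le_pderivs)
          fix \<beta> :: "'n list" assume \<beta>: "length \<beta> \<le> m"
          have "cmod (pderivs \<beta> (\<lambda>x. \<psi> x - \<phi> x) x) \<le> (SUP x\<in>cball 0 r. cmod (pderivs \<beta> (\<lambda>x. \<psi> x - \<phi> x) x))"
            using x by (intro cSUP_upper bdd_above_smooth_seminorm B_smooth[OF D]) auto
          also have "\<dots> \<le> d / N" using q \<beta> unfolding F_def by (auto intro: less_imp_le)
          finally show "cmod (pderivs \<beta> (\<lambda>x. \<psi> x - \<phi> x) x) \<le> d / N" .
        qed
        then show ?thesis unfolding N_def[symmetric] using N by simp
      qed
      ultimately have "cmod (extension u (\<lambda>x. \<psi> x - \<phi> x)) \<le> \<epsilon> / 2" by (intro rd(3)[OF D]) auto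
      then show ?thesis using \<epsilon> by simp
    qed
    ultimately show ?thesis by (intro exI[of _ F] exI[of _ "d / N"] conjI ballI impI)
  qed
  then have p: "(\<lambda>\<phi>. cmod (extension u \<phi>)) \<in> Bc_seminorms"
    by (rule Bc_seminormI[OF seminorm_on_linear_form[OF lin]])
  have "continuous_map Bc_topology euclidean (extension u)"
    unfolding Bc_topology_eq continuous_map_seminorm[OF function_space_B seminorm_on_Bc_seminorms]
  proof (intro ballI allI impI)
    fix \<phi> :: "real^'n \<Rightarrow> complex" and \<epsilon> :: real assume \<phi>: "\<phi> \<in> B_space" and \<epsilon>: "0 < \<epsilon>"
    show "\<exists>F e. finite F \<and> F \<subseteq> Bc_seminorms \<and> 0 < e \<and>
        (\<forall>\<psi>\<in>B_space. (\<forall>p\<in>F. p (\<lambda>x. \<psi> x - \<phi> x) < e) \<longrightarrow> cmod (extension u \<psi> - extension u \<phi>) < \<epsilon>)"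
      using p \<epsilon> \<phi> linear_form_on_diff[OF lin function_space_B _ \<phi>]
      by (intro exI[of _ "{\<lambda>\<phi>. cmod (extension u \<phi>)}"] exI[of _ \<epsilon>]) auto
  qed
  then show ?thesis
    using lin unfolding dual_space_def Bc_topology_eq by simp
qed

section \<open>The dual of the functions vanishing at infinity\<close>

lemma Bdot_subset_B: "Bdot_space \<subseteq> B_space"
  unfolding Bdot_space_def by auto

lemma schwartz_subset_Bdot: "schwartz_space \<subseteq> Bdot_space"
proof
  fix \<phi> :: "real^'n \<Rightarrow> complex" assume \<phi>: "\<phi> \<in> schwartz_space"
  have "(pderivs \<beta> \<phi> \<longlongrightarrow> 0) at_infinity" for \<beta>
    unfolding Lim_at_infinity
  proof (intro allI impI)
    fix e :: real assume e: "0 < e"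
    then obtain r where r: "\<And>x. r \<le> norm x \<Longrightarrow> jet (length \<beta>) \<phi> x \<le> e / 2"
      using schwartz_jet_decay[OF \<phi>, of "e / 2" "length \<beta>"] by auto
    have "dist (pderivs \<beta> \<phi> x) 0 < e" if "r \<le> norm x" for x
      using order_trans[OF pderivs_le_jet[OF order_refl] r[OF that]] e by simp
    then show "\<exists>b. \<forall>x. b \<le> norm x \<longrightarrow> dist (pderivs \<beta> \<phi> x) 0 < e" by blast
  qed
  then show "\<phi> \<in> Bdot_space" using \<phi> schwartz_subset_B unfolding Bdot_space_def by auto
qed

text \<open>Continuity for a system of weighted sup-seminorms, from an estimate by the weighted jet.\<close>

lemma linear_form_continuous_jet:
  fixes u :: "'n::finite form" and w :: "real^'n \<Rightarrow> real"
  assumes V: "function_space V" and P: "\<forall>p\<in>P. seminorm_on V p" and A: "A \<subseteq> V"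
    and Vs: "V \<subseteq> smooth_space" and w: "\<And>x. 0 < w x"
    and p: "\<And>\<beta>. (\<lambda>\<phi>. SUP x. w x * cmod (pderivs \<beta> \<phi> x)) \<in> P"
    and bdd: "\<And>\<beta> \<phi>. \<phi> \<in> V \<Longrightarrow> bdd_above (range (\<lambda>x. w x * cmod (pderivs \<beta> \<phi> x)))"
    and C: "0 \<le> C" and diff: "\<And>\<phi> \<psi>. \<phi> \<in> A \<Longrightarrow> \<psi> \<in> A \<Longrightarrow> u (\<lambda>x. \<psi> x - \<phi> x) = u \<psi> - u \<phi>"
    and bound: "\<And>\<phi> \<psi> B. \<phi> \<in> A \<Longrightarrow> \<psi> \<in> A \<Longrightarrow> \<forall>x. w x * jet m (\<lambda>x. \<psi> x - \<phi> x) x \<le> B \<Longrightarrow>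
      cmod (u (\<lambda>x. \<psi> x - \<phi> x)) \<le> C * B"
  shows "continuous_map (subtopology (seminorm_topology V P) A) euclidean u"
  unfolding continuous_map_subtopology_seminorm[OF V P A]
proof (intro ballI allI impI)
  fix \<phi> and \<epsilon> :: real assume \<phi>: "\<phi> \<in> A" and \<epsilon>: "0 < \<epsilon>"
  define N where "N = real (CARD('n) + 1) ^ m"
  have N: "0 < N" unfolding N_def by simp
  define e where "e = \<epsilon> / (2 * (C + 1) * N)"
  have e: "0 < e" unfolding e_def using \<epsilon> C N by simp
  define F where "F = (\<lambda>\<beta> \<phi>. SUP x. w x * cmod (pderivs \<beta> \<phi> x)) ` {\<beta> :: 'n list. length \<beta> \<le> m}"
  have "finite F" unfolding F_def by (intro finite_imageI finite_words)
  moreover have "F \<subseteq> P" unfolding F_def using p by auto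
  moreover have "cmod (u \<psi> - u \<phi>) < \<epsilon>" if \<psi>: "\<psi> \<in> A" and q: "\<forall>q\<in>F. q (\<lambda>x. \<psi> x - \<phi> x) < e" for \<psi>
  proof -
    have D: "(\<lambda>x. \<psi> x - \<phi> x) \<in> V" using \<phi> \<psi> A by (intro function_space_diff[OF V]) auto
    have "\<forall>x. w x * jet m (\<lambda>x. \<psi> x - \<phi> x) x \<le> N * e"
    proof
      fix x
      have "jet m (\<lambda>x. \<psi> x - \<phi> x) x \<le> real (CARD('n) + 1) ^ m * (e / w x)"
      proof (rule jet_le_pderivs)
        fix \<beta> :: "'n list" assume \<beta>: "length \<beta> \<le> m"
        have "w x * cmod (pderivs \<beta> (\<lambda>x. \<psi> x - \<phi> x) x) \<le> (SUP x. w x * cmod (pderivs \<beta> (\<lambda>x. \<psi> x - \<phi> x) x))"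
          by (intro cSUP_upper bdd[OF D]) simp
        also have "\<dots> \<le> e" using q \<beta> unfolding F_def by (auto intro: less_imp_le)
        finally show "cmod (pderivs \<beta> (\<lambda>x. \<psi> x - \<phi> x) x) \<le> e / w x"
          using w[of x] by (simp add: field_simps)
      qed
      then have "w x * jet m (\<lambda>x. \<psi> x - \<phi> x) x \<le> w x * (N * (e / w x))"
        unfolding N_def using w[of x] by (intro mult_left_mono) auto
      also have "\<dots> = N * e" using w[of x] by simp
      finally show "w x * jet m (\<lambda>x. \<psi> x - \<phi> x) x \<le> N * e" .
    qed
    from bound[OF \<phi> \<psi> this] have "cmod (u \<psi> - u \<phi>) \<le> C * (N * e)" unfolding diff[OF \<phi> \<psi>] .
    also have "\<dots> = \<epsilon> / (2 * (C + 1)) * C" unfolding e_def using N by simp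
    also have "\<dots> \<le> \<epsilon> / 2" by (rule half_quotient_le[OF C]) (use \<epsilon> in simp)
    also have "\<dots> < \<epsilon>" using \<epsilon> by simp
    finally show ?thesis .
  qed
  ultimately show "\<exists>F e. finite F \<and> F \<subseteq> P \<and> 0 < e \<and>
      (\<forall>\<psi>\<in>A. (\<forall>p\<in>F. p (\<lambda>x. \<psi> x - \<phi> x) < e) \<longrightarrow> cmod (u \<psi> - u \<phi>) < \<epsilon>)"
    using e by (intro exI[of _ F] exI[of _ e] conjI ballI impI)
qed

lemma temperedI:
  fixes u :: "'n::finite form"
  assumes lin: "linear_form_on schwartz_space u" and C: "0 \<le> C"
    and bound: "\<And>\<psi> B. \<psi> \<in> schwartz_space \<Longrightarrow> \<forall>x. (1 + norm x) ^ k * jet m \<psi> x \<le> B \<Longrightarrow> cmod (u \<psi>) \<le> C * B"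
  shows "u \<in> tempered"
proof -
  let ?P = "{(\<lambda>\<phi> :: real^'n \<Rightarrow> complex. SUP x. (1 + norm x) ^ k * cmod (pderivs \<beta> \<phi> x)) | (k::nat) \<beta>. True}"
  have bdd: "bdd_above (range (\<lambda>x. (1 + norm x) ^ k * cmod (pderivs \<beta> \<phi> x)))"
    if \<phi>: "\<phi> \<in> schwartz_space" for k \<beta> and \<phi> :: "real^'n \<Rightarrow> complex"
  proof -
    have "bounded (range (\<lambda>x. (1 + norm x) ^ k * cmod (pderivs \<beta> \<phi> x)))"
      using \<phi> unfolding schwartz_space_def by blast
    then show ?thesis by (rule bounded_imp_bdd_above)
  qed
  have P: "\<forall>p\<in>?P. seminorm_on schwartz_space p"
  proof
    fix p assume "p \<in> ?P"
    then obtain k \<beta> where p: "p = (\<lambda>\<phi> :: real^'n \<Rightarrow> complex. SUP x. (1 + norm x) ^ k * cmod (pderivs \<beta> \<phi> x))"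
      by auto
    show "seminorm_on schwartz_space p"
      unfolding p by (rule seminorm_on_SUP[OF function_space_schwartz])
        (auto simp: pderivs_add pderivs_cmult schwartz_smooth intro: bdd)
  qed
  have "continuous_map (subtopology (seminorm_topology schwartz_space ?P) schwartz_space) euclidean u"
  proof (rule linear_form_continuous_jet[OF function_space_schwartz P order_refl,
        where w="\<lambda>x. (1 + norm x) ^ k" and m=m and C=C])
    show "schwartz_space \<subseteq> smooth_space" using schwartz_smooth by auto
    show "0 < (1 + norm x) ^ k" for x :: "real^'n" by (intro zero_less_power add_pos_nonneg) auto
    show "u (\<lambda>x. \<psi> x - \<phi> x) = u \<psi> - u \<phi>" if "\<phi> \<in> schwartz_space" "\<psi> \<in> schwartz_space" for \<phi> \<psi>
      by (rule linear_form_on_diff[OF lin function_space_schwartz that(2,1)])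
    show "cmod (u (\<lambda>x. \<psi> x - \<phi> x)) \<le> C * B"
      if "\<phi> \<in> schwartz_space" "\<psi> \<in> schwartz_space" "\<forall>x. (1 + norm x) ^ k * jet m (\<lambda>x. \<psi> x - \<phi> x) x \<le> B" for \<phi> \<psi> B
      by (rule bound[OF function_space_diff[OF function_space_schwartz that(2,1)] that(3)])
  qed (use bdd C in auto)
  then have "continuous_map schwartz_topology euclidean u"
    unfolding schwartz_topology_def
    using subtopology_topspace[of "seminorm_topology schwartz_space ?P"] by simp
  then show ?thesis
    using lin unfolding tempered_def dual_space_def schwartz_topology_def by simp
qed

lemma tempered_linear: "u \<in> tempered \<Longrightarrow> linear_form_on schwartz_space u"
  unfolding tempered_def dual_space_def schwartz_topology_def by simp

text \<open>
  Continuity of a form at zero involves finitely many seminorms of \<open>B_space\<close>, and all of them are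
  below one jet; scaling turns this into an estimate.  Together with its converse, this reduces
  membership in \<open>DL1\<close> to an estimate on Schwartz functions, without any reference to topologies.
\<close>

lemma DL1_jet_bounded_form:
  fixes u :: "'n::finite form"
  assumes u: "u \<in> DL1"
  obtains m C where "jet_bounded_form m C u"
proof -
  from u have lin: "linear_form_on schwartz_space u" unfolding DL1_def by (auto intro: tempered_linear)
  from u obtain U where U: "U \<in> dual_space Bdot_topology" and Uu: "\<And>\<phi>. \<phi> \<in> schwartz_space \<Longrightarrow> U \<phi> = u \<phi>"
    unfolding DL1_def by auto
  have "continuous_map (subtopology (seminorm_topology B_space B_seminorms) Bdot_space) euclidean U"
    using U unfolding dual_space_def Bdot_topology_def B_topology_def by simp
  note cont = this[unfolded continuous_map_subtopology_seminorm[OF function_space_B seminorm_on_B_seminorms Bdot_subset_B]]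
  have z: "(\<lambda>_. 0) \<in> Bdot_space" using function_space_zero[OF function_space_schwartz] schwartz_subset_Bdot by auto
  have Uz: "U (\<lambda>_. 0) = 0"
    using Uu[OF function_space_zero[OF function_space_schwartz]]
      linear_form_on_cmult[OF lin function_space_zero[OF function_space_schwartz], of 0] by simp
  from cont[rule_format, OF z zero_less_one] obtain F e where F: "finite F" "F \<subseteq> B_seminorms" "0 < e"
    "\<forall>\<psi>\<in>Bdot_space. (\<forall>p\<in>F. p (\<lambda>x. \<psi> x - 0) < e) \<longrightarrow> cmod (U \<psi> - U (\<lambda>_. 0)) < 1" by (elim exE conjE)
  have "\<exists>m. \<forall>p\<in>F. \<forall>\<psi> B. (\<forall>x. jet m \<psi> x \<le> B) \<longrightarrow> p \<psi> \<le> B"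
    using F(1,2)
  proof (induction F rule: finite_induct)
    case (insert p F)
    then obtain m where m: "\<forall>p\<in>F. \<forall>\<psi> B. (\<forall>x. jet m \<psi> x \<le> B) \<longrightarrow> p \<psi> \<le> B" by auto
    obtain \<beta> where p: "p = (\<lambda>\<phi>. SUP x. cmod (pderivs \<beta> \<phi> x))" using insert.prems unfolding B_seminorms_def by auto
    have "\<forall>q\<in>insert p F. \<forall>\<psi> B. (\<forall>x. jet (max m (length \<beta>)) \<psi> x \<le> B) \<longrightarrow> q \<psi> \<le> B"
    proof (intro ballI allI impI)
      fix q and \<psi> :: "real^'n \<Rightarrow> complex" and B assume q: "q \<in> insert p F" and B: "\<forall>x. jet (max m (length \<beta>)) \<psi> x \<le> B"
      have 1: "jet m \<psi> x \<le> B" for x by (rule order_trans[OF jet_mono spec[OF B]]) simp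
      have 2: "jet (length \<beta>) \<psi> x \<le> B" for x by (rule order_trans[OF jet_mono spec[OF B]]) simp
      show "q \<psi> \<le> B"
      proof (cases "q = p")
        case True
        show ?thesis unfolding True p by (rule smooth_seminorm_le) (use 2 in auto)
      next
        case False
        then show ?thesis using m q 1 by blast
      qed
    qed
    then show ?case by blast
  qed simp
  then obtain m where m: "\<And>p \<psi> B. p \<in> F \<Longrightarrow> \<forall>x. jet m \<psi> x \<le> B \<Longrightarrow> p \<psi> \<le> B" by blast
  have "cmod (u \<psi>) \<le> 2 / e * B" if \<psi>: "\<psi> \<in> schwartz_space" and B: "\<forall>x. jet m \<psi> x \<le> B" for \<psi> B
  proof (rule field_le_epsilon)
    \<comment> \<open>The bound \<open>B\<close> may be zero; scaling uses the slightly larger \<open>B'\<close>.\<close>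
    fix t :: real assume t: "0 < t"
    define B' where "B' = B + t * e / 2"
    have B0: "0 \<le> B" using order_trans[OF jet_nonneg spec[OF B]] .
    have B': "0 < B'" "B \<le> B'" unfolding B'_def using B0 t F(3) by (auto intro: add_nonneg_pos)
    let ?\<zeta> = "\<lambda>x. of_real (e / (2 * B')) * \<psi> x"
    have \<zeta>: "?\<zeta> \<in> schwartz_space" by (rule function_space_cmult[OF function_space_schwartz \<psi>])
    have "jet m ?\<zeta> x \<le> e / 2" for x
    proof -
      have "jet m ?\<zeta> x = e / (2 * B') * jet m \<psi> x"
        unfolding jet_cmult[OF schwartz_smooth[OF \<psi>]] norm_of_real using B'(1) F(3) by simp
      also have "\<dots> \<le> e / (2 * B') * B'"
        using B' F(3) order_trans[OF spec[OF B, of x] B'(2)] by (intro mult_left_mono) auto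
      finally show ?thesis using B'(1) by simp
    qed
    then have "\<forall>p\<in>F. p ?\<zeta> < e" using m[of _ ?\<zeta> "e / 2"] F(3) by force
    then have "cmod (U ?\<zeta>) < 1"
      using F(4) \<zeta> schwartz_subset_Bdot Uz by auto
    then have "cmod (of_real (e / (2 * B')) * u \<psi>) < 1"
      unfolding Uu[OF \<zeta>] linear_form_on_cmult[OF lin \<psi>] .
    then have "e / (2 * B') * cmod (u \<psi>) < 1"
      unfolding norm_mult norm_of_real using B'(1) F(3) by simp
    then have "cmod (u \<psi>) \<le> 2 / e * B'" using B'(1) F(3) by (simp add: field_simps)
    also have "\<dots> = 2 / e * B + t" unfolding B'_def using F(3) by (simp add: field_simps)
    finally show "cmod (u \<psi>) \<le> 2 / e * B + t" .
  qed
  then have "jet_bounded_form m (2 / e) u"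
    unfolding jet_bounded_form_def using lin F(3) by auto
  then show ?thesis by (rule that)
qed

lemma jet_bounded_form_DL1:
  fixes u :: "'n::finite form"
  assumes u: "jet_bounded_form m C u"
  shows "u \<in> DL1"
proof -
  note lin = jet_bounded_formD(1)[OF u] and C = jet_bounded_formD(2)[OF u]
  have "u \<in> tempered"
  proof (rule temperedI[OF lin C, where k=0 and m=m])
    fix \<psi> :: "real^'n \<Rightarrow> complex" and B assume "\<psi> \<in> schwartz_space" "\<forall>x. (1 + norm x) ^ 0 * jet m \<psi> x \<le> B"
    then show "cmod (u \<psi>) \<le> C * B" by (intro jet_bounded_formD(3)[OF u]) auto
  qed
  moreover have "extension u \<in> dual_space Bdot_topology"
  proof -
    note linE = extension_linear[OF u]
    obtain D where D: "0 \<le> D"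
      "\<And>\<phi> B. \<phi> \<in> B_space \<Longrightarrow> (\<forall>x. jet m \<phi> x \<le> B) \<Longrightarrow> cmod (extension u \<phi>) \<le> D * B"
      by (rule extension_bound[OF u]) (rule that)
    have dB: "(\<lambda>x. \<psi> x - \<phi> x) \<in> B_space" "extension u (\<lambda>x. \<psi> x - \<phi> x) = extension u \<psi> - extension u \<phi>"
      if "\<phi> \<in> Bdot_space" "\<psi> \<in> Bdot_space" for \<phi> \<psi>
      using that Bdot_subset_B
      by (auto intro!: function_space_diff[OF function_space_B] linear_form_on_diff[OF linE function_space_B])
    have c: "continuous_map (subtopology (seminorm_topology B_space B_seminorms) Bdot_space) euclidean (extension u)"
    proof (rule linear_form_continuous_jet[OF function_space_B seminorm_on_B_seminorms Bdot_subset_B,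
          where w="\<lambda>_. 1" and m=m and C=D])
      show "B_space \<subseteq> smooth_space" unfolding B_space_def by auto
      show "(\<lambda>\<phi>. SUP x. 1 * cmod (pderivs \<beta> \<phi> x)) \<in> B_seminorms" for \<beta>
        unfolding B_seminorms_def by auto
      show "bdd_above (range (\<lambda>x. 1 * cmod (pderivs \<beta> \<phi> x)))" if "\<phi> \<in> B_space" for \<beta> and \<phi> :: "real^'n \<Rightarrow> complex"
        using bdd_above_B_seminorm[OF that, of \<beta>] by simp
      show "cmod (extension u (\<lambda>x. \<psi> x - \<phi> x)) \<le> D * B"
        if "\<phi> \<in> Bdot_space" "\<psi> \<in> Bdot_space" "\<forall>x. 1 * jet m (\<lambda>x. \<psi> x - \<phi> x) x \<le> B" for \<phi> \<psi> B
        using that(3) by (intro D(2)[OF dB(1)[OF that(1,2)]]) simp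
    qed (use D(1) dB(2) in auto)
    have l: "linear_form_on Bdot_space (extension u)"
      using linE Bdot_subset_B unfolding linear_form_on_def by blast
    have t: "topspace Bdot_topology = Bdot_space"
      unfolding Bdot_topology_def B_topology_def using Bdot_subset_B by auto
    show ?thesis
      unfolding dual_space_def mem_Collect_eq t
      using l c[folded B_topology_def Bdot_topology_def] by (rule conjI)
  qed
  ultimately show ?thesis unfolding DL1_def using extension_schwartz[OF u] by blast
qed

text \<open>
  A form that is continuous for \<open>Bc_topology\<close> is determined by its values on Schwartz functions,
  since Gaussian cutoffs of \<open>\<phi>\<close> converge to \<open>\<phi>\<close> in the sense of \<open>Bc_dual_LIMSEQ\<close>.
\<close>

lemma cutoff_LIMSEQ:
  fixes U :: "'n::finite form"
  assumes U: "U \<in> dual_space Bc_topology" and \<phi>: "\<phi> \<in> B_space"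
  shows "(\<lambda>k. U (\<lambda>x. cutoff (inverse (real (Suc k))) x * \<phi> x)) \<longlonglongrightarrow> U \<phi>"
proof (rule Bc_dual_LIMSEQ[OF U _ \<phi>])
  let ?l = "\<lambda>k. inverse (real (Suc k))"
  have l: "0 < ?l k" "?l k \<le> 1" for k by (auto simp: inverse_le_1_iff)
  have sm: "\<phi> \<in> smooth_space" by (rule B_smooth[OF \<phi>])
  show "(\<lambda>x. cutoff (?l k) x * \<phi> x) \<in> B_space" for k
    using cutoff_mult_schwartz[OF \<phi> l(1)] schwartz_subset_B by auto
  fix m
  obtain B where B: "0 \<le> B" "\<And>x. jet m \<phi> x \<le> B"
    by (rule symbol_jet_bounded[OF \<phi>[unfolded B_space_eq]]) (rule that)
  obtain G where G: "1 \<le> G" "\<And>l \<psi> x. 0 < l \<Longrightarrow> l \<le> 1 \<Longrightarrow> \<psi> \<in> smooth_space \<Longrightarrow>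
      jet m (\<lambda>x. cutoff l x * \<psi> x) x \<le> G * jet m \<psi> (x :: real^'n)"
    by (rule jet_cutoff_mult[of m]) (rule that)
  have "jet m (\<lambda>x. cutoff (?l k) x * \<phi> x) x \<le> G * B" for k x
    by (rule order_trans[OF G(2)[OF l sm] mult_left_mono[OF B(2)]]) (use G(1) in simp)
  then show "\<exists>C. \<forall>k x. jet m (\<lambda>x. cutoff (?l k) x * \<phi> x) x \<le> C" by blast
  fix r \<epsilon> :: real assume \<epsilon>: "0 < \<epsilon>"
  obtain H where H: "0 \<le> H" "\<And>l \<psi> x. 0 < l \<Longrightarrow> l \<le> 1 \<Longrightarrow> \<psi> \<in> smooth_space \<Longrightarrow>
      jet m (\<lambda>x. (1 - cutoff l x) * \<psi> x) x \<le> (cmod (1 - cutoff l x) + l * H) * jet m \<psi> (x :: real^'n)"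
    by (rule jet_one_minus_cutoff_mult[of m]) (rule that)
  have "(\<lambda>k. ((?l k)\<^sup>2 * r\<^sup>2 + ?l k * H) * B) \<longlonglongrightarrow> (0\<^sup>2 * r\<^sup>2 + 0 * H) * B"
    by (intro tendsto_intros LIMSEQ_inverse_real_of_nat)
  then have "\<forall>\<^sub>F k in sequentially. ((?l k)\<^sup>2 * r\<^sup>2 + ?l k * H) * B < \<epsilon>"
    by (intro order_tendstoD) (use \<epsilon> in auto)
  then show "\<forall>\<^sub>F k in sequentially. \<forall>x. norm x \<le> r \<longrightarrow> jet m (\<lambda>x. cutoff (?l k) x * \<phi> x - \<phi> x) x \<le> \<epsilon>"
  proof (rule eventually_mono, intro allI impI)
    fix k and x :: "real^'n" assume k: "((?l k)\<^sup>2 * r\<^sup>2 + ?l k * H) * B < \<epsilon>" and x: "norm x \<le> r"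
    have s: "(\<lambda>x. (1 - cutoff (?l k) x) * \<phi> x) \<in> smooth_space"
      by (intro smooth_mult sm symbol_smooth[OF one_minus_cutoff_symbol[OF l(1)]])
    have "(\<lambda>x. cutoff (?l k) x * \<phi> x - \<phi> x) = (\<lambda>x. (-1) * ((1 - cutoff (?l k) x) * \<phi> x))"
      by (auto simp: algebra_simps)
    then have "jet m (\<lambda>x. cutoff (?l k) x * \<phi> x - \<phi> x) x = jet m (\<lambda>x. (1 - cutoff (?l k) x) * \<phi> x) x"
      using jet_cmult[OF s, of m "-1" x] by simp
    also have "\<dots> \<le> (cmod (1 - cutoff (?l k) x) + ?l k * H) * jet m \<phi> x" by (rule H(2)[OF l sm])
    also have "\<dots> \<le> ((?l k)\<^sup>2 * r\<^sup>2 + ?l k * H) * B"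
    proof (intro mult_mono add_mono B order_refl)
      have "(?l k)\<^sup>2 * (norm x)\<^sup>2 \<le> (?l k)\<^sup>2 * r\<^sup>2" using x by (intro mult_left_mono power_mono) auto
      then show "cmod (1 - cutoff (?l k) x) \<le> (?l k)\<^sup>2 * r\<^sup>2"
        by (rule order_trans[OF cmod_one_minus_cutoff_le(2)])
    qed (use H(1) l in auto)
    finally show "jet m (\<lambda>x. cutoff (?l k) x * \<phi> x - \<phi> x) x \<le> \<epsilon>" using k by simp
  qed
qed

text \<open>
  The extension is a continuous form that agrees with \<open>u\<close> on the Schwartz functions, and any
  other such form is the same limit along cutoffs.
\<close>

lemma DL1_pairing_eq:
  fixes u :: "'n::finite form"
  assumes u: "jet_bounded_form m C u" and \<phi>: "\<phi> \<in> B_space"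
  shows "DL1_pairing u \<phi> = extension u \<phi>"
  unfolding DL1_pairing_def
proof (rule the_equality)
  show "\<exists>U\<in>dual_space Bc_topology. (\<forall>\<psi>\<in>schwartz_space. U \<psi> = u \<psi>) \<and> U \<phi> = extension u \<phi>"
    using extension_in_Bc_dual[OF u] extension_schwartz[OF u] by blast
next
  fix c assume "\<exists>U\<in>dual_space Bc_topology. (\<forall>\<psi>\<in>schwartz_space. U \<psi> = u \<psi>) \<and> U \<phi> = c"
  then obtain U where U: "U \<in> dual_space Bc_topology" "\<And>\<psi>. \<psi> \<in> schwartz_space \<Longrightarrow> U \<psi> = u \<psi>" "U \<phi> = c"
    by auto
  have "U (\<lambda>x. cutoff (inverse (real (Suc k))) x * \<phi> x) = u (\<lambda>x. cutoff (inverse (real (Suc k))) x * \<phi> x)" for k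
    by (rule U(2)[OF cutoff_mult_schwartz[OF \<phi>]]) simp
  then show "c = extension u \<phi>"
    using LIMSEQ_unique[OF cutoff_LIMSEQ[OF U(1) \<phi>]] extension_LIMSEQ[OF u \<phi>] U(3) by simp
qed

section \<open>Weights and kernels\<close>

definition kernel_order :: "'n::finite itself \<Rightarrow> real \<Rightarrow> real" where
  "kernel_order _ \<alpha> = (\<alpha> + real CARD('n) + 1) / 2"

lemma kernel_order_gt:
  assumes "-1 < \<alpha>"
  shows "real CARD('n::finite) / 2 < kernel_order TYPE('n) \<alpha>" "0 < kernel_order TYPE('n) \<alpha>"
  using assms unfolding kernel_order_def by (auto simp: field_simps intro: add_pos_nonneg)

lemma weight_eq: "weight \<alpha> (x :: real^'n) = of_real (bracket x powr kernel_order TYPE('n) \<alpha>)"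
  unfolding weight_def bracket_def kernel_order_def ..

lemma weight_nonzero [simp]: "weight \<alpha> x \<noteq> 0"
  unfolding weight_eq by simp

lemma radial_symbol:
  assumes "0 < y"
  shows "(\<lambda>x :: real^'n. complex_of_real ((y\<^sup>2 + (norm x)\<^sup>2) powr r)) \<in> symbol_space r"
  using elementary_symbol_in_symbol_space[OF elementary_symbol.base[OF assms order_refl, of r r]] by simp

lemma weight_symbol: "(weight \<alpha> :: real^'n \<Rightarrow> complex) \<in> symbol_space (kernel_order TYPE('n) \<alpha>)"
  using radial_symbol[OF zero_less_one, of "kernel_order TYPE('n) \<alpha>", where 'n='n]
  unfolding weight_eq[abs_def] bracket_def by simp

lemma alpha_kernel_eq:
  assumes "-1 < \<alpha>" "0 < y"
  obtains k where "0 < k"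
    "\<And>x :: real^'n. alpha_kernel \<alpha> y x = of_real (k * (y\<^sup>2 + (norm x)\<^sup>2) powr - kernel_order TYPE('n) \<alpha>)"
proof -
  let ?k = "Gamma ((\<alpha> + real CARD('n) + 1) / 2) / (Gamma ((\<alpha> + 1) / 2) * pi powr (real CARD('n) / 2)) * y powr (\<alpha> + 1)"
  have "0 < (\<alpha> + real CARD('n) + 1) / 2" using kernel_order_gt(2)[OF assms(1), where 'n='n] unfolding kernel_order_def .
  then have "0 < ?k" using assms by (intro mult_pos_pos divide_pos_pos Gamma_real_pos) auto
  moreover have "alpha_kernel \<alpha> y x = of_real (?k * (y\<^sup>2 + (norm x)\<^sup>2) powr - kernel_order TYPE('n) \<alpha>)" for x :: "real^'n"
    unfolding alpha_kernel_def kernel_order_def powr_minus_divide by (simp add: add.commute)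
  ultimately show ?thesis by (rule that)
qed

lemma alpha_kernel_symbol:
  assumes "-1 < \<alpha>" "0 < y"
  shows "(alpha_kernel \<alpha> y :: real^'n \<Rightarrow> complex) \<in> symbol_space (- kernel_order TYPE('n) \<alpha>)"
proof -
  obtain k where "\<And>x :: real^'n. alpha_kernel \<alpha> y x = of_real (k * (y\<^sup>2 + (norm x)\<^sup>2) powr - kernel_order TYPE('n) \<alpha>)"
    by (rule alpha_kernel_eq[OF assms]) (rule that)
  then have "(alpha_kernel \<alpha> y :: real^'n \<Rightarrow> complex) =
      (\<lambda>x. of_real k * of_real ((y\<^sup>2 + (norm x)\<^sup>2) powr - kernel_order TYPE('n) \<alpha>))"
    by auto
  then show ?thesis using symbol_cmult[OF radial_symbol[OF assms(2)]] by simp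
qed

lemma alpha_kernel_minus: "alpha_kernel \<alpha> y (- x) = alpha_kernel \<alpha> y x"
  unfolding alpha_kernel_def by simp

lemma integrable_symbol:
  fixes \<phi> :: "real^'n \<Rightarrow> complex"
  assumes "\<phi> \<in> symbol_space (- q)" "real CARD('n) / 2 < q"
  shows "integrable lborel \<phi>"
proof -
  obtain C where C: "0 \<le> C" "\<And>x. jet 0 \<phi> x \<le> C * bracket x powr - q" by (rule symbol_jet_le[OF assms(1)]) (rule that)
  have "integrable lborel (\<lambda>x :: real^'n. C * bracket x powr - q)"
    by (intro integrable_mult_right integrable_bracket_powr assms)
  then show ?thesis
  proof (rule Bochner_Integration.integrable_bound)
    show "AE x in lborel. norm (\<phi> x) \<le> norm (C * bracket x powr - q)"
      using C by (intro AE_I2) simp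
  qed (use smooth_measurable[OF symbol_smooth[OF assms(1)]] in simp)
qed

lemma integrable_symbol_mult_schwartz:
  fixes h :: "real^'n \<Rightarrow> complex"
  assumes "h \<in> symbol_space \<rho>" "\<psi> \<in> schwartz_space"
  shows "integrable lborel (\<lambda>x. h x * \<psi> x)"
  by (rule integrable_symbol[OF schwartz_symbol[OF schwartz_mult_symbol[OF assms]], of "real CARD('n)"]) simp

lemma schwartz_integrable_bracket:
  fixes \<psi> :: "real^'n \<Rightarrow> complex"
  assumes "\<psi> \<in> schwartz_space"
  shows "integrable lborel (\<lambda>x. cmod (\<psi> x) * bracket x powr \<sigma>)"
proof -
  have "(\<lambda>x :: real^'n. complex_of_real ((1\<^sup>2 + (norm x)\<^sup>2) powr \<sigma>)) \<in> symbol_space \<sigma>"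
    by (rule radial_symbol) simp
  from integrable_norm[OF integrable_symbol_mult_schwartz[OF this assms]]
  show ?thesis unfolding bracket_def by (simp add: norm_mult mult.commute)
qed

lemma dist_of_fun_linear:
  fixes h :: "real^'n \<Rightarrow> complex"
  assumes "h \<in> symbol_space \<rho>"
  shows "linear_form_on schwartz_space (dist_of_fun h)"
  unfolding linear_form_on_def dist_of_fun_def
proof (intro conjI ballI allI)
  fix \<phi> \<psi> :: "real^'n \<Rightarrow> complex" assume "\<phi> \<in> schwartz_space" "\<psi> \<in> schwartz_space"
  then show "(\<integral>x. h x * (\<phi> x + \<psi> x) \<partial>lborel) = (\<integral>x. h x * \<phi> x \<partial>lborel) + (\<integral>x. h x * \<psi> x \<partial>lborel)"
    unfolding distrib_left
    by (intro Bochner_Integration.integral_add integrable_symbol_mult_schwartz[OF assms])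
next
  fix c and \<phi> :: "real^'n \<Rightarrow> complex"
  show "(\<integral>x. h x * (c * \<phi> x) \<partial>lborel) = c * (\<integral>x. h x * \<phi> x \<partial>lborel)"
    unfolding mult.left_commute[of _ c] by (rule integral_mult_right_zero)
qed

lemma alpha_kernel_tempered:
  assumes "-1 < \<alpha>" "0 < y"
  shows "dist_of_fun (alpha_kernel \<alpha> y :: real^'n \<Rightarrow> complex) \<in> tempered"
proof -
  let ?K = "alpha_kernel \<alpha> y :: real^'n \<Rightarrow> complex"
  note K = alpha_kernel_symbol[OF assms, where 'n='n]
  have iK: "integrable lborel ?K" by (rule integrable_symbol[OF K kernel_order_gt(1)[OF assms(1)]])
  show ?thesis
  proof (rule temperedI[OF dist_of_fun_linear[OF K], where k=0 and m=0])
    show "0 \<le> (\<integral>x. cmod (?K x) \<partial>lborel)" by simp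
    fix \<psi> :: "real^'n \<Rightarrow> complex" and B assume \<psi>: "\<psi> \<in> schwartz_space" and B: "\<forall>x. (1 + norm x) ^ 0 * jet 0 \<psi> x \<le> B"
    have "cmod (dist_of_fun ?K \<psi>) \<le> (\<integral>x. cmod (?K x) * B \<partial>lborel)"
      unfolding dist_of_fun_def
      by (rule Bochner_Integration.integral_norm_bound_integral[OF integrable_symbol_mult_schwartz[OF K \<psi>]
            integrable_mult_left[OF integrable_norm[OF iK]]])
        (use B in \<open>auto simp: norm_mult intro: mult_left_mono\<close>)
    then show "cmod (dist_of_fun ?K \<psi>) \<le> (\<integral>x. cmod (?K x) \<partial>lborel) * B" by simp
  qed
qed

lemma check_conv_alpha_kernel:
  assumes "-1 < \<alpha>" "0 < y" "\<phi> \<in> smooth_space"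
  shows "check_conv (dist_of_fun (alpha_kernel \<alpha> y)) \<phi> = convolution (alpha_kernel \<alpha> y) (\<phi> :: real^'n \<Rightarrow> complex)"
proof
  fix \<eta> :: "real^'n"
  let ?f = "\<lambda>x. alpha_kernel \<alpha> y x * \<phi> (x + \<eta>)"
  have [measurable]: "\<phi> \<in> borel_measurable borel" "(alpha_kernel \<alpha> y :: real^'n \<Rightarrow> complex) \<in> borel_measurable borel"
    by (rule smooth_measurable, fact) (rule smooth_measurable[OF symbol_smooth[OF alpha_kernel_symbol[OF assms(1,2)]]])
  have "(\<integral>x. ?f (0 - x) \<partial>lborel) = (\<integral>x. ?f x \<partial>lborel)" by (rule integral_reflect) measurable
  then show "check_conv (dist_of_fun (alpha_kernel \<alpha> y)) \<phi> \<eta> = convolution (alpha_kernel \<alpha> y) \<phi> \<eta>"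
    unfolding check_conv_def dist_of_fun_def translate_def convolution_def
    by (simp add: alpha_kernel_minus)
qed

lemma convolution_commute:
  assumes [measurable]: "a \<in> borel_measurable borel" "b \<in> borel_measurable borel"
  shows "convolution a b = convolution b a"
proof
  fix x
  have "(\<integral>\<eta>. (\<lambda>\<eta>. a \<eta> * b (x - \<eta>)) (x - \<eta>) \<partial>lborel) = (\<integral>\<eta>. a \<eta> * b (x - \<eta>) \<partial>lborel)"
    by (rule integral_reflect) measurable
  then show "convolution a b x = convolution b a x" unfolding convolution_def by (simp add: mult.commute)
qed

lemma alpha_kernel_le:
  assumes "-1 < \<alpha>" "0 < y"
  obtains k where "0 \<le> k" "\<And>x :: real^'n. cmod (alpha_kernel \<alpha> y x) \<le> k * bracket x powr - kernel_order TYPE('n) \<alpha>"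
proof -
  obtain k where "0 \<le> k" "\<And>x :: real^'n. jet 0 (alpha_kernel \<alpha> y) x \<le> k * bracket x powr - kernel_order TYPE('n) \<alpha>"
    by (rule symbol_jet_le[OF alpha_kernel_symbol[OF assms]]) (rule that)
  then show ?thesis by (intro that[of k]) auto
qed

lemma alpha_kernel_measurable:
  "-1 < \<alpha> \<Longrightarrow> 0 < y \<Longrightarrow> (alpha_kernel \<alpha> y :: real^'n \<Rightarrow> complex) \<in> borel_measurable borel"
  by (rule smooth_measurable[OF symbol_smooth[OF alpha_kernel_symbol]])

lemma convolution_alpha_kernel_symbol:
  assumes "-1 < \<alpha>" "0 < y" "\<phi> \<in> schwartz_space"
  shows "convolution (alpha_kernel \<alpha> y) (\<phi> :: real^'n \<Rightarrow> complex) \<in> symbol_space (- kernel_order TYPE('n) \<alpha>)"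
proof -
  obtain k where k: "\<And>x :: real^'n. cmod (alpha_kernel \<alpha> y x) \<le> k * bracket x powr - kernel_order TYPE('n) \<alpha>"
    by (rule alpha_kernel_le[OF assms(1,2)]) (rule that)
  show ?thesis by (rule convolution_schwartz_symbol[OF alpha_kernel_measurable[OF assms(1,2)] k assms(3)])
qed

section \<open>Convolvability with the kernels characterizes the weighted space\<close>

lemma DL1_mult:
  fixes u :: "'n::finite form"
  assumes u: "u \<in> DL1" and h: "h \<in> symbol_space 0"
  shows "mult_dist h u \<in> DL1"
proof -
  obtain m C where "jet_bounded_form m C u" by (rule DL1_jet_bounded_form[OF u]) (rule that)
  note lin = jet_bounded_formD(1)[OF this] and C = jet_bounded_formD(2)[OF this] and ub = jet_bounded_formD(3)[OF this]
  obtain H where H: "0 \<le> H" "\<And>x. jet m h x \<le> H" by (rule symbol_jet_bounded[OF h]) (rule that)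
  have m: "(\<lambda>x. h x * \<psi> x) \<in> schwartz_space" if "\<psi> \<in> schwartz_space" for \<psi>
    by (rule schwartz_mult_symbol[OF h that])
  have "linear_form_on schwartz_space (mult_dist h u)"
    unfolding linear_form_on_def mult_dist_def distrib_left mult.left_commute[of "h _"]
    using linear_form_on_add[OF lin m m] linear_form_on_cmult[OF lin m] by auto
  moreover have "cmod (mult_dist h u \<psi>) \<le> C * (2 ^ m * H) * B"
    if \<psi>: "\<psi> \<in> schwartz_space" and B: "\<forall>x. jet m \<psi> x \<le> B" for \<psi> B
  proof -
    have "jet m (\<lambda>x. h x * \<psi> x) x \<le> 2 ^ m * H * B" for x
    proof -
      have "jet m (\<lambda>x. h x * \<psi> x) x \<le> 2 ^ m * jet m h x * jet m \<psi> x"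
        by (rule jet_mult[OF symbol_smooth[OF h] schwartz_smooth[OF \<psi>]])
      also have "\<dots> \<le> 2 ^ m * H * B"
        using H by (intro mult_mono mult_left_mono H(2) spec[OF B]) auto
      finally show ?thesis .
    qed
    from ub[OF m[OF \<psi>] this] show ?thesis unfolding mult_dist_def by (simp add: mult_ac)
  qed
  ultimately have "jet_bounded_form m (C * (2 ^ m * H)) (mult_dist h u)"
    unfolding jet_bounded_form_def using C H(1) by auto
  then show ?thesis by (rule jet_bounded_form_DL1)
qed

text \<open>
  The convolution of the kernel with a Schwartz function has the order of the kernel, so that its
  product with the weight is bounded with all derivatives and multiplies \<open>DL1\<close> into itself.
\<close>

lemma weighted_DL1_convolvable:
  fixes f :: "'n::finite form"
  assumes \<alpha>: "-1 < \<alpha>" and f: "f \<in> weighted_DL1 \<alpha>" and y: "0 < y"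
  shows "S_convolvable f (dist_of_fun (alpha_kernel \<alpha> y))"
  unfolding S_convolvable_def
proof (intro conjI ballI)
  show "f \<in> tempered" using f unfolding weighted_DL1_def by simp
  show "dist_of_fun (alpha_kernel \<alpha> y) \<in> tempered" by (rule alpha_kernel_tempered[OF \<alpha> y])
  fix \<phi> :: "real^'n \<Rightarrow> complex" assume \<phi>: "\<phi> \<in> schwartz_space"
  let ?c = "convolution (alpha_kernel \<alpha> y) \<phi>"
  have g: "mult_dist (\<lambda>x. inverse (weight \<alpha> x)) f \<in> DL1" using f unfolding weighted_DL1_def by simp
  have "(\<lambda>x. weight \<alpha> x * ?c x) \<in> symbol_space 0"
    using symbol_mult[OF weight_symbol[of \<alpha>] convolution_alpha_kernel_symbol[OF \<alpha> y \<phi>]] by simp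
  note DL1_mult[OF g this]
  also have "mult_dist (\<lambda>x. weight \<alpha> x * ?c x) (mult_dist (\<lambda>x. inverse (weight \<alpha> x)) f) = mult_dist ?c f"
  proof -
    have "inverse (weight \<alpha> x) * (weight \<alpha> x * ?c x * z) = ?c x * z" for x z by simp
    then show ?thesis unfolding mult_dist_def by (simp only:)
  qed
  finally show "mult_dist (check_conv (dist_of_fun (alpha_kernel \<alpha> y)) \<phi>) f \<in> DL1"
    unfolding check_conv_alpha_kernel[OF \<alpha> y schwartz_smooth[OF \<phi>]] .
qed

text \<open>
  The kernel smoothed by a Gaussian is bounded below by a multiple of \<open>1 / weight \<alpha>\<close>, by
  Peetre's inequality.
\<close>

lemma convolution_alpha_kernel_cutoff_ge:
  assumes \<alpha>: "-1 < \<alpha>"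
  obtains d where "0 < d"
    "\<And>x :: real^'n. d * bracket x powr - kernel_order TYPE('n) \<alpha> \<le> cmod (convolution (alpha_kernel \<alpha> 1) (cutoff 1) x)"
proof -
  let ?s = "kernel_order TYPE('n) \<alpha>"
  note s = kernel_order_gt[OF \<alpha>, where 'n='n]
  obtain k where k: "0 < k" "\<And>x :: real^'n. alpha_kernel \<alpha> 1 x = of_real (k * (1\<^sup>2 + (norm x)\<^sup>2) powr - ?s)"
    by (rule alpha_kernel_eq[OF \<alpha> zero_less_one]) (rule that)
  have K: "alpha_kernel \<alpha> 1 x = of_real (k * bracket x powr - ?s)" for x :: "real^'n"
    unfolding k(2) bracket_def by simp
  define e where "e z = exp (- (norm (z :: real^'n))\<^sup>2)" for z
  have e: "cutoff 1 z = of_real (e z)" "0 < e z" "e z \<le> 1" for z unfolding cutoff_def e_def by auto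
  have [measurable]: "e \<in> borel_measurable borel" unfolding e_def by measurable
  have be: "integrable lborel (\<lambda>z :: real^'n. bracket z powr - ?s * e z)"
  proof (rule Bochner_Integration.integrable_bound[OF integrable_bracket_powr[OF s(1)]])
    show "AE z :: real^'n in lborel. norm (bracket z powr - ?s * e z) \<le> norm (bracket z powr - ?s)"
      using e by (intro AE_I2) (simp add: mult_left_le less_imp_le)
  qed measurable
  define I where "I = (\<integral>z. bracket z powr - ?s * e z \<partial>lborel)"
  have pos: "0 < bracket z powr - ?s * e z" for z :: "real^'n" using e(2)[of z] by simp
  have I: "0 < I"
  proof -
    have "0 \<le> I" unfolding I_def using less_imp_le[OF pos] by (intro integral_nonneg_AE AE_I2)
    moreover have "I \<noteq> 0"
    proof
      assume "I = 0"
      then have "AE z :: real^'n in lborel. bracket z powr - ?s * e z = 0"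
        unfolding I_def using less_imp_le[OF pos] by (subst (asm) integral_nonneg_eq_0_iff_AE[OF be]) auto
      then have "AE z :: real^'n in lborel. False"
        by (rule eventually_mono) (use pos in \<open>metis less_irrefl\<close>)
      then have "ae_filter (lborel :: (real^'n) measure) = bot" by (simp add: trivial_limit_def)
      then show False by (simp add: ae_filter_eq_bot_iff)
    qed
    ultimately show ?thesis by simp
  qed
  have "(k * 2 powr - ?s * I) * bracket x powr - ?s \<le> cmod (convolution (alpha_kernel \<alpha> 1) (cutoff 1) x)" for x :: "real^'n"
  proof -
    have i: "integrable lborel (\<lambda>\<eta>. k * bracket \<eta> powr - ?s * e (x - \<eta>))"
    proof (rule Bochner_Integration.integrable_bound[OF integrable_mult_right[OF integrable_bracket_powr[OF s(1)], of k]])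
      show "AE \<eta> in lborel. norm (k * bracket \<eta> powr - ?s * e (x - \<eta>)) \<le> norm (k * bracket \<eta> powr - ?s)"
        using e k(1) by (intro AE_I2) (simp add: mult_left_le less_imp_le)
    qed measurable
    have "(k * 2 powr - ?s * I) * bracket x powr - ?s =
        (\<integral>\<eta>. (k * 2 powr - ?s * bracket x powr - ?s) * (bracket (x - \<eta>) powr - ?s * e (x - \<eta>)) \<partial>lborel)"
      using integral_reflect[of "\<lambda>z. bracket z powr - ?s * e z" x] unfolding I_def by simp
    also have "\<dots> \<le> (\<integral>\<eta>. k * bracket \<eta> powr - ?s * e (x - \<eta>) \<partial>lborel)"
    proof (rule integral_mono[OF integrable_mult_right[OF integrable_reflect[OF be]] i])
      fix \<eta>
      have "bracket \<eta> \<le> 2 * bracket x * bracket (x - \<eta>)"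
        using bracket_add_le[of x "- (x - \<eta>)"] by (simp only: bracket_minus) simp
      then have "(2 * bracket x * bracket (x - \<eta>)) powr - ?s \<le> bracket \<eta> powr - ?s"
        using s(2) by (intro powr_mono2') auto
      then have "2 powr - ?s * bracket x powr - ?s * bracket (x - \<eta>) powr - ?s \<le> bracket \<eta> powr - ?s"
        by (simp add: powr_mult)
      then have "k * (2 powr - ?s * bracket x powr - ?s * bracket (x - \<eta>) powr - ?s) * e (x - \<eta>) \<le>
          k * bracket \<eta> powr - ?s * e (x - \<eta>)"
        using k(1) e(2)[of "x - \<eta>"] by (intro mult_right_mono mult_left_mono) auto
      then show "(k * 2 powr - ?s * bracket x powr - ?s) * (bracket (x - \<eta>) powr - ?s * e (x - \<eta>)) \<le>
          k * bracket \<eta> powr - ?s * e (x - \<eta>)"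
        by (simp add: mult_ac)
    qed
    also have "\<dots> \<le> cmod (of_real (\<integral>\<eta>. k * bracket \<eta> powr - ?s * e (x - \<eta>) \<partial>lborel))"
      unfolding norm_of_real by (rule abs_ge_self)
    also have "of_real (\<integral>\<eta>. k * bracket \<eta> powr - ?s * e (x - \<eta>) \<partial>lborel) = convolution (alpha_kernel \<alpha> 1) (cutoff 1) x"
      unfolding convolution_def K e(1) by (simp flip: integral_complex_of_real)
    finally show ?thesis .
  qed
  moreover have "0 < k * 2 powr - ?s * I" using k(1) I by simp
  ultimately show ?thesis by (rule that[rotated])
qed

text \<open>
  Dividing by the convolution of the kernel with a Gaussian: its product \<open>h\<close> with the weight is a
  symbol of order zero that is bounded away from zero, so that \<open>inverse h\<close> multiplies \<open>DL1\<close> into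
  itself.
\<close>

lemma convolvable_weighted_DL1:
  fixes f :: "'n::finite form"
  assumes \<alpha>: "-1 < \<alpha>" and f: "S_convolvable f (dist_of_fun (alpha_kernel \<alpha> 1))"
  shows "f \<in> weighted_DL1 \<alpha>"
proof -
  let ?s = "kernel_order TYPE('n) \<alpha>" and ?c = "convolution (alpha_kernel \<alpha> 1) (cutoff 1) :: real^'n \<Rightarrow> complex"
  have \<phi>: "(cutoff 1 :: real^'n \<Rightarrow> complex) \<in> schwartz_space" by (rule cutoff_schwartz) simp
  obtain d where d: "0 < d" "\<And>x :: real^'n. d * bracket x powr - ?s \<le> cmod (?c x)"
    by (rule convolution_alpha_kernel_cutoff_ge[OF \<alpha>]) (rule that)
  define h where "h = (\<lambda>x. weight \<alpha> x * ?c x)"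
  have h: "h \<in> symbol_space 0"
    unfolding h_def using symbol_mult[OF weight_symbol[of \<alpha>] convolution_alpha_kernel_symbol[OF \<alpha> zero_less_one \<phi>]] by simp
  have hd: "d \<le> cmod (h x)" for x :: "real^'n"
  proof -
    have "d = bracket x powr ?s * (d * bracket x powr - ?s)" by (simp add: powr_minus)
    also have "\<dots> \<le> bracket x powr ?s * cmod (?c x)" by (intro mult_left_mono d) simp
    finally show ?thesis unfolding h_def norm_mult weight_eq by simp
  qed
  have c: "?c x \<noteq> 0" for x
    using hd[of x] d(1) unfolding h_def by auto
  have "mult_dist ?c f \<in> DL1"
    using f \<phi> check_conv_alpha_kernel[OF \<alpha> zero_less_one schwartz_smooth[OF \<phi>]] unfolding S_convolvable_def by force
  from DL1_mult[OF this symbol_inverse[OF h d(1) hd]]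
  have "mult_dist (\<lambda>x. inverse (h x)) (mult_dist ?c f) \<in> DL1" .
  also have "mult_dist (\<lambda>x. inverse (h x)) (mult_dist ?c f) = mult_dist (\<lambda>x. inverse (weight \<alpha> x)) f"
    proof -
    have "?c x * (inverse (h x) * z) = inverse (weight \<alpha> x) * z" for x z
      unfolding h_def using c[of x] by simp
    then show ?thesis unfolding mult_dist_def by (simp only:)
  qed
  finally show ?thesis using f unfolding weighted_DL1_def S_convolvable_def by simp
qed

section \<open>The convolution as a function\<close>

text \<open>
  The form \<open>L \<psi> = \<langle>f / weight \<alpha>, weight \<alpha> * \<psi>\<rangle>\<close> extends \<open>f\<close> to all symbols of the order of the kernel.
  The convolution is computed in terms of \<open>L\<close> alone.
\<close>

locale weighted_functional =
  fixes \<alpha> :: real and f L :: "'n::finite form" and m :: nat and C :: real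
  assumes \<alpha>: "-1 < \<alpha>" and C: "0 \<le> C"
    and L_linear: "linear_form_on (symbol_space (- kernel_order TYPE('n) \<alpha>)) L"
    and L_bound: "\<And>\<psi> B. \<psi> \<in> symbol_space (- kernel_order TYPE('n) \<alpha>) \<Longrightarrow>
      (\<And>x. jet m \<psi> x \<le> B * bracket x powr - kernel_order TYPE('n) \<alpha>) \<Longrightarrow> cmod (L \<psi>) \<le> C * B"
    and L_eq: "\<And>\<psi>. \<psi> \<in> schwartz_space \<Longrightarrow> L \<psi> = f \<psi>"
    and L_LIMSEQ: "\<And>\<phi>s \<phi>. (\<And>k. \<phi>s k \<in> symbol_space (- kernel_order TYPE('n) \<alpha>)) \<Longrightarrow>
      \<phi> \<in> symbol_space (- kernel_order TYPE('n) \<alpha>) \<Longrightarrow>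
      (\<And>m. \<exists>C. \<forall>k x. jet m (\<phi>s k) x \<le> C * bracket x powr - kernel_order TYPE('n) \<alpha>) \<Longrightarrow>
      (\<And>m r \<epsilon>. 0 < \<epsilon> \<Longrightarrow> \<forall>\<^sub>F k in sequentially. \<forall>x. norm x \<le> r \<longrightarrow> jet m (\<lambda>x. \<phi>s k x - \<phi> x) x \<le> \<epsilon>) \<Longrightarrow>
      (\<lambda>k. L (\<phi>s k)) \<longlonglongrightarrow> L \<phi>"
begin

lemma check_conv_f:
  assumes "\<phi> \<in> schwartz_space"
  shows "check_conv f \<phi> \<eta> = L (translate (- \<eta>) \<phi>)"
  unfolding check_conv_def by (rule L_eq[OF schwartz_translate[OF assms], symmetric])

lemma L_convolution:
  assumes "a \<in> borel_measurable borel"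
    and "integrable lborel (\<lambda>\<eta>. cmod (a \<eta>) * bracket \<eta> powr (2 * \<bar>- kernel_order TYPE('n) \<alpha>\<bar> + 1))"
    and "\<phi> \<in> symbol_space (- kernel_order TYPE('n) \<alpha>)"
  shows "integrable lborel (\<lambda>\<eta>. a \<eta> * L (translate \<eta> \<phi>))"
    and "L (convolution a \<phi>) = (\<integral>\<eta>. a \<eta> * L (translate \<eta> \<phi>) \<partial>lborel)"
  by (rule linear_form_convolution[OF L_linear C _ assms, where m=m], rule L_bound, assumption, blast)+

text \<open>
  Since the kernel is even, testing \<open>K (f\<^sup>\<or> * \<phi>)\<close> with \<open>\<psi>\<close> is testing \<open>f\<close> with the convolution of \<open>\<phi>\<close> with the reflection of \<open>K \<psi>\<close>.
\<close>

lemma kernel_check_conv_eq: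
  assumes y: "0 < y" and \<phi>: "\<phi> \<in> schwartz_space" and \<psi>: "\<psi> \<in> schwartz_space"
  shows "integrable lborel (\<lambda>x. alpha_kernel \<alpha> y x * (check_conv f \<phi> x * \<psi> x))"
    and "mult_dist (check_conv f \<phi>) (dist_of_fun (alpha_kernel \<alpha> y)) \<psi> =
      L (convolution (\<lambda>\<eta>. alpha_kernel \<alpha> y \<eta> * \<psi> (- \<eta>)) \<phi>)"
proof -
  let ?s = "kernel_order TYPE('n) \<alpha>"
  let ?K = "alpha_kernel \<alpha> y :: real^'n \<Rightarrow> complex"
  let ?a = "\<lambda>\<eta>. ?K \<eta> * \<psi> (- \<eta>)"
  have p: "(\<lambda>\<eta>. ?K \<eta> * \<psi> \<eta>) \<in> schwartz_space" by (rule schwartz_mult_symbol[OF alpha_kernel_symbol[OF \<alpha> y] \<psi>])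
  have [measurable]: "?K \<in> borel_measurable borel" "\<psi> \<in> borel_measurable borel"
    by (rule alpha_kernel_measurable[OF \<alpha> y]) (rule smooth_measurable[OF schwartz_smooth[OF \<psi>]])
  have am: "?a \<in> borel_measurable borel" by measurable
  have ai: "integrable lborel (\<lambda>\<eta>. cmod (?a \<eta>) * bracket \<eta> powr (2 * \<bar>- ?s\<bar> + 1))"
    using integrable_reflect[OF schwartz_integrable_bracket[OF p, of "2 * \<bar>- ?s\<bar> + 1"], of 0]
    by (simp add: alpha_kernel_minus)
  note conv = L_convolution[OF am ai schwartz_symbol[OF \<phi>]]
  have eq: "?a (0 - x) * L (translate (0 - x) \<phi>) = ?K x * (check_conv f \<phi> x * \<psi> x)" for x
    by (simp add: alpha_kernel_minus check_conv_f[OF \<phi>] mult_ac)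
  show "integrable lborel (\<lambda>x. ?K x * (check_conv f \<phi> x * \<psi> x))"
    using integrable_reflect[OF conv(1), of 0] unfolding eq .
  have "(\<integral>x. ?a (0 - x) * L (translate (0 - x) \<phi>) \<partial>lborel) = (\<integral>\<eta>. ?a \<eta> * L (translate \<eta> \<phi>) \<partial>lborel)"
    using borel_measurable_integrable[OF conv(1)] by (intro integral_reflect) simp
  then show "mult_dist (check_conv f \<phi>) (dist_of_fun ?K) \<psi> = L (convolution ?a \<phi>)"
    unfolding conv(2) eq mult_dist_def dist_of_fun_def .
qed

lemma L_convolution_le:
  fixes a :: "real^'n \<Rightarrow> complex"
  assumes a: "a \<in> borel_measurable borel" "\<And>\<eta>. cmod (a \<eta>) \<le> A * bracket \<eta> powr - kernel_order TYPE('n) \<alpha>"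
    and \<phi>: "\<phi> \<in> schwartz_space" and Q: "\<And>x. jet m \<phi> x \<le> Q * bracket x powr (- \<bar>- kernel_order TYPE('n) \<alpha>\<bar> - real CARD('n))"
  shows "cmod (L (convolution a \<phi>)) \<le> C * (real (CARD('n) + 1) ^ m * (peetre_constant TYPE('n) (- kernel_order TYPE('n) \<alpha>) * A * Q))"
proof (rule L_bound[OF convolution_schwartz_symbol[OF a \<phi>]])
  let ?s = "kernel_order TYPE('n) \<alpha>"
  fix x
  show "jet m (convolution a \<phi>) x \<le>
      real (CARD('n) + 1) ^ m * (peetre_constant TYPE('n) (- ?s) * A * Q) * bracket x powr - ?s"
    using jet_convolution_le[OF a schwartz_symbol[OF \<phi>] Q, of x] by (simp add: mult_ac)
qed

text \<open>
  The function \<open>\<psi>\<close> enters \<open>kernel_check_conv_eq\<close> undifferentiated, through a factor of the kernel;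
  all derivatives of the convolution fall on \<open>\<phi>\<close>.  Hence only the supremum of \<open>\<psi>\<close> matters.
\<close>

lemma kernel_check_conv_bounded:
  assumes y: "0 < y" and \<phi>: "\<phi> \<in> schwartz_space"
  obtains D where "jet_bounded_form 0 D (mult_dist (check_conv f \<phi>) (dist_of_fun (alpha_kernel \<alpha> y)))"
proof -
  let ?s = "kernel_order TYPE('n) \<alpha>"
  let ?K = "alpha_kernel \<alpha> y :: real^'n \<Rightarrow> complex"
  let ?u = "mult_dist (check_conv f \<phi>) (dist_of_fun ?K)"
  obtain k where k: "0 \<le> k" "\<And>x :: real^'n. cmod (?K x) \<le> k * bracket x powr - ?s"
    by (rule alpha_kernel_le[OF \<alpha> y]) (rule that)
  obtain Q where Q: "0 \<le> Q" "\<And>x. jet m \<phi> x \<le> Q * bracket x powr (- \<bar>- ?s\<bar> - real CARD('n))"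
    by (rule symbol_jet_le[OF schwartz_symbol[OF \<phi>]]) (rule that)
  define D where "D = C * (real (CARD('n) + 1) ^ m * (peetre_constant TYPE('n) (- ?s) * k * Q))"
  have D: "0 \<le> D" unfolding D_def using C k(1) Q(1) by simp
  have "linear_form_on schwartz_space ?u"
    unfolding linear_form_on_def
  proof (intro conjI ballI allI)
    fix \<psi> \<psi>' :: "real^'n \<Rightarrow> complex" assume \<psi>: "\<psi> \<in> schwartz_space" "\<psi>' \<in> schwartz_space"
    show "?u (\<lambda>x. \<psi> x + \<psi>' x) = ?u \<psi> + ?u \<psi>'"
      unfolding mult_dist_def dist_of_fun_def distrib_left
      by (rule Bochner_Integration.integral_add) (rule kernel_check_conv_eq(1)[OF y \<phi>], rule \<psi>)+
  next
    fix c and \<psi> :: "real^'n \<Rightarrow> complex"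
    show "?u (\<lambda>x. c * \<psi> x) = c * ?u \<psi>"
      unfolding mult_dist_def dist_of_fun_def mult.left_commute[of _ c] by (rule integral_mult_right_zero)
  qed
  moreover have "cmod (?u \<psi>) \<le> D * B" if \<psi>: "\<psi> \<in> schwartz_space" and B: "\<forall>x. jet 0 \<psi> x \<le> B" for \<psi> B
  proof -
    have [measurable]: "?K \<in> borel_measurable borel" "\<psi> \<in> borel_measurable borel"
      by (rule alpha_kernel_measurable[OF \<alpha> y]) (rule smooth_measurable[OF schwartz_smooth[OF \<psi>]])
    have am: "(\<lambda>\<eta>. ?K \<eta> * \<psi> (- \<eta>)) \<in> borel_measurable borel" by measurable
    have "cmod (?K \<eta> * \<psi> (- \<eta>)) \<le> (k * B) * bracket \<eta> powr - ?s" for \<eta>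
    proof -
      have "cmod (?K \<eta>) * cmod (\<psi> (- \<eta>)) \<le> (k * bracket \<eta> powr - ?s) * B"
        using B k(1) by (intro mult_mono k(2)) auto
      then show ?thesis by (simp add: norm_mult mult_ac)
    qed
    from L_convolution_le[OF am this \<phi> Q(2)]
    show ?thesis unfolding kernel_check_conv_eq(2)[OF y \<phi> \<psi>] D_def by (simp add: mult_ac)
  qed
  ultimately have "jet_bounded_form 0 D ?u" unfolding jet_bounded_form_def using D by simp
  then show ?thesis by (rule that)
qed

text \<open>
  The value of the convolution at \<open>\<phi>\<close> is a limit along cutoffs of the constant function \<open>1\<close>.  The
  corresponding cutoffs of the kernel are dominated by the kernel and converge to it, so that the
  continuity of \<open>L\<close> applies.
\<close>

lemma S_convolution_kernel:
  assumes y: "0 < y" and \<phi>: "\<phi> \<in> schwartz_space"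
  shows "S_convolution (dist_of_fun (alpha_kernel \<alpha> y)) f \<phi> = L (convolution (alpha_kernel \<alpha> y) \<phi>)"
proof -
  let ?s = "kernel_order TYPE('n) \<alpha>"
  let ?K = "alpha_kernel \<alpha> y :: real^'n \<Rightarrow> complex" and ?l = "\<lambda>k. inverse (real (Suc k))"
  let ?u = "mult_dist (check_conv f \<phi>) (dist_of_fun ?K)"
  let ?a = "\<lambda>k \<eta>. ?K \<eta> * cutoff (?l k) \<eta>"
  have l: "0 < ?l k" for k by simp
  obtain D where u: "jet_bounded_form 0 D ?u" by (rule kernel_check_conv_bounded[OF y \<phi>]) (rule that)
  have one: "(\<lambda>_. 1) \<in> (B_space :: (real^'n \<Rightarrow> complex) set)" unfolding B_space_eq by (rule symbol_const)
  have Km [measurable]: "?K \<in> borel_measurable borel" by (rule alpha_kernel_measurable[OF \<alpha> y])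
  have cm [measurable]: "cutoff l \<in> borel_measurable borel" for l
    unfolding cutoff_def by measurable
  have am: "?a k \<in> borel_measurable borel" for k by measurable
  obtain c where c: "0 \<le> c" "\<And>x :: real^'n. cmod (?K x) \<le> c * bracket x powr - ?s"
    by (rule alpha_kernel_le[OF \<alpha> y]) (rule that)
  have ale: "cmod (?a k \<eta>) \<le> c * bracket \<eta> powr - ?s" for k \<eta>
    using mult_mono[OF c(2)[of \<eta>] cmod_cutoff_le[of "?l k" \<eta>]] c(1) by (simp add: norm_mult)
  have u_eq: "?u (\<lambda>x. cutoff (?l k) x * 1) = L (convolution (?a k) \<phi>)" for k
  proof -
    have "cutoff (?l k) (- \<eta>) = cutoff (?l k) \<eta>" for \<eta> :: "real^'n" unfolding cutoff_def by simp
    then show ?thesis using kernel_check_conv_eq(2)[OF y \<phi> cutoff_schwartz[OF l[of k]]] by (simp only: mult_1_right)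
  qed
  have "(\<lambda>k. L (convolution (?a k) \<phi>)) \<longlonglongrightarrow> L (convolution ?K \<phi>)"
  proof (rule L_LIMSEQ)
    show "convolution (?a k) \<phi> \<in> symbol_space (- ?s)" for k by (rule convolution_schwartz_symbol[OF am ale \<phi>])
    show "convolution ?K \<phi> \<in> symbol_space (- ?s)" by (rule convolution_alpha_kernel_symbol[OF \<alpha> y \<phi>])
    fix M
    obtain Q where Q: "\<And>x. jet M \<phi> x \<le> Q * bracket x powr (- \<bar>- ?s\<bar> - real CARD('n))"
      by (rule symbol_jet_le[OF schwartz_symbol[OF \<phi>]]) (rule that)
    have "jet M (convolution (?a k) \<phi>) x \<le>
        (real (CARD('n) + 1) ^ M * (peetre_constant TYPE('n) (- ?s) * c * Q)) * bracket x powr - ?s" for k x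
      using jet_convolution_le[OF am ale schwartz_symbol[OF \<phi>] Q, of k x] by (simp add: mult_ac)
    then show "\<exists>B. \<forall>k x. jet M (convolution (?a k) \<phi>) x \<le> B * bracket x powr - ?s" by blast
    fix r \<epsilon> :: real assume \<epsilon>: "0 < \<epsilon>"
    obtain P where P: "0 \<le> P" "\<And>x. jet M \<phi> x \<le> P * bracket x powr (- \<bar>1\<bar> - real CARD('n))"
      by (rule symbol_jet_le[OF schwartz_symbol[OF \<phi>]]) (rule that)
    define E where "E = real (CARD('n) + 1) ^ M * (peetre_constant TYPE('n) 1 * c * P) * (1 + r\<^sup>2)"
    \<comment> \<open>The error \<open>1 - cutoff l\<close> is \<open>O(l\<^sup>2 \<bar>\<eta>\<bar>\<^sup>2)\<close>: as a function of order one it has size \<open>O(l\<^sup>2)\<close>.\<close>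
    have diff: "jet M (\<lambda>x. convolution (?a k) \<phi> x - convolution ?K \<phi> x) x \<le> (?l k)\<^sup>2 * E"
      if x: "norm x \<le> r" for k x
    proof -
      let ?b = "\<lambda>\<eta>. ?K \<eta> * (cutoff (?l k) \<eta> - 1)"
      have bm: "?b \<in> borel_measurable borel" by measurable
      have ble: "cmod (?b \<eta>) \<le> (c * (?l k)\<^sup>2) * bracket \<eta> powr 1" for \<eta>
      proof -
        have "bracket \<eta> powr - ?s \<le> bracket \<eta> powr 0"
          using kernel_order_gt(2)[OF \<alpha>, where 'n='n] by (intro bracket_powr_mono) simp
        then have "c * bracket \<eta> powr - ?s \<le> c * 1" using c(1) by (intro mult_left_mono) auto
        then have "cmod (?K \<eta>) \<le> c" using order_trans[OF c(2)] by simp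
        moreover have "cmod (cutoff (?l k) \<eta> - 1) \<le> (?l k)\<^sup>2 * bracket \<eta>"
        proof -
          have "cmod (cutoff (?l k) \<eta> - 1) \<le> (?l k)\<^sup>2 * (norm \<eta>)\<^sup>2"
            using cmod_one_minus_cutoff_le(2)[of "?l k" \<eta>] by (simp only: norm_minus_commute)
          also have "\<dots> \<le> (?l k)\<^sup>2 * bracket \<eta>" unfolding bracket_def by (intro mult_left_mono) auto
          finally show ?thesis .
        qed
        ultimately have "cmod (?K \<eta>) * cmod (cutoff (?l k) \<eta> - 1) \<le> c * ((?l k)\<^sup>2 * bracket \<eta>)"
          using c(1) by (intro mult_mono) auto
        then show ?thesis by (simp only: norm_mult mult.assoc powr_one[OF bracket_nonneg])
      qed
      have int: "integrable lborel (\<lambda>\<eta>. ?a k \<eta> * \<phi> (x - \<eta>))" "integrable lborel (\<lambda>\<eta>. ?K \<eta> * \<phi> (x - \<eta>))" for x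
        by (rule convolution_integrable[OF am integrable_order[OF am ale] schwartz_symbol[OF \<phi>]],
            rule convolution_integrable[OF Km integrable_order[OF Km c(2)] schwartz_symbol[OF \<phi>]])
      have "(\<lambda>x. convolution (?a k) \<phi> x - convolution ?K \<phi> x) = convolution ?b \<phi>"
      proof
        fix x
        show "convolution (?a k) \<phi> x - convolution ?K \<phi> x = convolution ?b \<phi> x"
          unfolding convolution_def Bochner_Integration.integral_diff[OF int, symmetric]
          by (simp add: algebra_simps)
      qed
      then have "jet M (\<lambda>x. convolution (?a k) \<phi> x - convolution ?K \<phi> x) x \<le>
          real (CARD('n) + 1) ^ M * (peetre_constant TYPE('n) 1 * (c * (?l k)\<^sup>2) * P * bracket x powr 1)"
        using jet_convolution_le[OF bm ble schwartz_symbol[OF \<phi>] P(2), of x] by (simp only: mult_ac)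
      also have "\<dots> = (?l k)\<^sup>2 * (real (CARD('n) + 1) ^ M * (peetre_constant TYPE('n) 1 * c * P) * bracket x)"
        by (simp only: powr_one[OF bracket_nonneg] mult_ac)
      also have "\<dots> \<le> (?l k)\<^sup>2 * E"
      proof -
        have "(norm x)\<^sup>2 \<le> r\<^sup>2" using x by (intro power_mono) auto
        then show ?thesis unfolding E_def bracket_def using c(1) P(1) by (intro mult_left_mono) auto
      qed
      finally show ?thesis .
    qed
    have "(\<lambda>k. (?l k)\<^sup>2 * E) \<longlonglongrightarrow> 0\<^sup>2 * E" by (intro tendsto_intros LIMSEQ_inverse_real_of_nat)
    then have "\<forall>\<^sub>F k in sequentially. (?l k)\<^sup>2 * E < \<epsilon>" by (intro order_tendstoD) (use \<epsilon> in auto)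
    then show "\<forall>\<^sub>F k in sequentially. \<forall>x. norm x \<le> r \<longrightarrow>
        jet M (\<lambda>x. convolution (?a k) \<phi> x - convolution ?K \<phi> x) x \<le> \<epsilon>"
    proof (rule eventually_mono, intro allI impI)
      fix k and x :: "real^'n" assume "(?l k)\<^sup>2 * E < \<epsilon>" "norm x \<le> r"
      then show "jet M (\<lambda>x. convolution (?a k) \<phi> x - convolution ?K \<phi> x) x \<le> \<epsilon>"
        using order_trans[OF diff less_imp_le] by blast
    qed
  qed
  then have "(\<lambda>k. ?u (\<lambda>x. cutoff (?l k) x * 1)) \<longlonglongrightarrow> L (convolution ?K \<phi>)" unfolding u_eq .
  then have "extension ?u (\<lambda>_. 1) = L (convolution ?K \<phi>)"
    using LIMSEQ_unique[OF extension_LIMSEQ[OF u one]] by simp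
  then show ?thesis unfolding S_convolution_def DL1_pairing_eq[OF u one] .
qed

text \<open>
  By \<open>linear_form_convolution\<close>, with the roles of the kernel and of the test function exchanged.
\<close>

lemma L_convolution_kernel:
  assumes y: "0 < y" and \<phi>: "\<phi> \<in> schwartz_space"
  shows "integrable lborel (\<lambda>\<eta>. \<phi> \<eta> * L (translate \<eta> (alpha_kernel \<alpha> y)))"
    and "L (convolution (alpha_kernel \<alpha> y) \<phi>) = (\<integral>\<eta>. \<phi> \<eta> * L (translate \<eta> (alpha_kernel \<alpha> y)) \<partial>lborel)"
proof -
  have m: "\<phi> \<in> borel_measurable borel" by (rule smooth_measurable[OF schwartz_smooth[OF \<phi>]])
  note conv = L_convolution[OF m schwartz_integrable_bracket[OF \<phi>] alpha_kernel_symbol[OF \<alpha> y]]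
  show "integrable lborel (\<lambda>\<eta>. \<phi> \<eta> * L (translate \<eta> (alpha_kernel \<alpha> y)))" by (rule conv(1))
  show "L (convolution (alpha_kernel \<alpha> y) \<phi>) = (\<integral>\<eta>. \<phi> \<eta> * L (translate \<eta> (alpha_kernel \<alpha> y)) \<partial>lborel)"
    unfolding convolution_commute[OF alpha_kernel_measurable[OF \<alpha> y] m] by (rule conv(2))
qed

lemma S_convolution_is_function:
  assumes y: "0 < y"
  shows "is_function (S_convolution (dist_of_fun (alpha_kernel \<alpha> y)) f) (\<lambda>\<eta>. L (translate \<eta> (alpha_kernel \<alpha> y)))"
proof -
  let ?s = "kernel_order TYPE('n) \<alpha>"
  let ?K = "alpha_kernel \<alpha> y :: real^'n \<Rightarrow> complex"
  let ?v = "S_convolution (dist_of_fun ?K) f"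
  let ?G = "\<lambda>\<eta>. L (translate \<eta> ?K)"
  have int: "integrable lborel (\<lambda>\<eta>. ?G \<eta> * \<phi> \<eta>)" if "\<phi> \<in> schwartz_space" for \<phi>
    using L_convolution_kernel(1)[OF y that] by (simp add: mult.commute)
  have v: "?v \<phi> = (\<integral>\<eta>. ?G \<eta> * \<phi> \<eta> \<partial>lborel)" if "\<phi> \<in> schwartz_space" for \<phi>
    unfolding S_convolution_kernel[OF y that] L_convolution_kernel(2)[OF y that] by (simp only: mult.commute)
  have lin: "linear_form_on schwartz_space ?v"
    unfolding linear_form_on_def
  proof (intro conjI ballI allI)
    fix \<phi> \<psi> :: "real^'n \<Rightarrow> complex" assume \<phi>: "\<phi> \<in> schwartz_space" and \<psi>: "\<psi> \<in> schwartz_space"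
    show "?v (\<lambda>x. \<phi> x + \<psi> x) = ?v \<phi> + ?v \<psi>"
      using v[OF function_space_add[OF function_space_schwartz \<phi> \<psi>]] v[OF \<phi>] v[OF \<psi>]
        Bochner_Integration.integral_add[OF int[OF \<phi>] int[OF \<psi>]]
      by (simp only: distrib_left)
  next
    fix c and \<phi> :: "real^'n \<Rightarrow> complex" assume \<phi>: "\<phi> \<in> schwartz_space"
    have "?v (\<lambda>x. c * \<phi> x) = (\<integral>\<eta>. ?G \<eta> * (c * \<phi> \<eta>) \<partial>lborel)"
      by (rule v[OF function_space_cmult[OF function_space_schwartz \<phi>]])
    also have "\<dots> = (\<integral>\<eta>. c * (?G \<eta> * \<phi> \<eta>) \<partial>lborel)" by (simp only: mult.left_commute)
    also have "\<dots> = c * ?v \<phi>" unfolding v[OF \<phi>] by (rule integral_mult_right_zero)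
    finally show "?v (\<lambda>x. c * \<phi> x) = c * ?v \<phi>" .
  qed
  obtain k where k: "0 \<le> k" "\<And>x :: real^'n. cmod (?K x) \<le> k * bracket x powr - ?s"
    by (rule alpha_kernel_le[OF \<alpha> y]) (rule that)
  obtain j :: nat where j: "\<bar>- ?s\<bar> + real CARD('n) \<le> real j" using real_arch_simple by blast
  define D where "D = C * (real (CARD('n) + 1) ^ m * (peetre_constant TYPE('n) (- ?s) * k))"
  have D: "0 \<le> D" unfolding D_def using C k(1) by simp
  have "?v \<in> tempered"
  proof (rule temperedI[OF lin D, where k="2 * j" and m=m])
    fix \<phi> :: "real^'n \<Rightarrow> complex" and B
    assume \<phi>: "\<phi> \<in> schwartz_space" and B: "\<forall>x. (1 + norm x) ^ (2 * j) * jet m \<phi> x \<le> B"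
    have "jet m \<phi> x \<le> B * bracket x powr (- \<bar>- ?s\<bar> - real CARD('n))" for x
    proof -
      have "bracket x powr (\<bar>- ?s\<bar> + real CARD('n)) * jet m \<phi> x \<le> (1 + norm x) ^ (2 * j) * jet m \<phi> x"
        by (rule mult_right_mono[OF order_trans[OF bracket_powr_mono[OF j] bracket_power_le]]) simp
      also have "\<dots> \<le> B" using B by simp
      finally have "jet m \<phi> x \<le> B / bracket x powr (\<bar>- ?s\<bar> + real CARD('n))"
        by (simp add: pos_le_divide_eq mult.commute)
      also have "\<dots> = B * bracket x powr - (\<bar>- ?s\<bar> + real CARD('n))" by (simp only: powr_minus_divide) simp
      also have "- (\<bar>- ?s\<bar> + real CARD('n)) = - \<bar>- ?s\<bar> - real CARD('n)" by simp
      finally show ?thesis .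
    qed
    from L_convolution_le[OF alpha_kernel_measurable[OF \<alpha> y] k(2) \<phi> this]
    show "cmod (?v \<phi>) \<le> D * B"
      unfolding S_convolution_kernel[OF y \<phi>] D_def by (simp add: mult_ac)
  qed
  then show ?thesis unfolding is_function_def dist_of_fun_def[of ?G] using int v by (intro conjI ballI)
qed

lemma kernel_convolvable:
  assumes y: "0 < y" and f: "f \<in> tempered"
  shows "S_convolvable (dist_of_fun (alpha_kernel \<alpha> y)) f"
  unfolding S_convolvable_def
proof (intro conjI ballI alpha_kernel_tempered[OF \<alpha> y] f)
  fix \<phi> :: "real^'n \<Rightarrow> complex" assume "\<phi> \<in> schwartz_space"
  then obtain D where "jet_bounded_form 0 D (mult_dist (check_conv f \<phi>) (dist_of_fun (alpha_kernel \<alpha> y)))"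
    using kernel_check_conv_bounded[OF y] by blast
  then show "mult_dist (check_conv f \<phi>) (dist_of_fun (alpha_kernel \<alpha> y)) \<in> DL1"
    by (rule jet_bounded_form_DL1)
qed

end

text \<open>
  Multiplication by the weight maps symbols of the order of the kernel to bounded smooth functions,
  on which \<open>f / weight\<close> acts by its extension.
\<close>

lemma weighted_DL1_functional:
  fixes f :: "'n::finite form"
  assumes \<alpha>: "-1 < \<alpha>" and f: "f \<in> weighted_DL1 \<alpha>"
  obtains m C L where "weighted_functional \<alpha> f L m C"
    "\<And>\<psi>. \<psi> \<in> symbol_space (- kernel_order TYPE('n) \<alpha>) \<Longrightarrow>
      L \<psi> = DL1_pairing (mult_dist (\<lambda>x. inverse (weight \<alpha> x)) f) (\<lambda>x. weight \<alpha> x * \<psi> x)"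
proof -
  let ?s = "kernel_order TYPE('n) \<alpha>"
  let ?g = "mult_dist (\<lambda>x. inverse (weight \<alpha> x)) f"
  obtain m C0 where g: "jet_bounded_form m C0 ?g"
    using DL1_jet_bounded_form[of ?g] f unfolding weighted_DL1_def by auto
  obtain D where D: "0 \<le> D"
    "\<And>\<phi> B. \<phi> \<in> B_space \<Longrightarrow> (\<forall>x. jet m \<phi> x \<le> B) \<Longrightarrow> cmod (extension ?g \<phi>) \<le> D * B"
    by (rule extension_bound[OF g]) (rule that)
  note lin = extension_linear[OF g]
  have w: "(\<lambda>x. weight \<alpha> x * \<psi> x) \<in> B_space" if "\<psi> \<in> symbol_space (- ?s)" for \<psi> :: "real^'n \<Rightarrow> complex"
    unfolding B_space_eq using symbol_mult[OF weight_symbol[of \<alpha>] that] by simp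
  have jw: "\<exists>W\<ge>0. \<forall>\<psi>\<in>smooth_space. \<forall>x. jet M (\<lambda>x. weight \<alpha> x * \<psi> x) x \<le> W * (bracket (x :: real^'n) powr ?s * jet M \<psi> x)" for M
  proof -
    obtain W where W: "0 \<le> W" "\<And>x :: real^'n. jet M (weight \<alpha>) x \<le> W * bracket x powr ?s"
      by (rule symbol_jet_le[OF weight_symbol]) (rule that)
    have "jet M (\<lambda>x. weight \<alpha> x * \<psi> x) x \<le> (2 ^ M * W) * (bracket x powr ?s * jet M \<psi> x)"
      if \<psi>: "\<psi> \<in> smooth_space" for \<psi> and x :: "real^'n"
    proof -
      have "jet M (\<lambda>x. weight \<alpha> x * \<psi> x) x \<le> 2 ^ M * jet M (weight \<alpha>) x * jet M \<psi> x"
        by (rule jet_mult[OF symbol_smooth[OF weight_symbol] \<psi>])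
      also have "\<dots> \<le> 2 ^ M * (W * bracket x powr ?s) * jet M \<psi> x"
        by (intro mult_right_mono mult_left_mono W(2)) auto
      finally show ?thesis by (simp add: mult_ac)
    qed
    then show ?thesis using W(1) by (intro exI[of _ "2 ^ M * W"]) auto
  qed
  have jwb: "jet M (\<lambda>x. weight \<alpha> x * \<psi> x) x \<le> W * B"
    if W: "0 \<le> W" "\<forall>\<psi>\<in>smooth_space. \<forall>x. jet M (\<lambda>x. weight \<alpha> x * \<psi> x) x \<le> W * (bracket (x :: real^'n) powr ?s * jet M \<psi> x)"
      and \<psi>: "\<psi> \<in> smooth_space" and B: "jet M \<psi> x \<le> B * bracket x powr - ?s"
    for M W B and \<psi> :: "real^'n \<Rightarrow> complex" and x
  proof -
    have "jet M (\<lambda>x. weight \<alpha> x * \<psi> x) x \<le> W * (bracket x powr ?s * jet M \<psi> x)" using W(2) \<psi> by blast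
    also have "\<dots> \<le> W * (bracket x powr ?s * (B * bracket x powr - ?s))"
      by (intro mult_left_mono B W(1)) auto
    also have "\<dots> = W * B" by (simp add: powr_minus)
    finally show ?thesis .
  qed
  obtain Wm where Wm: "0 \<le> Wm" "\<forall>\<psi>\<in>smooth_space. \<forall>x. jet m (\<lambda>x. weight \<alpha> x * \<psi> x) x \<le> Wm * (bracket (x :: real^'n) powr ?s * jet m \<psi> x)"
    using jw[of m] by auto
  define L where "L = (\<lambda>\<psi>. extension ?g (\<lambda>x. weight \<alpha> x * \<psi> x))"
  have "weighted_functional \<alpha> f L m (D * Wm)"
  proof
    show "0 \<le> D * Wm" using D(1) Wm(1) by simp
    show "linear_form_on (symbol_space (- ?s)) L"
      unfolding linear_form_on_def L_def distrib_left mult.left_commute[of "weight \<alpha> _"]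
      using linear_form_on_add[OF lin w w] linear_form_on_cmult[OF lin w] by auto
    show "cmod (L \<psi>) \<le> D * Wm * B"
      if \<psi>: "\<psi> \<in> symbol_space (- ?s)" and B: "\<And>x. jet m \<psi> x \<le> B * bracket x powr - ?s" for \<psi> B
      using D(2)[OF w[OF \<psi>] allI[OF jwb[OF Wm symbol_smooth[OF \<psi>] B]]] unfolding L_def by (simp add: mult.assoc)
    show "L \<psi> = f \<psi>" if \<psi>: "\<psi> \<in> schwartz_space" for \<psi>
    proof -
      have "L \<psi> = ?g (\<lambda>x. weight \<alpha> x * \<psi> x)"
        unfolding L_def by (rule extension_schwartz[OF g schwartz_mult_symbol[OF weight_symbol \<psi>]])
      then show ?thesis unfolding mult_dist_def by (simp add: mult.assoc[symmetric])
    qed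
    fix \<phi>s :: "nat \<Rightarrow> real^'n \<Rightarrow> complex" and \<phi>
    assume \<phi>s: "\<And>k. \<phi>s k \<in> symbol_space (- ?s)" and \<phi>: "\<phi> \<in> symbol_space (- ?s)"
      and bounded: "\<And>M. \<exists>C. \<forall>k x. jet M (\<phi>s k) x \<le> C * bracket x powr - ?s"
      and conv: "\<And>M r \<epsilon>. 0 < \<epsilon> \<Longrightarrow> \<forall>\<^sub>F k in sequentially. \<forall>x. norm x \<le> r \<longrightarrow> jet M (\<lambda>x. \<phi>s k x - \<phi> x) x \<le> \<epsilon>"
    show "(\<lambda>k. L (\<phi>s k)) \<longlonglongrightarrow> L \<phi>"
      unfolding L_def
    proof (rule Bc_dual_LIMSEQ[OF extension_in_Bc_dual[OF g] w[OF \<phi>s] w[OF \<phi>]])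
      fix M
      obtain W where W: "0 \<le> W" "\<forall>\<psi>\<in>smooth_space. \<forall>x. jet M (\<lambda>x. weight \<alpha> x * \<psi> x) x \<le> W * (bracket (x :: real^'n) powr ?s * jet M \<psi> x)"
        using jw[of M] by auto
      obtain B where B: "\<And>k x. jet M (\<phi>s k) x \<le> B * bracket x powr - ?s" using bounded[of M] by auto
      show "\<exists>C. \<forall>k x. jet M (\<lambda>x. weight \<alpha> x * \<phi>s k x) x \<le> C"
        using jwb[OF W symbol_smooth[OF \<phi>s] B] by blast
      fix r \<epsilon> :: real assume \<epsilon>: "0 < \<epsilon>"
      define E where "E = W * (1 + r\<^sup>2) powr ?s"
      have E: "0 \<le> E" unfolding E_def using W(1) by simp
      have "0 < \<epsilon> / (E + 1)" using \<epsilon> E by simp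
      from conv[OF this, of r M]
      show "\<forall>\<^sub>F k in sequentially. \<forall>x. norm x \<le> r \<longrightarrow>
          jet M (\<lambda>x. weight \<alpha> x * \<phi>s k x - weight \<alpha> x * \<phi> x) x \<le> \<epsilon>"
      proof (rule eventually_mono, intro allI impI)
        fix k and x :: "real^'n"
        assume k: "\<forall>x. norm x \<le> r \<longrightarrow> jet M (\<lambda>x. \<phi>s k x - \<phi> x) x \<le> \<epsilon> / (E + 1)" and x: "norm x \<le> r"
        have sm: "(\<lambda>x. \<phi>s k x - \<phi> x) \<in> smooth_space" by (intro smooth_diff symbol_smooth[OF \<phi>s] symbol_smooth[OF \<phi>])
        have "(norm x)\<^sup>2 \<le> r\<^sup>2" using x by (intro power_mono) auto
        then have b: "bracket x powr ?s \<le> (1 + r\<^sup>2) powr ?s"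
          unfolding bracket_def using kernel_order_gt(2)[OF \<alpha>, where 'n='n] by (intro powr_mono2) auto
        have "jet M (\<lambda>x. weight \<alpha> x * \<phi>s k x - weight \<alpha> x * \<phi> x) x = jet M (\<lambda>x. weight \<alpha> x * (\<phi>s k x - \<phi> x)) x"
          by (simp only: right_diff_distrib)
        also have "\<dots> \<le> W * (bracket x powr ?s * jet M (\<lambda>x. \<phi>s k x - \<phi> x) x)" by (rule W(2)[rule_format, OF sm])
        also have "\<dots> \<le> W * ((1 + r\<^sup>2) powr ?s * (\<epsilon> / (E + 1)))"
          using k x by (intro mult_left_mono mult_mono b W(1)) auto
        also have "\<dots> = \<epsilon> * (E / (E + 1))" unfolding E_def by simp
        also have "\<dots> \<le> \<epsilon> * 1" using \<epsilon> E by (intro mult_left_mono) (auto simp: divide_le_eq)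
        finally show "jet M (\<lambda>x. weight \<alpha> x * \<phi>s k x - weight \<alpha> x * \<phi> x) x \<le> \<epsilon>" by simp
      qed
    qed
  qed (rule \<alpha>)
  moreover have "L \<psi> = DL1_pairing ?g (\<lambda>x. weight \<alpha> x * \<psi> x)" if "\<psi> \<in> symbol_space (- ?s)" for \<psi>
    unfolding L_def DL1_pairing_eq[OF g w[OF that]] ..
  ultimately show ?thesis by (rule that)
qed

theorem theorem3p3:
  fixes f :: "(real^'n \<Rightarrow> complex) \<Rightarrow> complex" and \<alpha> :: real
  assumes "\<alpha> > -1" and "f \<in> tempered"
  shows "(f \<in> weighted_DL1 \<alpha> \<longleftrightarrow>
            (\<forall>y>0. S_convolvable f (dist_of_fun (alpha_kernel \<alpha> y)))) \<and>
         (f \<in> weighted_DL1 \<alpha> \<longrightarrow>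
            (\<forall>y>0. S_convolvable (dist_of_fun (alpha_kernel \<alpha> y)) f \<and>
               is_function (S_convolution (dist_of_fun (alpha_kernel \<alpha> y)) f)
                 (\<lambda>\<eta>. DL1_pairing (mult_dist (\<lambda>x. inverse (weight \<alpha> x)) f)
                        (\<lambda>x. weight \<alpha> x * translate \<eta> (alpha_kernel \<alpha> y) x))))"
proof (intro conjI iffI impI allI)
  fix y :: real assume y: "0 < y"
  show "S_convolvable f (dist_of_fun (alpha_kernel \<alpha> y))" if "f \<in> weighted_DL1 \<alpha>"
    by (rule weighted_DL1_convolvable[OF assms(1) that y])
  assume f: "f \<in> weighted_DL1 \<alpha>"
  obtain m C L where L: "weighted_functional \<alpha> f L m C"
    "\<And>\<psi>. \<psi> \<in> symbol_space (- kernel_order TYPE('n) \<alpha>) \<Longrightarrow>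
      L \<psi> = DL1_pairing (mult_dist (\<lambda>x. inverse (weight \<alpha> x)) f) (\<lambda>x. weight \<alpha> x * \<psi> x)"
    by (rule weighted_DL1_functional[OF assms(1) f]) (rule that)
  interpret weighted_functional \<alpha> f L m C by (rule L(1))
  show "S_convolvable (dist_of_fun (alpha_kernel \<alpha> y)) f" by (rule kernel_convolvable[OF y assms(2)])
  have "L (translate \<eta> (alpha_kernel \<alpha> y)) = DL1_pairing (mult_dist (\<lambda>x. inverse (weight \<alpha> x)) f)
      (\<lambda>x. weight \<alpha> x * translate \<eta> (alpha_kernel \<alpha> y) x)" for \<eta>
    by (rule L(2)[OF symbol_translate[OF alpha_kernel_symbol[OF assms(1) y]]])
  then show "is_function (S_convolution (dist_of_fun (alpha_kernel \<alpha> y)) f)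
      (\<lambda>\<eta>. DL1_pairing (mult_dist (\<lambda>x. inverse (weight \<alpha> x)) f)
        (\<lambda>x. weight \<alpha> x * translate \<eta> (alpha_kernel \<alpha> y) x))"
    using S_convolution_is_function[OF y] by simp
next
  assume "\<forall>y>0. S_convolvable f (dist_of_fun (alpha_kernel \<alpha> y))"
  then have "S_convolvable f (dist_of_fun (alpha_kernel \<alpha> 1))" using zero_less_one by blast
  then show "f \<in> weighted_DL1 \<alpha>" by (rule convolvable_weighted_DL1[OF assms(1)])
qed

end
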